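(* For any word $w=a_1\cdots a_n$ in letters $A,B,\dots$ and their inverses, the limit defining the forest polynomial $p(w)$ exists, and the normalized forest polynomial $\Phi(w)=e^{-\frac12\sum_{i=1}^na_i}\,p(w)$ satisfies $\Phi(w)=\tau(w)$, where $\tau(w)$ is the expectation of the corresponding word in mutually free multiplicative free Brownian motions.
   Context: Letters $A,B,\dots$ denote generators of a free group in words, and positive real numbers (commuting variables) in polynomials; in expressions such as $\sum_ia_i$ the inverse $A^{-1}$ is identified with the number $A$. A letter and its inverse count as the same letter. Non-crossing forests. For a word $w=a_1\cdots a_n$, put vertices $1,\dots,n$ in cyclic order on a circle, vertex $i$ carrying $a_i$. $\mathcal F_w$ is the set of forests $F=(T_1,\dots,T_m)$ on the vertex set $[n]$ (with $T_1,\dots,T_m$ its components, isolated vertices included) such that all vertices in the same component have the same letter, and different components do not cross, i.e. the partition of $[n]$ into vertex sets of components is non-crossing (edges of one component may cross each other). For $F\in\mathcal F_w$ with $x_k$ the letter of $T_k$, $$q(F)=\prod_{k=1}^m(-1)^{s(T_k)}\frac{x_k^{|T_k|-1}}{(|T_k|-1)!},$$ where $|T_k|$ is the number of vertices and $s(T_k)$ the number of edges of $T_k$ joining two $x_k$'s or two $x_k^{-1}$'s. Put $q(w)=\sum_{F\in\mathcal F_w}q(F)$. Forest polynomial. $w_J$ is the word obtained from $w$ by replacing each $A$ by $A_1A_2\cdots A_J$ and each $A^{-1}$ by $A_J^{-1}\cdots A_1^{-1}$ (with distinct new letters $A_1,\dots,A_J$), and similarly for every other letter. Then $$p(w)=\lim_{J\to\infty}q(w_J)\Big|_{A_1=\cdots=A_J=A/J,\;B_1=\cdots=B_J=B/J,\;\dots}.$$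 Free Brownian motion. In a non-commutative probability space $(\mathcal A,\tau)$, a free multiplicative Brownian motion is a family $(u_t)_{t\ge0}$ of unitaries with $u_0=1$ such that for $0\le t_1\le\dots\le t_n$ the increments $u_{t_2}u_{t_1}^*,\dots,u_{t_n}u_{t_{n-1}}^*$ are free, $u_tu_s^*$ having distribution $\nu_{t-s}$, where $\nu_t$ is the probability measure on the unit circle with $\int z^n\,d\nu_t=\int z^{-n}\,d\nu_t=e^{-nt/2}\sum_{k=0}^{n-1}\binom n{k+1}n^{k-1}\frac{(-t)^k}{k!}$ for $n\ge1$. Let $(u_{t,A})_t,(u_{t,B})_t,\dots$ be mutually free such families, and let $u_A:=u_{A,A}$ (time $t=A$), $u_{A^{-1}}:=u_A^{-1}$, etc. Then $\tau(w):=\tau(u_{a_1}\cdots u_{a_n})$. *)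

theory Defs
  imports "HOL-Probability.Probability"
begin

section \<open>Words and non-crossing forests\<close>

text \<open>
  The entry \<open>(a, False)\<close> stands for the letter \<open>a\<close> and \<open>(a, True)\<close> for its inverse. Words need not
  be reduced.
\<close>

type_synonym 'a word = "('a \<times> bool) list"

text \<open>
  A graph on the vertex set \<open>{..<n}\<close> is given by its set of edges, which are two-element sets of
  vertices. A closed walk traversing one edge back and forth is not a cycle, hence the length
  bound in \<open>is_cycle\<close>.
\<close>

definition is_cycle :: "nat set set \<Rightarrow> nat list \<Rightarrow> bool" where
  "is_cycle E vs \<longleftrightarrow> length vs \<ge> 3 \<and> distinct vs \<and>
     (\<forall>k < length vs. {vs ! k, vs ! (Suc k mod length vs)} \<in> E)"

definition is_forest :: "nat \<Rightarrow> nat set set \<Rightarrow> bool" where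
  "is_forest n E \<longleftrightarrow> (\<forall>e\<in>E. e \<subseteq> {..<n} \<and> card e = 2) \<and> (\<nexists>vs. is_cycle E vs)"

text \<open>The vertex sets of the connected components, singletons of isolated vertices included.\<close>

definition components_of :: "nat \<Rightarrow> nat set set \<Rightarrow> nat set set" where
  "components_of n E = {{j. j < n \<and> (i, j) \<in> {(u, v). {u, v} \<in> E}\<^sup>*} | i. i < n}"

definition non_crossing :: "nat set set \<Rightarrow> bool" where
  "non_crossing P \<longleftrightarrow> (\<forall>S\<in>P. \<forall>T\<in>P. S \<noteq> T \<longrightarrow>
     \<not> (\<exists>a b c d. a < b \<and> b < c \<and> c < d \<and> a \<in> S \<and> b \<in> T \<and> c \<in> S \<and> d \<in> T))"

definition nc_forests :: "'a word \<Rightarrow> nat set set set" where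
  "nc_forests w = {E. is_forest (length w) E \<and>
     (\<forall>T\<in>components_of (length w) E. \<forall>i\<in>T. \<forall>j\<in>T. fst (w ! i) = fst (w ! j)) \<and>
     non_crossing (components_of (length w) E)}"

definition comp_letter :: "'a word \<Rightarrow> nat set \<Rightarrow> 'a" where
  "comp_letter w T = the_elem ((\<lambda>i. fst (w ! i)) ` T)"

definition same_sign_edges :: "'a word \<Rightarrow> nat set set \<Rightarrow> nat set \<Rightarrow> nat" where
  "same_sign_edges w E T =
     card {e \<in> E. e \<subseteq> T \<and> (\<forall>i\<in>e. \<forall>j\<in>e. snd (w ! i) = snd (w ! j))}"

text \<open>The polynomials are evaluated at real values \<open>x a\<close> of the letters \<open>a\<close>.\<close>

definition forest_weight :: "('a \<Rightarrow> real) \<Rightarrow> 'a word \<Rightarrow> nat set set \<Rightarrow> real" where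
  "forest_weight x w E = (\<Prod>T\<in>components_of (length w) E.
     (- 1) ^ same_sign_edges w E T * (x (comp_letter w T) ^ (card T - 1) / fact (card T - 1)))"

definition forest_sum :: "('a \<Rightarrow> real) \<Rightarrow> 'a word \<Rightarrow> real" where
  "forest_sum x w = (\<Sum>E\<in>nc_forests w. forest_weight x w E)"

section \<open>The forest polynomial\<close>

text \<open>The new letter \<open>(a, j)\<close> with \<open>1 \<le> j \<le> J\<close> is \<open>A\<^sub>j\<close> for \<open>A = a\<close>.\<close>

definition refine_letter :: "nat \<Rightarrow> 'a \<times> bool \<Rightarrow> ('a \<times> nat) word" where
  "refine_letter J l = (if snd l then map (\<lambda>j. ((fst l, j), True)) (rev [1..<Suc J])
                        else map (\<lambda>j. ((fst l, j), False)) [1..<Suc J])"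

definition refine_word :: "nat \<Rightarrow> 'a word \<Rightarrow> ('a \<times> nat) word" where
  "refine_word J w = concat (map (refine_letter J) w)"

definition refined_forest_sum :: "('a \<Rightarrow> real) \<Rightarrow> 'a word \<Rightarrow> nat \<Rightarrow> real" where
  "refined_forest_sum x w J = forest_sum (\<lambda>(a, j). x a / real J) (refine_word J w)"

definition forest_poly :: "('a \<Rightarrow> real) \<Rightarrow> 'a word \<Rightarrow> real" where
  "forest_poly x w = lim (refined_forest_sum x w)"

definition normalized_forest_poly :: "('a \<Rightarrow> real) \<Rightarrow> 'a word \<Rightarrow> real" where
  "normalized_forest_poly x w =
     exp (- (1 / 2) * (\<Sum>l\<leftarrow>w. x (fst l))) * forest_poly x w"

section \<open>Free multiplicative Brownian motion\<close>

text \<open>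
  The exponent \<open>k - 1\<close> of \<open>n\<close> is \<open>-1\<close> for \<open>k = 0\<close>, hence the integer power.
\<close>

definition fmbm_moment :: "real \<Rightarrow> nat \<Rightarrow> real" where
  "fmbm_moment t n = exp (- real n * t / 2) *
     (\<Sum>k<n. real (n choose (k + 1)) * real n powi (int k - 1) * (- t) ^ k / fact k)"

text \<open>
  A probability measure on the unit circle is a Borel measure on the complex plane concentrated
  on the circle. The moments below determine it uniquely.
\<close>

definition is_fmbm_law :: "real \<Rightarrow> complex measure \<Rightarrow> bool" where
  "is_fmbm_law t \<nu> \<longleftrightarrow> prob_space \<nu> \<and> sets \<nu> = sets borel \<and> (AE z in \<nu>. norm z = 1) \<and>
     (\<forall>n\<ge>1. (\<integral>z. z ^ n \<partial>\<nu>) = of_real (fmbm_moment t n) \<and>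
             (\<integral>z. inverse z ^ n \<partial>\<nu>) = of_real (fmbm_moment t n))"

text \<open>
  A unital complex \<open>*\<close>-algebra with a state. The state is not assumed to be tracial, and the algebra
  carries no topology.
\<close>

locale nc_prob_space = vector_space scale
  for scale :: "complex \<Rightarrow> 'm::ring_1 \<Rightarrow> 'm" +
  fixes star :: "'m \<Rightarrow> 'm" and \<tau> :: "'m \<Rightarrow> complex"
  assumes scale_mult_left: "scale c x * y = scale c (x * y)"
    and scale_mult_right: "x * scale c y = scale c (x * y)"
    and star_add: "star (x + y) = star x + star y"
    and star_scale: "star (scale c x) = scale (cnj c) (star x)"
    and star_mult: "star (x * y) = star y * star x"
    and star_star: "star (star x) = x"
    and state_add: "\<tau> (x + y) = \<tau> x + \<tau> y"
    and state_scale: "\<tau> (scale c x) = c * \<tau> x"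
    and state_one: "\<tau> 1 = 1"
    and state_positive: "\<tau> (star x * x) \<in> \<real> \<and> 0 \<le> Re (\<tau> (star x * x))"
begin

definition unitary :: "'m \<Rightarrow> bool" where
  "unitary v \<longleftrightarrow> star v * v = 1 \<and> v * star v = 1"

inductive_set star_alg :: "'m set \<Rightarrow> 'm set" for X :: "'m set" where
  gen: "x \<in> X \<Longrightarrow> x \<in> star_alg X"
| one: "1 \<in> star_alg X"
| add: "x \<in> star_alg X \<Longrightarrow> y \<in> star_alg X \<Longrightarrow> x + y \<in> star_alg X"
| scale: "x \<in> star_alg X \<Longrightarrow> scale c x \<in> star_alg X"
| mult: "x \<in> star_alg X \<Longrightarrow> y \<in> star_alg X \<Longrightarrow> x * y \<in> star_alg X"
| star: "x \<in> star_alg X \<Longrightarrow> star x \<in> star_alg X"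

text \<open>
  Freeness of the sets \<open>X i\<close>, \<open>i \<in> I\<close>: alternating products of centred elements of the unital
  \<open>*\<close>-subalgebras that they generate are centred.
\<close>

definition free_sets :: "'i set \<Rightarrow> ('i \<Rightarrow> 'm set) \<Rightarrow> bool" where
  "free_sets I X \<longleftrightarrow> (\<forall>is ys. is \<noteq> [] \<and> length is = length ys \<and> set is \<subseteq> I \<and>
     successively (\<noteq>) is \<and> (\<forall>k < length is. ys ! k \<in> star_alg (X (is ! k)) \<and> \<tau> (ys ! k) = 0)
     \<longrightarrow> \<tau> (prod_list ys) = 0)"

text \<open>For unitary \<open>v\<close>, where \<open>star v\<close> is the inverse of \<open>v\<close>, and \<open>\<mu>\<close> on the unit circle.\<close>

definition has_distribution :: "'m \<Rightarrow> complex measure \<Rightarrow> bool" where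
  "has_distribution v \<mu> \<longleftrightarrow>
     (\<forall>n. \<tau> (v ^ n) = (\<integral>z. z ^ n \<partial>\<mu>) \<and> \<tau> (star v ^ n) = (\<integral>z. inverse z ^ n \<partial>\<mu>))"

definition free_mult_bm :: "(real \<Rightarrow> 'm) \<Rightarrow> bool" where
  "free_mult_bm u \<longleftrightarrow>
     (\<forall>t\<ge>0. unitary (u t)) \<and> u 0 = 1 \<and>
     (\<forall>ts. sorted ts \<and> (\<forall>t\<in>set ts. 0 \<le> t) \<longrightarrow>
        free_sets {k. Suc k < length ts} (\<lambda>k. {u (ts ! Suc k) * star (u (ts ! k))})) \<and>
     (\<forall>s t. 0 \<le> s \<and> s \<le> t \<longrightarrow>
        (\<exists>\<nu>. is_fmbm_law (t - s) \<nu> \<and> has_distribution (u t * star (u s)) \<nu>))"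

definition free_mult_bms :: "('a \<Rightarrow> real \<Rightarrow> 'm) \<Rightarrow> bool" where
  "free_mult_bms u \<longleftrightarrow> (\<forall>a. free_mult_bm (u a)) \<and> free_sets UNIV (\<lambda>a. u a ` {0..})"

text \<open>\<open>\<tau>(w)\<close>: the letter \<open>a\<close> is replaced by its Brownian motion at time \<open>x a\<close>.\<close>

definition word_expectation ::
  "('a \<Rightarrow> real \<Rightarrow> 'm) \<Rightarrow> ('a \<Rightarrow> real) \<Rightarrow> 'a word \<Rightarrow> complex" where
  "word_expectation u x w = \<tau> (prod_list
     (map (\<lambda>(a, inv). if inv then star (u a (x a)) else u a (x a)) w))"

end

end

theory Submission
  imports Defs
begin

text \<open>
  Grouping forests by their components writes the forest sum as a sum over non-crossing partitions of
  products of block weights that vanish on blocks with two different letters. Such a sum is a free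
  functional: the expectation of an alternating product of centred runs vanishes, because it is the
  sum over partitions in which no run is a union of blocks, and a non-crossing partition with
  one-coloured blocks always leaves some run isolated. Conversely every free functional is a
  non-crossing sum over its cumulants, so free functionals are compared through their values on
  single-letter words.

  After splitting every letter into \<open>J\<close> pieces of size \<open>y = x/J\<close>, each piece occurs a bounded number
  of times. On a word of length \<open>m\<close> in one piece with exponent sum \<open>d\<close>, the forest sum, its further
  refinements and \<open>e\<^bsup>my/2\<^esup>\<close> times the expectation of the Brownian increments all equal
  \<open>1 + y(m - d\<^sup>2)/2 + O(y\<^sup>2)\<close>. Over the \<open>O(J)\<close> pieces these errors add up to \<open>O(1/J)\<close>. Comparison with a
  further refinement gives the Cauchy property, and comparison with the increments, which are free
  and multiply to the Brownian motions, identifies the limit.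
\<close>

section \<open>Sums over non-crossing partitions\<close>

text \<open>Neither the free cumulants of multiplicative Brownian motion nor the signed tree counts
  in the forest weights are computed beyond second order. As in a limit theorem for many small free
  contributions, only the part linear in the size of a piece survives. The two linear parts agree
  for different reasons. An edge between positions with signs \<open>s\<close> and \<open>s'\<close>
  weighs \<open>- y * s * s'\<close>, and the sum over pairs is \<open>y * (m - d^2) / 2\<close>.
  For the increments, \<open>exp (m * y / 2)\<close> times the moment of order \<open>|d|\<close>
  has linear coefficient \<open>(m - |d|) / 2 - |d| * (|d| - 1) / 2\<close>, the same number.

  The obstacle is that the refined word has length proportional to J, while a comparison of two free
  functionals by recursion on the length loses a factor at each step. Cumulants localize the
  comparison: there are only O(J) monochrome sets of positions, each cumulant of order at least two
  is O(1/J), and two such cumulants differ by O(1/J^2). The normalization gives every single letter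
  the value 1, so singleton blocks cost nothing.\<close>

definition read :: "(nat \<Rightarrow> 'l) \<Rightarrow> nat set \<Rightarrow> 'l list" where
  "read lab P = map lab (sorted_list_of_set P)"

definition nc_partitions :: "nat set \<Rightarrow> nat set set set" where
  "nc_partitions P = {\<pi>. partition_on P \<pi> \<and> non_crossing \<pi>}"

text \<open>The moment-cumulant formula of free probability, with \<kappa> in the role of the
  cumulants. Arbitrary sets of positions are allowed, so that a run can be deleted from a word
  without renumbering the rest.\<close>

definition nc_sum :: "('l list \<Rightarrow> complex) \<Rightarrow> (nat \<Rightarrow> 'l) \<Rightarrow> nat set \<Rightarrow> complex" where
  "nc_sum \<kappa> lab P = (\<Sum>\<pi>\<in>nc_partitions P. \<Prod>B\<in>\<pi>. \<kappa> (read lab B))"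

definition nc_word :: "('l list \<Rightarrow> complex) \<Rightarrow> 'l list \<Rightarrow> complex" where
  "nc_word \<kappa> w = nc_sum \<kappa> (nth w) {..<length w}"

text \<open>The value of \<open>\<phi>\<close> at \<open>acc (W\<^sub>1 - \<phi> W\<^sub>1) \<cdots> (W\<^sub>r - \<phi> W\<^sub>r)\<close>, expanded linearly.\<close>

fun centred :: "('l list \<Rightarrow> complex) \<Rightarrow> 'l list \<Rightarrow> 'l list list \<Rightarrow> complex" where
  "centred \<phi> acc [] = \<phi> acc"
| "centred \<phi> acc (W # ws) = centred \<phi> (acc @ W) ws - \<phi> W * centred \<phi> acc ws"

lemma finite_nc_partitions: "finite P \<Longrightarrow> finite (nc_partitions P)"
  unfolding nc_partitions_def by (rule finite_subset[OF _ finitely_many_partition_on]) auto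

lemma sorted_list_of_set_strict_mono_image:
  assumes "finite P" "strict_mono_on P f"
  shows "sorted_list_of_set (f ` P) = map f (sorted_list_of_set P)"
proof (rule sorted_distinct_set_unique)
  have m: "mono_on P f" using assms(2) by (simp add: strict_mono_on_imp_mono_on)
  show "sorted (map f (sorted_list_of_set P))"
    unfolding sorted_map
    by (rule sorted_wrt_mono_rel[OF _ sorted_sorted_list_of_set])
      (use m assms(1) in \<open>auto dest: mono_onD\<close>)
  show "distinct (map f (sorted_list_of_set P))"
    using assms by (simp add: distinct_map strict_mono_on_imp_inj_on)
qed (use assms in auto)

lemma read_image:
  assumes "finite P" "strict_mono_on P f"
  shows "read lab (f ` P) = read (lab \<circ> f) P"
  unfolding read_def using sorted_list_of_set_strict_mono_image[OF assms] by simp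

lemma read_cong: "finite P \<Longrightarrow> (\<And>i. i \<in> P \<Longrightarrow> lab i = lab' i) \<Longrightarrow> read lab P = read lab' P"
  unfolding read_def by auto

lemma length_read [simp]: "length (read lab P) = card P"
  unfolding read_def by simp

lemma set_read [simp]: "finite P \<Longrightarrow> set (read lab P) = lab ` P"
  unfolding read_def by simp

lemma read_empty [simp]: "read lab {} = []"
  unfolding read_def by simp

lemma read_lessThan: "read lab {..<n} = map lab [0..<n]"
  unfolding read_def by (simp add: lessThan_atLeast0)

lemma read_nth_lessThan [simp]: "read (nth w) {..<length w} = w"
  by (simp add: read_lessThan map_nth)

lemma read_Un:
  assumes "finite A" "finite B" "\<And>a b. a \<in> A \<Longrightarrow> b \<in> B \<Longrightarrow> a < b"
  shows "read lab (A \<union> B) = read lab A @ read lab B"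
proof -
  have "sorted_list_of_set (A \<union> B) = sorted_list_of_set A @ sorted_list_of_set B"
    by (rule sorted_distinct_set_unique)
      (use assms in \<open>auto simp: sorted_append intro: less_imp_le dest: less_imp_neq\<close>)
  then show ?thesis by (simp add: read_def)
qed

lemma nc_partitionsD:
  assumes "\<pi> \<in> nc_partitions P" "B \<in> \<pi>"
  shows "B \<subseteq> P" "B \<noteq> {}"
  using assms unfolding nc_partitions_def partition_on_def by auto

lemma nc_partitions_finite:
  assumes "\<pi> \<in> nc_partitions P" "finite P"
  shows "finite \<pi>" "B \<in> \<pi> \<Longrightarrow> finite B"
  using assms finite_elements[of P \<pi>] nc_partitionsD[of \<pi> P B] finite_subset
  unfolding nc_partitions_def by auto

lemma nc_partitions_image:
  assumes "strict_mono_on P f" "\<pi> \<in> nc_partitions P"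
  shows "image f ` \<pi> \<in> nc_partitions (f ` P)"
proof -
  have inj: "inj_on f P" using assms(1) by (rule strict_mono_on_imp_inj_on)
  have po: "partition_on P \<pi>" and nc: "non_crossing \<pi>"
    using assms(2) by (auto simp: nc_partitions_def)
  have lt: "a < b" if "f a < f b" "a \<in> P" "b \<in> P" for a b
    using that assms(1) by (metis linorder_neqE_nat not_less_iff_gr_or_eq strict_mono_onD)
  have "non_crossing (image f ` \<pi>)"
    unfolding non_crossing_def
  proof (intro ballI impI notI, elim imageE exE conjE)
    fix S T S' T' a b c d
    assume *: "S \<noteq> T" "S = f ` S'" "T = f ` T'" "S' \<in> \<pi>" "T' \<in> \<pi>" "a < b" "b < c" "c < d"
      "a \<in> S" "b \<in> T" "c \<in> S" "d \<in> T"
    then obtain a' b' c' d' where **: "a = f a'" "b = f b'" "c = f c'" "d = f d'"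
      "a' \<in> S'" "b' \<in> T'" "c' \<in> S'" "d' \<in> T'" by blast
    have sub: "S' \<subseteq> P" "T' \<subseteq> P" using po *(4,5) by (auto simp: partition_on_def)
    have "a' < b'" "b' < c'" "c' < d'" 
      using lt[of a' b'] lt[of b' c'] lt[of c' d'] *(6-8) ** sub by auto
    moreover have "S' \<noteq> T'" using *(1-3) by auto
    ultimately show False
      using nc[unfolded non_crossing_def, rule_format, OF *(4,5)] **(5-8) by metis
  qed
  moreover have "image f ` \<pi> - {{}} = image f ` \<pi>"
    using po by (auto simp: partition_on_def)
  ultimately show ?thesis using partition_on_inj_image[OF po inj] by (simp add: nc_partitions_def)
qed

lemma nc_sum_cong:
  assumes "finite P" "\<And>i. i \<in> P \<Longrightarrow> lab i = lab' i"
  shows "nc_sum \<kappa> lab P = nc_sum \<kappa> lab' P"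
  unfolding nc_sum_def
proof (intro sum.cong prod.cong refl arg_cong[of _ _ \<kappa>] read_cong)
  fix \<pi> B i assume *: "\<pi> \<in> nc_partitions P" "B \<in> \<pi>"
  then show "finite B" using nc_partitions_finite assms(1) by blast
  assume "i \<in> B" then show "lab i = lab' i" using * nc_partitionsD assms(2) by blast
qed

text \<open>Shared by partitions and by edge sets of trees: both are families of subsets of
  \<open>V\<close>, transported along an injection of the points and back along its inverse.\<close>

lemma bij_betw_image_image:
  assumes inj: "inj_on f V"
    and A: "\<And>F. F \<in> A \<Longrightarrow> F \<subseteq> Pow V \<and> image f ` F \<in> A'"
    and A': "\<And>F. F \<in> A' \<Longrightarrow> F \<subseteq> Pow (f ` V) \<and> image (inv_into V f) ` F \<in> A"
  shows "bij_betw (image (image f)) A A'"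
proof (rule bij_betw_byWitness[where f' = "image (image (inv_into V f))"])
  let ?g = "inv_into V f"
  show "\<forall>F\<in>A. image ?g ` image f ` F = F"
  proof
    fix F assume "F \<in> A"
    then have "?g ` f ` B = B" if "B \<in> F" for B
      using A that inj by (intro inv_into_image_cancel) auto
    then have "(\<lambda>B. ?g ` f ` B) ` F = (\<lambda>B. B) ` F" by (intro image_cong refl)
    then show "image ?g ` image f ` F = F" unfolding image_image[of "image ?g"] by simp
  qed
  show "\<forall>F\<in>A'. image f ` image ?g ` F = F"
  proof
    fix F assume "F \<in> A'"
    then have "f ` ?g ` B = B" if "B \<in> F" for B
      using A' that by (intro image_inv_into_cancel[OF refl]) auto
    then have "(\<lambda>B. f ` ?g ` B) ` F = (\<lambda>B. B) ` F" by (intro image_cong refl)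
    then show "image f ` image ?g ` F = F" unfolding image_image[of "image f"] by simp
  qed
qed (use A A' in auto)

text \<open>Crossings depend only on the order of the positions, and a strictly increasing map and
  its inverse both preserve that order.\<close>

lemma nc_sum_image:
  assumes "finite P" "strict_mono_on P f"
  shows "nc_sum \<kappa> lab (f ` P) = nc_sum \<kappa> (lab \<circ> f) P"
proof -
  have inj: "inj_on f P" using assms(2) by (rule strict_mono_on_imp_inj_on)
  define g where "g = inv_into P f"
  have sg: "strict_mono_on (f ` P) g"
  proof (rule strict_mono_onI)
    fix r s assume "r \<in> f ` P" "s \<in> f ` P" "r < s"
    then obtain a b where "r = f a" "s = f b" "a \<in> P" "b \<in> P" by auto
    then show "g r < g s" unfolding g_def using inj \<open>r < s\<close> assms(2)
      by (metis inv_into_f_f linorder_neqE_nat not_less_iff_gr_or_eq strict_mono_onD)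
  qed
  have bij: "bij_betw (image (image f)) (nc_partitions P) (nc_partitions (f ` P))"
  proof (rule bij_betw_image_image[OF inj])
    show "\<pi> \<subseteq> Pow P \<and> image f ` \<pi> \<in> nc_partitions (f ` P)" if \<pi>: "\<pi> \<in> nc_partitions P" for \<pi>
      using nc_partitionsD(1)[OF \<pi>] nc_partitions_image[OF assms(2) \<pi>] by blast
    show "\<pi> \<subseteq> Pow (f ` P) \<and> image (inv_into P f) ` \<pi> \<in> nc_partitions P"
      if \<pi>: "\<pi> \<in> nc_partitions (f ` P)" for \<pi>
    proof
      show "\<pi> \<subseteq> Pow (f ` P)" using nc_partitionsD(1)[OF \<pi>] by blast
      have "g ` f ` P = P" unfolding g_def using inj by (simp add: inv_into_image_cancel)
      then show "image (inv_into P f) ` \<pi> \<in> nc_partitions P"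
        using nc_partitions_image[OF sg \<pi>] by (simp add: g_def)
    qed
  qed
  have "(\<Prod>B\<in>image f ` \<pi>. \<kappa> (read lab B)) = (\<Prod>B\<in>\<pi>. \<kappa> (read (lab \<circ> f) B))"
    if "\<pi> \<in> nc_partitions P" for \<pi>
  proof -
    have "inj_on (image f) \<pi>"
      using inj_on_image_Pow[OF inj] nc_partitionsD(1)[OF that] by (auto intro: inj_on_subset)
    moreover have "read lab (f ` B) = read (lab \<circ> f) B" if "B \<in> \<pi>" for B
    proof (rule read_image)
      show "finite B" using that \<open>\<pi> \<in> _\<close> assms(1) nc_partitions_finite by blast
      show "strict_mono_on B f"
        using nc_partitionsD(1)[OF \<open>\<pi> \<in> _\<close> that] assms(2) by (auto intro: monotone_on_subset)
    qed
    ultimately show ?thesis by (simp add: prod.reindex)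
  qed
  then show ?thesis
    unfolding nc_sum_def by (simp add: sum.reindex_bij_betw[OF bij, symmetric])
qed

lemma nc_word_read:
  assumes "finite P"
  shows "nc_word \<kappa> (read lab P) = nc_sum \<kappa> lab P"
proof -
  let ?xs = "sorted_list_of_set P"
  have "strict_mono_on {..<card P} (nth ?xs)"
    by (intro strict_mono_onI sorted_wrt_nth_less[of "(<)"]) auto
  moreover have "nth ?xs ` {..<card P} = P"
    using assms by (metis atLeast0LessThan nth_image sorted_list_of_set.length_sorted_key_list_of_set
        sorted_list_of_set.set_sorted_key_list_of_set take_all_iff order_refl)
  ultimately have "nc_sum \<kappa> lab P = nc_sum \<kappa> (lab \<circ> nth ?xs) {..<card P}"
    using nc_sum_image[of "{..<card P}" "nth ?xs" \<kappa> lab] by simp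
  also have "\<dots> = nc_sum \<kappa> (nth (read lab P)) {..<card P}"
    by (rule nc_sum_cong) (auto simp: read_def)
  finally show ?thesis by (simp add: nc_word_def)
qed

section \<open>Partitions in which a given interval is a union of blocks\<close>

definition isolated :: "nat set \<Rightarrow> nat set set \<Rightarrow> bool" where
  "isolated I \<pi> \<longleftrightarrow> (\<forall>B\<in>\<pi>. B \<inter> I = {} \<or> B \<subseteq> I)"

lemma non_crossing_subset: "non_crossing \<pi> \<Longrightarrow> \<pi>' \<subseteq> \<pi> \<Longrightarrow> non_crossing \<pi>'"
  unfolding non_crossing_def by (meson subsetD)

text \<open>\<open>I\<close> is convex relative to \<open>P\<close>. In a crossing
  \<open>a < b < c < d\<close> of a block inside \<open>I\<close> with one inside \<open>P\<close>,
  either \<open>b\<close> or \<open>c\<close> would be a point of \<open>P\<close> strictly between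
  two points of \<open>I\<close>. Hence partitions of the two parts combine without
  restriction.\<close>

lemma nc_partitions_split:
  assumes "\<And>a b i. a \<in> P \<Longrightarrow> i \<in> I \<Longrightarrow> b \<in> I \<Longrightarrow> \<not> (i < a \<and> a < b)"
  assumes disj: "P \<inter> I = {}"
  shows "bij_betw (\<lambda>(\<sigma>, \<rho>). \<sigma> \<union> \<rho>) (nc_partitions I \<times> nc_partitions P)
    {\<pi> \<in> nc_partitions (P \<union> I). isolated I \<pi>}"
proof (rule bij_betw_byWitness[where f' = "\<lambda>\<pi>. ({B\<in>\<pi>. B \<subseteq> I}, {B\<in>\<pi>. \<not> B \<subseteq> I})"])
  show "\<forall>a\<in>nc_partitions I \<times> nc_partitions P.
    (\<lambda>\<pi>. ({B \<in> \<pi>. B \<subseteq> I}, {B \<in> \<pi>. \<not> B \<subseteq> I})) ((\<lambda>(\<sigma>, \<rho>). \<sigma> \<union> \<rho>) a) = a"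
  proof
    fix p assume "p \<in> nc_partitions I \<times> nc_partitions P"
    then obtain \<sigma> \<rho> where p: "p = (\<sigma>, \<rho>)" "\<sigma> \<in> nc_partitions I" "\<rho> \<in> nc_partitions P" by auto
    have "B \<subseteq> I" if "B \<in> \<sigma>" for B
      using that nc_partitionsD p by auto
    moreover have "\<not> B \<subseteq> I" if "B \<in> \<rho>" for B
      using nc_partitionsD[OF p(3) that] disj by auto
    ultimately show "(\<lambda>\<pi>. ({B \<in> \<pi>. B \<subseteq> I}, {B \<in> \<pi>. \<not> B \<subseteq> I})) ((\<lambda>(\<sigma>, \<rho>). \<sigma> \<union> \<rho>) p) = p"
      unfolding p(1) by auto
  qed
  show "\<forall>\<pi>\<in>{\<pi> \<in> nc_partitions (P \<union> I). isolated I \<pi>}.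
    (\<lambda>(\<sigma>, \<rho>). \<sigma> \<union> \<rho>) ({B \<in> \<pi>. B \<subseteq> I}, {B \<in> \<pi>. \<not> B \<subseteq> I}) = \<pi>"
    by auto
  show "(\<lambda>(\<sigma>, \<rho>). \<sigma> \<union> \<rho>) ` (nc_partitions I \<times> nc_partitions P)
    \<subseteq> {\<pi> \<in> nc_partitions (P \<union> I). isolated I \<pi>}"
  proof clarify
    fix \<sigma> \<rho> assume s: "\<sigma> \<in> nc_partitions I" and r: "\<rho> \<in> nc_partitions P"
    have sI: "B \<subseteq> I" if "B \<in> \<sigma>" for B using s that nc_partitionsD by blast
    have rP: "B \<subseteq> P" if "B \<in> \<rho>" for B using r that nc_partitionsD by blast
    have nc: "non_crossing \<sigma>" "non_crossing \<rho>" using s r by (auto simp: nc_partitions_def)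
    have "partition_on (P \<union> I) (\<sigma> \<union> \<rho>)"
    proof (rule partition_onI)
      show "\<Union>(\<sigma> \<union> \<rho>) = P \<union> I" "{} \<notin> \<sigma> \<union> \<rho>"
        using s r by (auto simp: nc_partitions_def partition_on_def)
      fix p q assume *: "p \<in> \<sigma> \<union> \<rho>" "q \<in> \<sigma> \<union> \<rho>" "p \<noteq> q"
      have d: "disjoint \<sigma>" "disjoint \<rho>"
        using s r by (auto simp: nc_partitions_def partition_on_def)
      consider "p \<in> \<sigma>" "q \<in> \<sigma>" | "p \<in> \<rho>" "q \<in> \<rho>" | "p \<in> \<sigma>" "q \<in> \<rho>" | "p \<in> \<rho>" "q \<in> \<sigma>"
        using * by blast
      then show "disjnt p q"
      proof cases
        case 1 then show ?thesis using d(1) *(3) by (auto simp: disjnt_def dest: disjointD)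
      next
        case 2 then show ?thesis using d(2) *(3) by (auto simp: disjnt_def dest: disjointD)
      next
        case 3 then show ?thesis using sI[of p] rP[of q] disj by (auto simp: disjnt_def)
      next
        case 4 then show ?thesis using sI[of q] rP[of p] disj by (auto simp: disjnt_def)
      qed
    qed
    moreover have "non_crossing (\<sigma> \<union> \<rho>)"
      unfolding non_crossing_def
    proof (intro ballI impI notI, elim exE conjE)
      fix S T a b c d
      assume *: "S \<in> \<sigma> \<union> \<rho>" "T \<in> \<sigma> \<union> \<rho>" "S \<noteq> T" "a < b" "b < c" "c < d"
        "a \<in> S" "b \<in> T" "c \<in> S" "d \<in> T"
      consider "S \<in> \<sigma>" "T \<in> \<sigma>" | "S \<in> \<rho>" "T \<in> \<rho>" | "S \<in> \<sigma>" "T \<in> \<rho>" | "S \<in> \<rho>" "T \<in> \<sigma>"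
        using *(1,2) by blast
      then show False
      proof cases
        case 1 then show ?thesis using nc(1)[unfolded non_crossing_def, rule_format, of S T] *(3-) by metis
      next
        case 2 then show ?thesis using nc(2)[unfolded non_crossing_def, rule_format, of S T] *(3-) by metis
      next
        case 3 then show ?thesis using assms(1)[of b a c] sI[of S] rP[of T] *(4-) by auto
      next
        case 4 then show ?thesis using assms(1)[of c b d] sI[of T] rP[of S] *(4-) by auto
      qed
    qed
    moreover have "isolated I (\<sigma> \<union> \<rho>)"
      unfolding isolated_def using sI rP disj by blast
    ultimately show "\<sigma> \<union> \<rho> \<in> nc_partitions (P \<union> I) \<and> isolated I (\<sigma> \<union> \<rho>)"
      by (simp add: nc_partitions_def)
  qed
  show "(\<lambda>\<pi>. ({B \<in> \<pi>. B \<subseteq> I}, {B \<in> \<pi>. \<not> B \<subseteq> I})) ` {\<pi> \<in> nc_partitions (P \<union> I). isolated I \<pi>}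
    \<subseteq> nc_partitions I \<times> nc_partitions P"
  proof clarify
    fix \<pi> assume p: "\<pi> \<in> nc_partitions (P \<union> I)" and iso: "isolated I \<pi>"
    have u: "\<Union>\<pi> = P \<union> I" and d: "disjoint \<pi>" and e: "{} \<notin> \<pi>" and nc: "non_crossing \<pi>"
      using p by (auto simp: nc_partitions_def partition_on_def)
    have 1: "\<Union>{B \<in> \<pi>. B \<subseteq> I} = I"
      using u iso unfolding isolated_def by blast
    have 2: "\<Union>{B \<in> \<pi>. \<not> B \<subseteq> I} = P"
      using u iso disj unfolding isolated_def by blast
    show "{B \<in> \<pi>. B \<subseteq> I} \<in> nc_partitions I \<and> {B \<in> \<pi>. \<not> B \<subseteq> I} \<in> nc_partitions P"
      using 1 2 pairwise_subset[OF d, of "{B \<in> \<pi>. B \<subseteq> I}"] pairwise_subset[OF d, of "{B \<in> \<pi>. \<not> B \<subseteq> I}"]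
        e non_crossing_subset[OF nc, of "{B \<in> \<pi>. B \<subseteq> I}"]
        non_crossing_subset[OF nc, of "{B \<in> \<pi>. \<not> B \<subseteq> I}"]
      unfolding nc_partitions_def partition_on_def by simp
  qed
qed

text \<open>Weights multiply along \<open>nc_partitions_split\<close>. The runs in \<open>Js\<close>
  avoid \<open>I\<close>, so adding blocks inside \<open>I\<close> does not change which of them are
  isolated; this allows centred factors to be treated one at a time.\<close>

lemma nc_sum_isolated:
  assumes "\<And>a b i. a \<in> P \<Longrightarrow> i \<in> I \<Longrightarrow> b \<in> I \<Longrightarrow> \<not> (i < a \<and> a < b)"
  assumes disj: "P \<inter> I = {}" and fin: "finite P" "finite I"
    and Js: "\<And>J. J \<in> Js \<Longrightarrow> J \<inter> I = {}"
  shows "nc_sum \<kappa> lab I *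
      (\<Sum>\<pi>\<in>{\<pi> \<in> nc_partitions P. \<forall>J\<in>Js. \<not> isolated J \<pi>}. \<Prod>B\<in>\<pi>. \<kappa> (read lab B)) =
    (\<Sum>\<pi>\<in>{\<pi> \<in> nc_partitions (P \<union> I). isolated I \<pi> \<and> (\<forall>J\<in>Js. \<not> isolated J \<pi>)}. \<Prod>B\<in>\<pi>. \<kappa> (read lab B))"
proof -
  let ?N = "{\<pi> \<in> nc_partitions P. \<forall>J\<in>Js. \<not> isolated J \<pi>}"
  let ?M = "{\<pi> \<in> nc_partitions (P \<union> I). isolated I \<pi> \<and> (\<forall>J\<in>Js. \<not> isolated J \<pi>)}"
  let ?g = "\<lambda>\<pi>. \<Prod>B\<in>\<pi>. \<kappa> (read lab B)"
  have iso: "isolated J (\<sigma> \<union> \<rho>) \<longleftrightarrow> isolated J \<rho>" if "\<sigma> \<in> nc_partitions I" "J \<in> Js" for J \<sigma> \<rho>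
    using Js[OF that(2)] nc_partitionsD(1)[OF that(1)] unfolding isolated_def by blast
  have "bij_betw (\<lambda>(\<sigma>, \<rho>). \<sigma> \<union> \<rho>)
      {p \<in> nc_partitions I \<times> nc_partitions P. \<forall>J\<in>Js. \<not> isolated J (snd p)}
      {\<pi> \<in> {\<pi> \<in> nc_partitions (P \<union> I). isolated I \<pi>}. \<forall>J\<in>Js. \<not> isolated J \<pi>}"
    by (rule bij_betw_Collect, rule nc_partitions_split) (use assms iso in auto)
  moreover have "{p \<in> nc_partitions I \<times> nc_partitions P. \<forall>J\<in>Js. \<not> isolated J (snd p)} =
      nc_partitions I \<times> ?N" by auto
  ultimately have b: "bij_betw (\<lambda>(\<sigma>, \<rho>). \<sigma> \<union> \<rho>) (nc_partitions I \<times> ?N) ?M"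
    by (simp add: conj_assoc)
  have "?g (\<sigma> \<union> \<rho>) = ?g \<sigma> * ?g \<rho>" if "\<sigma> \<in> nc_partitions I" "\<rho> \<in> nc_partitions P" for \<sigma> \<rho>
  proof (rule prod.union_disjoint)
    show "finite \<sigma>" "finite \<rho>" using that fin nc_partitions_finite by blast+
    show "\<sigma> \<inter> \<rho> = {}"
      using nc_partitionsD[OF that(1)] nc_partitionsD(1)[OF that(2)] disj by blast
  qed
  then have "(\<Sum>p\<in>nc_partitions I \<times> ?N. ?g ((\<lambda>(\<sigma>, \<rho>). \<sigma> \<union> \<rho>) p))
      = (\<Sum>p\<in>nc_partitions I \<times> ?N. ?g (fst p) * ?g (snd p))"
    by (intro sum.cong) auto
  also have "\<dots> = nc_sum \<kappa> lab I * (\<Sum>\<pi>\<in>?N. ?g \<pi>)"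
    by (simp add: nc_sum_def sum_product sum.cartesian_product case_prod_unfold)
  finally show ?thesis unfolding sum.reindex_bij_betw[OF b, of ?g] by (rule sym)
qed

abbreviation before :: "nat set \<Rightarrow> nat set \<Rightarrow> bool" where
  "before A B \<equiv> (\<forall>a\<in>A. \<forall>b\<in>B. a < b)"

lemma before_disjoint: "before A B \<Longrightarrow> A \<inter> B = {}"
  using less_irrefl[where 'a = nat] by blast

text \<open>Inclusion-exclusion: the value at a run times the value of the word without it collects
  exactly the partitions that isolate the run. The prefix \<open>A\<close> is general because the
  induction either absorbs the next run into it or drops that run.\<close>

lemma centred_nc_word:
  assumes "finite A" "\<And>I. I \<in> set Is \<Longrightarrow> finite I" "sorted_wrt before (A # Is)"
  shows "centred (nc_word \<kappa>) (read lab A) (map (read lab) Is) =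
    (\<Sum>\<pi>\<in>{\<pi> \<in> nc_partitions (A \<union> \<Union>(set Is)). \<forall>I\<in>set Is. \<not> isolated I \<pi>}. \<Prod>B\<in>\<pi>. \<kappa> (read lab B))"
  using assms
proof (induction Is arbitrary: A)
  case Nil
  then show ?case by (simp add: nc_word_read) (simp add: nc_sum_def)
next
  case (Cons I Is)
  let ?R = "\<Union>(set Is)"
  let ?g = "\<lambda>\<pi>. \<Prod>B\<in>\<pi>. \<kappa> (read lab B)"
  have fin: "finite A" "finite I" "finite ?R" using Cons.prems by auto
  have lt: "before A I" "before I ?R" "before A ?R" using Cons.prems(3) by auto
  have 1: "centred (nc_word \<kappa>) (read lab A @ read lab I) (map (read lab) Is) =
    (\<Sum>\<pi>\<in>{\<pi> \<in> nc_partitions (A \<union> I \<union> ?R). \<forall>I\<in>set Is. \<not> isolated I \<pi>}. ?g \<pi>)"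
  proof -
    have "sorted_wrt before ((A \<union> I) # Is)" using Cons.prems(3) by auto
    from Cons.IH[OF _ _ this] show ?thesis
      using read_Un[of A I lab] fin lt(1) Cons.prems(2) by simp
  qed
  have 2: "centred (nc_word \<kappa>) (read lab A) (map (read lab) Is) =
    (\<Sum>\<pi>\<in>{\<pi> \<in> nc_partitions (A \<union> ?R). \<forall>I\<in>set Is. \<not> isolated I \<pi>}. ?g \<pi>)"
    using Cons.IH[of A] Cons.prems by auto
  have 3: "nc_sum \<kappa> lab I * (\<Sum>\<pi>\<in>{\<pi> \<in> nc_partitions (A \<union> ?R). \<forall>J\<in>set Is. \<not> isolated J \<pi>}. ?g \<pi>) =
    (\<Sum>\<pi>\<in>{\<pi> \<in> nc_partitions ((A \<union> ?R) \<union> I). isolated I \<pi> \<and> (\<forall>J\<in>set Is. \<not> isolated J \<pi>)}. ?g \<pi>)"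
  proof (rule nc_sum_isolated)
    fix a b i assume "a \<in> A \<union> ?R" "i \<in> I" "b \<in> I"
    then have "a < i \<or> b < a" using lt by blast
    then show "\<not> (i < a \<and> a < b)" by auto
  next
    show "(A \<union> ?R) \<inter> I = {}" using before_disjoint[OF lt(1)] before_disjoint[OF lt(2)] by blast
    fix J assume "J \<in> set Is" then show "J \<inter> I = {}" using before_disjoint[OF lt(2)] by blast
  qed (use fin in auto)
  have eq: "(A \<union> ?R) \<union> I = A \<union> I \<union> ?R" "A \<union> \<Union>(set (I # Is)) = A \<union> I \<union> ?R" by auto
  have fin2: "finite (nc_partitions (A \<union> I \<union> ?R))" using fin by (simp add: finite_nc_partitions)
  have "{\<pi> \<in> nc_partitions (A \<union> I \<union> ?R). \<forall>J\<in>set (I # Is). \<not> isolated J \<pi>} =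
     {\<pi> \<in> nc_partitions (A \<union> I \<union> ?R). \<forall>I\<in>set Is. \<not> isolated I \<pi>} -
     {\<pi> \<in> nc_partitions (A \<union> I \<union> ?R). isolated I \<pi> \<and> (\<forall>J\<in>set Is. \<not> isolated J \<pi>)}" by auto
  then have "(\<Sum>\<pi>\<in>{\<pi> \<in> nc_partitions (A \<union> I \<union> ?R). \<forall>J\<in>set (I # Is). \<not> isolated J \<pi>}. ?g \<pi>)
     = (\<Sum>\<pi>\<in>{\<pi> \<in> nc_partitions (A \<union> I \<union> ?R). \<forall>I\<in>set Is. \<not> isolated I \<pi>}. ?g \<pi>) -
       (\<Sum>\<pi>\<in>{\<pi> \<in> nc_partitions (A \<union> I \<union> ?R). isolated I \<pi> \<and> (\<forall>J\<in>set Is. \<not> isolated J \<pi>)}. ?g \<pi>)"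
    by (simp only:) (rule sum_diff, use fin2 in auto)
  then show ?case unfolding list.map centred.simps eq(2) nc_word_read[OF fin(2)] 1 2 3 eq(1) by (rule sym)
qed

section \<open>Free functionals on words\<close>

definition monochrome :: "('l \<Rightarrow> 'k) \<Rightarrow> 'l list \<Rightarrow> bool" where
  "monochrome f s \<longleftrightarrow> (\<forall>a\<in>set s. \<forall>b\<in>set s. f a = f b)"

lemma monochromeD: "monochrome f s \<Longrightarrow> a \<in> set s \<Longrightarrow> b \<in> set s \<Longrightarrow> f a = f b"
  unfolding monochrome_def by blast

lemma monochrome_Nil: "monochrome f []"
  by (simp add: monochrome_def)

definition alternating :: "('l \<Rightarrow> 'k) \<Rightarrow> 'l list list \<Rightarrow> bool" where
  "alternating f ws \<longleftrightarrow> (\<forall>W\<in>set ws. W \<noteq> [] \<and> monochrome f W) \<and>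
     successively (\<lambda>V W. f (hd V) \<noteq> f (hd W)) ws"

text \<open>Freeness tested on monomials. This is enough because a centred element is a linear
  combination of centred monomials, and it makes sense for functions on words, without any
  algebra.\<close>

definition free_functional :: "('l \<Rightarrow> 'k) \<Rightarrow> ('l list \<Rightarrow> complex) \<Rightarrow> bool" where
  "free_functional f \<phi> \<longleftrightarrow> \<phi> [] = 1 \<and>
     (\<forall>ws. ws \<noteq> [] \<longrightarrow> alternating f ws \<longrightarrow> centred \<phi> [] ws = 0)"

lemma exists_runs: "\<exists>ws. concat ws = w \<and> alternating f ws"
proof (induction w)
  case Nil
  then show ?case by (intro exI[of _ "[]"]) (simp add: alternating_def)
next
  case (Cons a w)
  then obtain ws where ws: "concat ws = w" "alternating f ws" by blast
  show ?case
  proof (cases ws)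
    case Nil
    then show ?thesis using ws
      by (intro exI[of _ "[[a]]"]) (auto simp: alternating_def monochrome_def)
  next
    case (Cons V vs)
    then have V: "V \<noteq> []" "monochrome f V" using ws by (auto simp: alternating_def)
    show ?thesis
    proof (cases "f a = f (hd V)")
      case True
      have "f b = f a" if "b \<in> set (a # V)" for b
        using that V hd_in_set[of V] True unfolding monochrome_def by (metis set_ConsD)
      then have "monochrome f (a # V)" unfolding monochrome_def by metis
      then show ?thesis using ws Cons True
        by (intro exI[of _ "(a # V) # vs"]) (auto simp: alternating_def successively_Cons)
    next
      case False
      moreover have "monochrome f [a]" by (simp add: monochrome_def)
      ultimately show ?thesis using ws Cons
        by (intro exI[of _ "[a] # ws"]) (simp add: alternating_def successively_Cons)
    qed
  qed
qed

text \<open>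
  An innermost pair of distinct runs joined by a block encloses a run, and by non-crossingness every
  block leaving the latter would join a closer pair of runs.
\<close>

lemma exists_isolated:
  assumes \<pi>: "\<pi> \<in> nc_partitions (\<Union>(set Is))" and "Is \<noteq> []" and sorted: "sorted_wrt before Is"
    and ne: "\<And>I. I \<in> set Is \<Longrightarrow> I \<noteq> {}"
    and col: "\<And>k i. k < length Is \<Longrightarrow> i \<in> Is ! k \<Longrightarrow> col i = c k"
    and alt: "\<And>k. Suc k < length Is \<Longrightarrow> c k \<noteq> c (Suc k)"
    and mono: "\<And>B i j. B \<in> \<pi> \<Longrightarrow> i \<in> B \<Longrightarrow> j \<in> B \<Longrightarrow> col i = col j"
  shows "\<exists>I\<in>set Is. isolated I \<pi>"
proof (rule ccontr)
  assume no: "\<not> ?thesis"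
  have lt: "p < q" if "k < l" "l < length Is" "p \<in> Is ! k" "q \<in> Is ! l" for p q k l
    using sorted_wrt_nth_less[OF sorted that(1,2)] that(3,4) by blast
  have leave: "\<exists>p q l B. p \<in> Is ! k \<and> q \<in> Is ! l \<and> l < length Is \<and> l \<noteq> k \<and> B \<in> \<pi> \<and> p \<in> B \<and> q \<in> B"
    if k: "k < length Is" for k
  proof -
    have "\<not> isolated (Is ! k) \<pi>" using no k by auto
    then obtain B p q where B: "B \<in> \<pi>" "p \<in> B" "p \<in> Is ! k" "q \<in> B" "q \<notin> Is ! k"
      unfolding isolated_def by blast
    then have "q \<in> \<Union>(set Is)" using nc_partitionsD(1)[OF \<pi>] by blast
    then obtain l where "l < length Is" "q \<in> Is ! l" by (auto simp: in_set_conv_nth)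
    then show ?thesis using B by metis
  qed
  define Q where "Q d \<longleftrightarrow> (\<exists>k l p q B. k < l \<and> l < length Is \<and> l - k = d \<and> p \<in> Is ! k \<and>
     q \<in> Is ! l \<and> B \<in> \<pi> \<and> p \<in> B \<and> q \<in> B)" for d
  have Q: "Q (if k < l then l - k else k - l)"
    if "k < length Is" "l < length Is" "k \<noteq> l" "p \<in> Is ! k" "q \<in> Is ! l" "B \<in> \<pi>" "p \<in> B" "q \<in> B"
    for k l p q B
  proof (cases "k < l")
    case True
    then show ?thesis using that(2,4-8) unfolding Q_def if_P[OF True] by blast
  next
    case False
    then have "l < k" using that(3) by simp
    then show ?thesis using that(1,4-8) unfolding Q_def if_not_P[OF False] by blast
  qed
  obtain p\<^sub>0 q\<^sub>0 l\<^sub>0 B\<^sub>0 where "p\<^sub>0 \<in> Is ! 0" "q\<^sub>0 \<in> Is ! l\<^sub>0" "l\<^sub>0 < length Is" "l\<^sub>0 \<noteq> 0" "B\<^sub>0 \<in> \<pi>"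
    "p\<^sub>0 \<in> B\<^sub>0" "q\<^sub>0 \<in> B\<^sub>0" using leave[of 0] \<open>Is \<noteq> []\<close> by auto
  then have "\<exists>d. Q d" using Q[of 0 l\<^sub>0 p\<^sub>0 q\<^sub>0 B\<^sub>0] \<open>Is \<noteq> []\<close> by auto
  define d where "d = (LEAST d. Q d)"
  have d: "Q d" unfolding d_def by (rule LeastI_ex) fact
  have min: "\<not> Q d'" if "d' < d" for d'
    using that unfolding d_def by (rule not_less_Least)
  from d obtain k l p q B where *: "k < l" "l < length Is" "l - k = d" "p \<in> Is ! k" "q \<in> Is ! l"
    "B \<in> \<pi>" "p \<in> B" "q \<in> B" unfolding Q_def by blast
  have ckl: "c k = c l" using mono[OF *(6-8)] col[of k p] col[of l q] *(1,2,4,5) by simp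
  \<comment> \<open>Neighbouring runs differ in colour, so some run lies strictly between the two; a
    block leaving run \<open>Suc k\<close> cannot be \<open>B\<close>, whose colour is that of run
    \<open>k\<close>.\<close>
  have "l \<noteq> Suc k" using alt[of k] ckl *(2) by auto
  then have k1: "Suc k < l" using *(1) by simp
  then obtain p' q' m B' where **: "p' \<in> Is ! Suc k" "q' \<in> Is ! m" "m < length Is" "m \<noteq> Suc k"
    "B' \<in> \<pi>" "p' \<in> B'" "q' \<in> B'" using leave[of "Suc k"] *(2) by auto
  have "B' \<noteq> B"
  proof
    assume "B' = B"
    then have "col p' = col p" using mono[OF *(6), of p' p] *(7) **(6) by simp
    then show False using alt[of k] col[of k p] col[of "Suc k" p'] *(2,4) **(1) k1 by simp
  qed
  have pp: "p < p'" "p' < q" using lt[of k "Suc k" p p'] lt[of "Suc k" l p' q] *(2,4,5) **(1) k1 by simp_all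
  have nc: "non_crossing \<pi>" and disj: "disjoint \<pi>"
    using \<pi> by (auto simp: nc_partitions_def partition_on_def)
  have "B \<inter> B' = {}" using disj \<open>B' \<noteq> B\<close> *(6) **(5) by (metis disjointD)
  then have "q' \<noteq> p" "q' \<noteq> q" using *(7,8) **(7) by auto
  have "\<not> q' < p"
    using nc[unfolded non_crossing_def, rule_format, OF **(5) *(6) \<open>B' \<noteq> B\<close>] pp *(7,8) **(6,7) by blast
  moreover have "\<not> q < q'"
    using nc[unfolded non_crossing_def, rule_format, OF *(6) **(5)] \<open>B' \<noteq> B\<close> pp *(7,8) **(6,7) by blast
  ultimately have "p < q'" "q' < q" using \<open>q' \<noteq> p\<close> \<open>q' \<noteq> q\<close> by auto
  \<comment> \<open>The block leaving run \<open>Suc k\<close> is confined between \<open>p\<close>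
    and \<open>q\<close>, so the run \<open>m\<close> that it reaches satisfies
    \<open>k \<le> m \<le> l\<close> and is closer to \<open>Suc k\<close> than the minimal distance
    \<open>d\<close>.\<close>
  then have "\<not> m < k" "\<not> l < m"
    using lt[of m k q' p] lt[of l m q q'] *(1,2,4,5) **(2,3) by (auto dest: less_asym)
  then have "(if Suc k < m then m - Suc k else Suc k - m) < d" using *(1,3) k1 **(4) by auto
  then show False 
    using min Q[OF _ **(3) **(4)[symmetric] **(1,2,5,6,7)] k1 *(2) by auto
qed

fun intervals :: "nat \<Rightarrow> 'l list list \<Rightarrow> nat set list" where
  "intervals k [] = []"
| "intervals k (W # ws) = {k..<k + length W} # intervals (k + length W) ws"

lemma length_intervals [simp]: "length (intervals k ws) = length ws"
  by (induction k ws rule: intervals.induct) auto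

lemma Union_intervals: "\<Union>(set (intervals k ws)) = {k..<k + length (concat ws)}"
  by (induction k ws rule: intervals.induct) auto

lemma sorted_wrt_intervals: "sorted_wrt before (intervals k ws)"
proof (induction k ws rule: intervals.induct)
  case (2 k W ws)
  have "\<forall>I\<in>set (intervals (k + length W) ws). before {k..<k + length W} I"
  proof (intro ballI)
    fix I a b assume "I \<in> set (intervals (k + length W) ws)" "b \<in> I" and a: "a \<in> {k..<k + length W}"
    then have "b \<in> {k + length W..<k + length W + length (concat ws)}"
      using Union_intervals[of "k + length W" ws] by blast
    then show "a < b" using a by simp
  qed
  with 2 show ?case by simp
qed simp

lemma read_intervals:
  assumes "\<And>i. i < length (concat ws) \<Longrightarrow> lab (k + i) = concat ws ! i"
  shows "map (read lab) (intervals k ws) = ws"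
  using assms
proof (induction k ws rule: intervals.induct)
  case (2 k W ws)
  have "read lab {k..<k + length W} = W"
    unfolding read_def
    by (rule nth_equalityI) (use 2(2) in \<open>auto simp: nth_append\<close>)
  moreover have "map (read lab) (intervals (k + length W) ws) = ws"
  proof (rule 2(1))
    fix i assume "i < length (concat ws)"
    then show "lab (k + length W + i) = concat ws ! i"
      using 2(2)[of "length W + i"] by (simp add: add.assoc)
  qed
  ultimately show ?case by simp
qed simp

lemma nc_word_Nil [simp]: "nc_word \<kappa> [] = 1"
proof -
  have "nc_partitions {} = {{}}"
    by (auto simp: nc_partitions_def partition_on_empty non_crossing_def)
  then show ?thesis by (simp add: nc_word_def nc_sum_def)
qed

theorem free_functional_nc_word:
  assumes "\<And>s. \<not> monochrome f s \<Longrightarrow> \<kappa> s = 0"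
  shows "free_functional f (nc_word \<kappa>)"
  unfolding free_functional_def
proof (intro conjI allI impI)
  fix ws :: "'a list list" assume ne: "ws \<noteq> []" and alt: "alternating f ws"
  define w where "w = concat ws"
  define Is where "Is = intervals 0 ws"
  have ws: "map (read (nth w)) Is = ws" unfolding Is_def w_def by (rule read_intervals) simp
  have U: "\<Union>(set Is) = {..<length w}" unfolding Is_def w_def Union_intervals by auto
  have fin: "finite I" if "I \<in> set Is" for I using that U by (metis Union_upper finite_lessThan finite_subset)
  have sorted: "sorted_wrt before ({} # Is)" unfolding Is_def using sorted_wrt_intervals by auto
  have len: "length Is = length ws" by (simp add: Is_def)
  have "centred (nc_word \<kappa>) [] ws =
    (\<Sum>\<pi>\<in>{\<pi> \<in> nc_partitions (\<Union>(set Is)). \<forall>I\<in>set Is. \<not> isolated I \<pi>}. \<Prod>B\<in>\<pi>. \<kappa> (read (nth w) B))"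
    using centred_nc_word[of "{}" Is \<kappa> "nth w"] fin sorted ws by simp
  also have "\<dots> = 0"
  proof (rule sum.neutral, rule ballI)
    fix \<pi> assume "\<pi> \<in> {\<pi> \<in> nc_partitions (\<Union>(set Is)). \<forall>I\<in>set Is. \<not> isolated I \<pi>}"
    then have \<pi>: "\<pi> \<in> nc_partitions (\<Union>(set Is))" and no: "\<not> (\<exists>I\<in>set Is. isolated I \<pi>)" by auto
    have finU: "finite (\<Union>(set Is))" using U by simp
    show "(\<Prod>B\<in>\<pi>. \<kappa> (read (nth w) B)) = 0"
    proof (rule ccontr)
      assume "\<not> ?thesis"
      then have nz: "\<kappa> (read (nth w) B) \<noteq> 0" if "B \<in> \<pi>" for B
        using that nc_partitions_finite(1)[OF \<pi> finU] by (meson prod_zero)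
      have "\<exists>I\<in>set Is. isolated I \<pi>"
      proof (rule exists_isolated[OF \<pi>, where col = "\<lambda>i. f (w ! i)" and c = "\<lambda>k. f (hd (ws ! k))"])
        show "Is \<noteq> []" using len ne by auto
        show "sorted_wrt before Is" using sorted by simp
        have rk: "read (nth w) (Is ! k) = ws ! k" if "k < length Is" for k
          using ws that by (metis nth_map)
        show "I \<noteq> {}" if "I \<in> set Is" for I
          using that rk alt len unfolding alternating_def
          by (metis in_set_conv_nth read_empty)
        fix k i assume k: "k < length Is"
        then have W: "ws ! k \<in> set ws" using len by simp
        assume "i \<in> Is ! k"
        then have "w ! i \<in> set (ws ! k)" using rk[OF k] fin k by (metis image_eqI nth_mem set_read)
        then show "f (w ! i) = f (hd (ws ! k))"
          using alt W unfolding alternating_def monochrome_def by (metis hd_in_set)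
      next
        fix k assume "Suc k < length Is"
        then show "f (hd (ws ! k)) \<noteq> f (hd (ws ! Suc k))"
          using alt len unfolding alternating_def successively_conv_nth by auto
      next
        fix B i j assume B: "B \<in> \<pi>" "i \<in> B" "j \<in> B"
        have "monochrome f (read (nth w) B)" using nz[OF B(1)] assms[of "read (nth w) B"] by argo
        then show "f (w ! i) = f (w ! j)"
          by (rule monochromeD) (use B(2,3) nc_partitions_finite(2)[OF \<pi> finU B(1)] in auto)
      qed
      then show False using no by blast
    qed
  qed
  finally show "centred (nc_word \<kappa>) [] ws = 0" .
qed simp

lemma centred_cong:
  assumes "\<And>s. length s \<le> length acc + length (concat ws) \<Longrightarrow> \<phi> s = \<psi> s"
  shows "centred \<phi> acc ws = centred \<psi> acc ws"
  using assms
proof (induction ws arbitrary: acc)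
  case (Cons W ws)
  have "centred \<phi> (acc @ W) ws = centred \<psi> (acc @ W) ws" "centred \<phi> acc ws = centred \<psi> acc ws"
    by (rule Cons.IH, rule Cons.prems, simp)+
  then show ?case using Cons.prems by simp
qed simp

text \<open>The full concatenation occurs once in the expansion, with coefficient 1, and all other
  words are shorter. The last hypothesis ensures that the subtracted factors \<open>\<phi> W\<close>
  are values at shorter words too.\<close>

lemma centred_diff:
  assumes "\<And>s. length s < length acc + length (concat ws) \<Longrightarrow> \<phi> s = \<psi> s"
    and "\<And>W. W \<in> set ws \<Longrightarrow> W \<noteq> []" and "acc \<noteq> [] \<or> length ws \<ge> 2"
  shows "centred \<phi> acc ws - centred \<psi> acc ws = \<phi> (acc @ concat ws) - \<psi> (acc @ concat ws)"
  using assms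
proof (induction ws arbitrary: acc)
  case (Cons W ws)
  have W: "W \<noteq> []" using Cons.prems by simp
  have "length W < length acc + length (concat (W # ws))"
  proof (cases "acc = []")
    case True
    then obtain V vs where "ws = V # vs" using Cons.prems(3) by (cases ws) auto
    then show ?thesis using Cons.prems(2) by auto
  qed simp
  then have "\<phi> W = \<psi> W" using Cons.prems(1) by blast
  moreover have "centred \<phi> acc ws = centred \<psi> acc ws"
    by (rule centred_cong) (use Cons.prems(1) W in \<open>auto simp: le_less_trans\<close>)
  moreover have "centred \<phi> (acc @ W) ws - centred \<psi> (acc @ W) ws =
      \<phi> ((acc @ W) @ concat ws) - \<psi> ((acc @ W) @ concat ws)"
    by (rule Cons.IH) (use Cons.prems W in \<open>auto simp: add.assoc\<close>)
  ultimately show ?case by simp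
qed simp

text \<open>Both centred values over the runs of \<open>w\<close> vanish, so
  \<open>centred_diff\<close> and induction on the length force equality at \<open>w\<close>. Words
  with at most one run are monochrome and fall to the hypothesis.\<close>

lemma free_functional_eqI:
  assumes \<phi>: "free_functional f \<phi>" and \<psi>: "free_functional f \<psi>"
    and mono: "\<And>s. monochrome f s \<Longrightarrow> \<phi> s = \<psi> s"
  shows "\<phi> w = \<psi> w"
proof (induction w rule: length_induct)
  case (1 w)
  obtain ws where ws: "concat ws = w" "alternating f ws" using exists_runs by blast
  show ?case
  proof (cases "length ws \<ge> 2")
    case True
    have "centred \<phi> [] ws - centred \<psi> [] ws = \<phi> ([] @ concat ws) - \<psi> ([] @ concat ws)"
      by (rule centred_diff) (use 1 ws True in \<open>auto simp: alternating_def\<close>)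
    moreover have "ws \<noteq> []" using True by auto
    ultimately show ?thesis using \<phi> \<psi> ws by (simp add: free_functional_def)
  next
    case False
    then have "monochrome f w" using ws
      by (cases ws; cases "tl ws") (auto simp: alternating_def monochrome_Nil)
    then show ?thesis by (rule mono)
  qed
qed

section \<open>Free cumulants\<close>

lemma nc_partitions_card_less:
  assumes "\<pi> \<in> nc_partitions P - {{P}}" "B \<in> \<pi>" "finite P"
  shows "card B < card P"
proof -
  have po: "partition_on P \<pi>" and "\<pi> \<noteq> {P}" using assms(1) by (auto simp: nc_partitions_def)
  have "B \<noteq> P"
  proof
    assume "B = P"
    have "C = P" if "C \<in> \<pi>" for C
    proof (rule ccontr)
      assume "C \<noteq> P"
      then have "C \<inter> P = {}" using po that assms(2) \<open>B = P\<close> unfolding partition_on_def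
        by (metis disjointD)
      moreover have "C \<subseteq> P" "C \<noteq> {}" using po that unfolding partition_on_def by auto
      ultimately show False by blast
    qed
    then show False using \<open>\<pi> \<noteq> {P}\<close> assms(2) \<open>B = P\<close> by blast
  qed
  then show ?thesis using assms nc_partitionsD(1)[of \<pi> P B]
    by (intro psubset_card_mono) auto
qed

text \<open>Solves the moment-cumulant formula for the term of the one-block partition. Colours are
  ignored: on a monochrome word all blocks are monochrome anyway.\<close>

function cumulant :: "('l list \<Rightarrow> complex) \<Rightarrow> 'l list \<Rightarrow> complex" where
  "cumulant \<phi> s = \<phi> s - (\<Sum>\<pi>\<in>nc_partitions {..<length s} - {{{..<length s}}}.
     \<Prod>B\<in>\<pi>. cumulant \<phi> (read (nth s) B))"
  by auto
termination
proof (relation "inv_image less_than (length \<circ> snd)")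
  fix \<phi> :: "'l list \<Rightarrow> complex" and s :: "'l list" and \<pi> B
  assume "\<pi> \<in> nc_partitions {..<length s} - {{{..<length s}}}" "B \<in> \<pi>"
  from nc_partitions_card_less[OF this]
  show "((\<phi>, read (nth s) B), (\<phi>, s)) \<in> inv_image less_than (length \<circ> snd)" by simp
qed simp

declare cumulant.simps [simp del]

lemma whole_nc_partition: "P \<noteq> {} \<Longrightarrow> {P} \<in> nc_partitions P"
  by (auto simp: nc_partitions_def partition_on_space non_crossing_def)

lemma nc_word_split:
  assumes "s \<noteq> []"
  shows "nc_word \<kappa> s = \<kappa> s + (\<Sum>\<pi>\<in>nc_partitions {..<length s} - {{{..<length s}}}.
     \<Prod>B\<in>\<pi>. \<kappa> (read (nth s) B))"
  unfolding nc_word_def nc_sum_def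
  using sum.remove[OF finite_nc_partitions whole_nc_partition, of "{..<length s}"
      "\<lambda>\<pi>. \<Prod>B\<in>\<pi>. \<kappa> (read (nth s) B)"] assms by (simp add: lessThan_empty_iff)

text \<open>Mixed cumulants are declared to be zero; that the moment-cumulant formula still returns
  a free \<phi> is the content of \<open>free_functional_eq_nc_word\<close>.\<close>

definition free_cumulant :: "('l \<Rightarrow> 'k) \<Rightarrow> ('l list \<Rightarrow> complex) \<Rightarrow> 'l list \<Rightarrow> complex" where
  "free_cumulant f \<phi> s = (if monochrome f s then cumulant \<phi> s else 0)"

lemma monochrome_read:
  assumes "monochrome f s" "B \<subseteq> {..<length s}"
  shows "monochrome f (read (nth s) B)"
proof -
  have "finite B" using assms(2) finite_subset by blast
  then have "set (read (nth s) B) \<subseteq> set s" using assms(2) by auto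
  then show ?thesis using assms(1) unfolding monochrome_def by blast
qed

text \<open>Both sides are free functionals, so only monochrome words have to be compared, and there
  the formula is the defining recursion of \<open>cumulant\<close>.\<close>

theorem free_functional_eq_nc_word:
  assumes "free_functional f \<phi>"
  shows "\<phi> w = nc_word (free_cumulant f \<phi>) w"
proof (rule free_functional_eqI[OF assms])
  show "free_functional f (nc_word (free_cumulant f \<phi>))"
    by (rule free_functional_nc_word) (simp add: free_cumulant_def)
  fix s assume s: "monochrome f s"
  show "\<phi> s = nc_word (free_cumulant f \<phi>) s"
  proof (cases "s = []")
    case True
    then show ?thesis using assms by (simp add: free_functional_def)
  next
    case False
    have "(\<Sum>\<pi>\<in>nc_partitions {..<length s} - {{{..<length s}}}. \<Prod>B\<in>\<pi>. free_cumulant f \<phi> (read (nth s) B))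
      = (\<Sum>\<pi>\<in>nc_partitions {..<length s} - {{{..<length s}}}. \<Prod>B\<in>\<pi>. cumulant \<phi> (read (nth s) B))"
      using s monochrome_read[OF s] nc_partitionsD(1)
      by (intro sum.cong prod.cong refl) (auto simp: free_cumulant_def)
    then show ?thesis
      using s by (simp add: nc_word_split[OF False] cumulant.simps[of \<phi> s] free_cumulant_def)
  qed
qed

section \<open>Stability of free cumulants\<close>

text \<open>
  A partition is determined by its blocks with at least two elements. Hence sums over partitions are
  bounded by sums over all families of such sets, which factorize.
\<close>

definition big_blocks :: "nat set set \<Rightarrow> nat set set" where
  "big_blocks \<pi> = {B\<in>\<pi>. card B \<ge> 2}"

lemma nc_partitions_small_block:
  assumes \<pi>: "\<pi> \<in> nc_partitions P" "B \<in> \<pi>" and "finite P" "\<not> card B \<ge> 2"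
  obtains x where "x \<in> P" "B = {x}"
proof -
  have "finite B" using nc_partitions_finite(2)[OF \<pi>(1)] assms by simp
  then have "card B = 1" using assms(4) nc_partitionsD(2)[OF \<pi>] card_gt_0_iff[of B] by linarith
  then show ?thesis using that nc_partitionsD(1)[OF \<pi>] by (auto simp: card_1_singleton_iff)
qed

lemma inj_on_big_blocks:
  assumes "finite P"
  shows "inj_on big_blocks (nc_partitions P)"
proof (rule inj_onI)
  have sub: "\<pi> \<subseteq> \<rho>" if p: "\<pi> \<in> nc_partitions P" and r: "\<rho> \<in> nc_partitions P" and e: "big_blocks \<pi> = big_blocks \<rho>" for \<pi> \<rho>
  proof
    fix B assume B: "B \<in> \<pi>"
    show "B \<in> \<rho>"
    proof (cases "card B \<ge> 2")
      case True
      then show ?thesis using B e by (auto simp: big_blocks_def)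
    next
      case False
      then obtain x where x: "x \<in> P" "B = {x}"
        using nc_partitions_small_block[OF p B assms False] by blast
      then obtain C where C: "C \<in> \<rho>" "x \<in> C"
        using r by (auto simp: nc_partitions_def partition_on_def)
      have "\<not> card C \<ge> 2"
      proof
        assume "card C \<ge> 2"
        then have "C \<in> \<pi>" "C \<noteq> B" using C e x by (auto simp: big_blocks_def)
        moreover have "disjoint \<pi>" using p by (simp add: nc_partitions_def partition_on_def)
        ultimately have "C \<inter> B = {}" using B by (metis disjointD)
        then show False using C(2) x(2) by simp
      qed
      obtain y where "C = {y}"
        using nc_partitions_small_block[OF r C(1) assms \<open>\<not> card C \<ge> 2\<close>] by blast
      then have "C = B" using C x by simp
      then show ?thesis using C by simp
    qed
  qed
  fix \<pi> \<rho> assume "\<pi> \<in> nc_partitions P" "\<rho> \<in> nc_partitions P" "big_blocks \<pi> = big_blocks \<rho>"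
  then show "\<pi> = \<rho>" using sub[of \<pi> \<rho>] sub[of \<rho> \<pi>] by auto
qed

definition big_families :: "nat set \<Rightarrow> nat set set set" where
  "big_families P = big_blocks ` nc_partitions P"

lemma nc_sum_big_families:
  assumes P: "finite P" and one: "\<And>i. i \<in> P \<Longrightarrow> \<kappa> [lab i] = 1"
  shows "nc_sum \<kappa> lab P = (\<Sum>S\<in>big_families P. \<Prod>B\<in>S. \<kappa> (read lab B))"
proof -
  have "(\<Prod>B\<in>big_blocks \<pi>. \<kappa> (read lab B)) = (\<Prod>B\<in>\<pi>. \<kappa> (read lab B))"
    if \<pi>: "\<pi> \<in> nc_partitions P" for \<pi>
  proof (rule prod.mono_neutral_left)
    show "finite \<pi>" using \<pi> P by (rule nc_partitions_finite)
    show "\<forall>B\<in>\<pi> - big_blocks \<pi>. \<kappa> (read lab B) = 1"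
    proof
      fix B assume B: "B \<in> \<pi> - big_blocks \<pi>"
      then have "B \<in> \<pi>" "\<not> card B \<ge> 2" by (auto simp: big_blocks_def)
      then obtain x where "x \<in> P" "B = {x}" by (rule nc_partitions_small_block[OF \<pi> _ P])
      then show "\<kappa> (read lab B) = 1" using one by (simp add: read_def)
    qed
  qed (auto simp: big_blocks_def)
  then show ?thesis unfolding big_families_def nc_sum_def
    by (simp add: sum.reindex[OF inj_on_big_blocks[OF P]])
qed

lemma big_familiesD:
  assumes "S \<in> big_families P" "B \<in> S"
  shows "B \<subseteq> P" "card B \<ge> 2"
proof -
  obtain \<pi> where "\<pi> \<in> nc_partitions P" "S = big_blocks \<pi>"
    using assms(1) by (auto simp: big_families_def)
  then show "B \<subseteq> P" "card B \<ge> 2"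
    using nc_partitionsD(1)[of \<pi> P B] assms(2) by (simp_all add: big_blocks_def)
qed

lemma finite_big_family: "finite P \<Longrightarrow> S \<in> big_families P \<Longrightarrow> finite S"
  using finite_subset[of S "Pow P"] big_familiesD(1) by auto

lemma finite_big_families: "finite P \<Longrightarrow> finite (big_families P)"
  by (simp add: big_families_def finite_nc_partitions)

lemma nc_sum_support:
  assumes P: "finite P" and one: "\<And>i. i \<in> P \<Longrightarrow> \<kappa> [lab i] = 1"
    and zero: "\<And>B. B \<subseteq> P \<Longrightarrow> card B \<ge> 2 \<Longrightarrow> B \<notin> M \<Longrightarrow> \<kappa> (read lab B) = 0"
  shows "nc_sum \<kappa> lab P = (\<Sum>S\<in>big_families P \<inter> Pow M. \<Prod>B\<in>S. \<kappa> (read lab B))"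
proof -
  have z: "(\<Prod>B\<in>S. \<kappa> (read lab B)) = 0" if S: "S \<in> big_families P - Pow M" for S
  proof -
    obtain B where B: "B \<in> S" "B \<notin> M" using S by auto
    then have "\<kappa> (read lab B) = 0" using zero big_familiesD S by auto
    then show ?thesis using finite_big_family[OF P] S B(1) by (metis DiffD1 prod_zero)
  qed
  have "nc_sum \<kappa> lab P = (\<Sum>S\<in>big_families P. \<Prod>B\<in>S. \<kappa> (read lab B))"
    by (rule nc_sum_big_families[OF P]) (rule one)
  then show ?thesis
    using z by (simp only:) (intro sum.mono_neutral_right finite_big_families[OF P], auto)
qed

lemma sum_Pow_power:
  fixes t :: real
  assumes "finite M"
  shows "(\<Sum>S\<in>Pow M. t ^ card S) = (1 + t) ^ card M"
  using prod_add[OF assms, of "\<lambda>_. t" "\<lambda>_. 1"] by (simp add: add.commute)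

text \<open>Telescoping. The bound is kept in this form, rather than as a multiple of
  \<open>d\<close>, because it sums exactly over all subsets of a set by the binomial
  theorem.\<close>

lemma norm_prod_diff_le:
  fixes a b :: "'i \<Rightarrow> complex"
  assumes "finite S" "\<And>i. i \<in> S \<Longrightarrow> norm (a i - b i) \<le> d" "\<And>i. i \<in> S \<Longrightarrow> norm (b i) \<le> t" "0 \<le> t" "0 \<le> d"
  shows "norm (prod a S - prod b S) \<le> (t + d) ^ card S - t ^ card S"
  using assms(1-3)
proof (induction S rule: finite_induct)
  case (insert x S)
  have na: "norm (a i) \<le> t + d" if "i \<in> S" for i
    using insert.prems that norm_triangle_ineq[of "b i" "a i - b i"] by fastforce
  have pa: "norm (prod a S) \<le> (t + d) ^ card S"
    using prod_mono[of S "\<lambda>i. norm (a i)" "\<lambda>_. t + d"] na by (simp add: prod_norm)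
  have IH: "norm (prod a S - prod b S) \<le> (t + d) ^ card S - t ^ card S"
    using insert by simp
  have "prod a (insert x S) - prod b (insert x S) = (a x - b x) * prod a S + b x * (prod a S - prod b S)"
    using insert.hyps by (simp add: algebra_simps)
  then have "norm (prod a (insert x S) - prod b (insert x S))
      \<le> norm (a x - b x) * norm (prod a S) + norm (b x) * norm (prod a S - prod b S)"
    by (metis norm_mult norm_triangle_ineq)
  also have "\<dots> \<le> d * (t + d) ^ card S + t * ((t + d) ^ card S - t ^ card S)"
    using insert.prems pa IH assms(4,5) by (intro add_mono mult_mono) auto
  also have "\<dots> = (t + d) ^ card (insert x S) - t ^ card (insert x S)"
    using insert.hyps by (simp add: algebra_simps)
  finally show ?case .
qed simp

text \<open>The bounds \<open>(t + d) ^ k - t ^ k\<close> are nonnegative, so the disjointness and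
  non-crossing of the blocks can be forgotten and the sum extended to all subsets of
  \<open>M\<close>. For \<open>M\<close> of size O(J), \<open>t\<close> of order 1/J and
  \<open>d\<close> of order 1/J^2 the result is O(1/J).\<close>

lemma norm_nc_sum_diff_le:
  assumes P: "finite P" and one: "\<And>i. i \<in> P \<Longrightarrow> \<kappa> [lab i] = 1" "\<And>i. i \<in> P \<Longrightarrow> \<kappa>' [lab i] = 1"
    and M: "finite M"
    and zero: "\<And>B. B \<subseteq> P \<Longrightarrow> card B \<ge> 2 \<Longrightarrow> B \<notin> M \<Longrightarrow> \<kappa> (read lab B) = 0"
      "\<And>B. B \<subseteq> P \<Longrightarrow> card B \<ge> 2 \<Longrightarrow> B \<notin> M \<Longrightarrow> \<kappa>' (read lab B) = 0"
    and d: "\<And>B. B \<in> M \<Longrightarrow> norm (\<kappa> (read lab B) - \<kappa>' (read lab B)) \<le> d" "0 \<le> d"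
    and t: "\<And>B. B \<in> M \<Longrightarrow> norm (\<kappa>' (read lab B)) \<le> t" "0 \<le> t"
  shows "norm (nc_sum \<kappa> lab P - nc_sum \<kappa>' lab P) \<le> (1 + (t + d)) ^ card M - (1 + t) ^ card M"
proof -
  let ?p = "\<lambda>\<kappa> S. \<Prod>B\<in>S. \<kappa> (read lab B)"
  note fin = finite_big_family[OF P]
  have "nc_sum \<kappa> lab P = (\<Sum>S\<in>big_families P \<inter> Pow M. ?p \<kappa> S)"
    by (rule nc_sum_support[OF P]) (fact one zero)+
  moreover have "nc_sum \<kappa>' lab P = (\<Sum>S\<in>big_families P \<inter> Pow M. ?p \<kappa>' S)"
    by (rule nc_sum_support[OF P]) (fact one zero)+
  ultimately have "norm (nc_sum \<kappa> lab P - nc_sum \<kappa>' lab P) =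
      norm (\<Sum>S\<in>big_families P \<inter> Pow M. ?p \<kappa> S - ?p \<kappa>' S)"
    by (simp add: sum_subtractf)
  also have "\<dots> \<le> (\<Sum>S\<in>big_families P \<inter> Pow M. (t + d) ^ card S - t ^ card S)"
  proof (rule sum_norm_le)
    fix S assume S: "S \<in> big_families P \<inter> Pow M"
    show "norm (?p \<kappa> S - ?p \<kappa>' S) \<le> (t + d) ^ card S - t ^ card S"
      by (rule norm_prod_diff_le) (use S fin d t in auto)
  qed
  also have "\<dots> \<le> (\<Sum>S\<in>Pow M. (t + d) ^ card S - t ^ card S)"
    using M d(2) t(2) by (intro sum_mono2) (auto intro: power_mono)
  also have "\<dots> = (1 + (t + d)) ^ card M - (1 + t) ^ card M"
    by (simp add: sum_subtractf sum_Pow_power[OF M])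
  finally show ?thesis .
qed

text \<open>The convex function \<open>(1 + d) ^ m\<close> lies below its chord over [0, 1].\<close>

lemma one_plus_power_le:
  fixes d :: real
  assumes "0 \<le> d" "d \<le> 1"
  shows "(1 + d) ^ m \<le> 1 + (2 ^ m - 1) * d"
proof (induction m)
  case (Suc m)
  have "(1 + d) ^ Suc m \<le> (1 + (2 ^ m - 1) * d) * (1 + d)"
    using Suc assms by (simp add: mult.commute mult_left_mono)
  also have "\<dots> = 1 + d * (1 + (2 ^ m - 1) * (1 + d))" by (simp add: algebra_simps)
  also have "\<dots> \<le> 1 + d * (1 + (2 ^ m - 1) * 2)"
    using assms by (intro add_left_mono mult_left_mono) auto
  also have "\<dots> = 1 + (2 ^ Suc m - 1) * d" by (simp add: algebra_simps)
  finally show ?case .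
qed simp

lemma power_diff_le:
  fixes t d :: real
  assumes "0 \<le> t" "0 \<le> d"
  shows "(1 + (t + d)) ^ m - (1 + t) ^ m \<le> real m * d * exp (real m * (t + d))"
proof -
  have *: "(1 + (t + d)) ^ m - (1 + t) ^ m \<le> real m * d * (1 + (t + d)) ^ m"
  proof (induction m)
    case (Suc m)
    have "(1 + (t + d)) ^ Suc m - (1 + t) ^ Suc m =
        d * (1 + (t + d)) ^ m + (1 + t) * ((1 + (t + d)) ^ m - (1 + t) ^ m)"
      by (simp add: algebra_simps)
    also have "\<dots> \<le> d * (1 + (t + d)) ^ m + (1 + t) * (real m * d * (1 + (t + d)) ^ m)"
      using Suc assms by (intro add_left_mono mult_left_mono) auto
    also have "\<dots> \<le> d * (1 + (t + d)) ^ Suc m + (1 + (t + d)) * (real m * d * (1 + (t + d)) ^ m)"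
      using assms by (intro add_mono mult_left_mono mult_right_mono power_increasing) auto
    also have "\<dots> = real (Suc m) * d * (1 + (t + d)) ^ Suc m" by (simp add: algebra_simps)
    finally show ?case .
  qed simp
  also have "\<dots> \<le> real m * d * exp (t + d) ^ m"
    using assms by (intro mult_left_mono power_mono) auto
  finally show ?thesis by (simp add: exp_of_nat_mult[symmetric])
qed

lemma nc_partitions_card_le:
  assumes "\<pi> \<in> nc_partitions P" "finite P"
  shows "card \<pi> \<le> card P"
proof -
  have "card \<pi> = (\<Sum>B\<in>\<pi>. 1)" by simp
  also have "\<dots> \<le> (\<Sum>B\<in>\<pi>. card B)"
    using nc_partitionsD(2)[OF assms(1)] nc_partitions_finite(2)[OF assms]
    by (intro sum_mono) (auto simp: Suc_le_eq card_gt_0_iff)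
  also have "\<dots> = card (\<Union>\<pi>)"
    using assms(1) nc_partitions_finite(2)[OF assms]
    by (intro card_Union_disjoint[symmetric]) (auto simp: nc_partitions_def partition_on_def)
  also have "\<Union>\<pi> = P" using assms(1) by (auto simp: nc_partitions_def partition_on_def)
  finally show ?thesis .
qed

lemma nc_partitions_lessThan_read:
  assumes "\<pi> \<in> nc_partitions {..<length s} - {{{..<length s}}}" "B \<in> \<pi>"
  shows "read (nth s) B \<noteq> []" "set (read (nth s) B) \<subseteq> set s" "length (read (nth s) B) < length s"
proof -
  have B: "B \<subseteq> {..<length s}" "B \<noteq> {}" using assms nc_partitionsD[of \<pi> _ B] by auto
  have "finite B" using B(1) finite_subset by blast
  then show "read (nth s) B \<noteq> []" "set (read (nth s) B) \<subseteq> set s"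
    using B by (auto simp: read_def)
  show "length (read (nth s) B) < length s" using nc_partitions_card_less[OF assms] by simp
qed

text \<open>Dominates the recursion of \<open>cumulant\<close>: all partitions of at most
  \<open>n + 1\<close> points, at most \<open>n + 1\<close> blocks in each, and a factor 2 per block
  from \<open>one_plus_power_le\<close>. It refers to no particular word and so serves all pieces at
  once.\<close>

fun stability_const :: "real \<Rightarrow> nat \<Rightarrow> real" where
  "stability_const C 0 = 1"
| "stability_const C (Suc n) = 1 + C +
     (\<Sum>m\<le>Suc n. real (card (nc_partitions {..<m}))) * (2 * stability_const C n) ^ Suc n"

lemma stability_const_ge_1: "0 \<le> C \<Longrightarrow> 1 \<le> stability_const C n"
proof (induction n)
  case (Suc n)
  have "0 \<le> (\<Sum>m\<le>Suc n. real (card (nc_partitions {..<m}))) * (2 * stability_const C n) ^ Suc n"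
    using Suc by (intro mult_nonneg_nonneg sum_nonneg zero_le_power) auto
  with Suc show ?case by (simp del: sum.atMost_Suc power_Suc)
qed simp

text \<open>A cumulant is a polynomial in the values of the functional on subwords. Size and
  perturbation are bounded together, since perturbing a product requires bounds on its
  factors.\<close>

lemma cumulant_stable:
  assumes C: "0 \<le> C" and d: "0 \<le> d" "d \<le> 1" and "s \<noteq> []" "length s \<le> n"
    and "\<And>r. r \<noteq> [] \<Longrightarrow> set r \<subseteq> set s \<Longrightarrow> length r \<le> length s \<Longrightarrow> norm (\<phi> r - \<psi> r) \<le> d \<and> norm (\<psi> r) \<le> C"
  shows "norm (cumulant \<phi> s - cumulant \<psi> s) \<le> stability_const C n * d \<and>
    norm (cumulant \<psi> s) \<le> stability_const C n"
  using assms(4-6)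
proof (induction n arbitrary: s)
  case (Suc n)
  define K where "K = stability_const C n"
  define A where "A = (\<Sum>m\<le>Suc n. real (card (nc_partitions {..<m})))"
  define K' where "K' = 1 + C + A * (2 * K) ^ Suc n"
  have K: "1 \<le> K" unfolding K_def by (rule stability_const_ge_1[OF C])
  have K': "stability_const C (Suc n) = K'" unfolding K'_def A_def K_def by (rule stability_const.simps)
  have A: "real (card (nc_partitions {..<m})) \<le> A" if "m \<le> Suc n" for m
    unfolding A_def using that by (intro member_le_sum) auto
  let ?N = "nc_partitions {..<length s} - {{{..<length s}}}"
  let ?p = "\<lambda>\<phi> \<pi>. \<Prod>B\<in>\<pi>. cumulant \<phi> (read (nth s) B)"
  have fin: "finite (nc_partitions {..<length s})" by (simp add: finite_nc_partitions)
  have cN: "real (card ?N) \<le> A"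
    using A[OF Suc.prems(2)] card_mono[OF fin, of ?N] by force
  have blk: "norm (cumulant \<phi> (read (nth s) B) - cumulant \<psi> (read (nth s) B)) \<le> K * d \<and>
      norm (cumulant \<psi> (read (nth s) B)) \<le> K" if "\<pi> \<in> ?N" "B \<in> \<pi>" for \<pi> B
    unfolding K_def
  proof (rule Suc.IH)
    note * = nc_partitions_lessThan_read[OF that]
    show "read (nth s) B \<noteq> []" by (rule *)
    show "length (read (nth s) B) \<le> n" using *(3) Suc.prems(2) by linarith
    fix r assume "r \<noteq> []" "set r \<subseteq> set (read (nth s) B)" "length r \<le> length (read (nth s) B)"
    then show "norm (\<phi> r - \<psi> r) \<le> d \<and> norm (\<psi> r) \<le> C" using * by (intro Suc.prems(3)) auto
  qed
  have part: "finite \<pi>" "card \<pi> \<le> Suc n" if "\<pi> \<in> ?N" for \<pi>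
    using that nc_partitions_finite(1)[of \<pi> "{..<length s}"]
      nc_partitions_card_le[of \<pi> "{..<length s}"] Suc.prems(2) by auto
  have p1: "norm (?p \<phi> \<pi> - ?p \<psi> \<pi>) \<le> (2 * K) ^ Suc n * d" if "\<pi> \<in> ?N" for \<pi>
  proof -
    have "norm (?p \<phi> \<pi> - ?p \<psi> \<pi>) \<le> (K + K * d) ^ card \<pi> - K ^ card \<pi>"
      by (rule norm_prod_diff_le) (use part(1)[OF that] blk[OF that] K d in auto)
    also have "\<dots> = K ^ card \<pi> * ((1 + d) ^ card \<pi> - 1)"
    proof -
      have "K + K * d = K * (1 + d)" by (simp add: algebra_simps)
      then show ?thesis by (simp add: power_mult_distrib right_diff_distrib)
    qed
    also have "\<dots> \<le> K ^ card \<pi> * ((2 ^ card \<pi> - 1) * d)"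
      using one_plus_power_le[OF d, of "card \<pi>"] K by (intro mult_left_mono) auto
    also have "\<dots> \<le> K ^ card \<pi> * (2 ^ card \<pi> * d)"
      using K d by (intro mult_left_mono mult_right_mono) auto
    also have "\<dots> = (2 * K) ^ card \<pi> * d" by (simp add: power_mult_distrib)
    also have "\<dots> \<le> (2 * K) ^ Suc n * d"
      using part(2)[OF that] K d by (intro mult_right_mono power_increasing) auto
    finally show ?thesis .
  qed
  have p2: "norm (?p \<psi> \<pi>) \<le> (2 * K) ^ Suc n" if "\<pi> \<in> ?N" for \<pi>
  proof -
    have "norm (?p \<psi> \<pi>) \<le> (\<Prod>B\<in>\<pi>. K)"
      unfolding prod_norm[symmetric] by (rule prod_mono) (use blk[OF that] in auto)
    also have "\<dots> = K ^ card \<pi>" by simp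
    also have "\<dots> \<le> K ^ Suc n" using part(2)[OF that] K by (intro power_increasing)
    also have "\<dots> \<le> (2 * K) ^ Suc n" using K by (intro power_mono) auto
    finally show ?thesis .
  qed
  have rs: "norm (\<phi> s - \<psi> s) \<le> d" "norm (\<psi> s) \<le> C" using Suc.prems(3)[of s] Suc.prems(1) by auto
  have "norm (cumulant \<phi> s - cumulant \<psi> s) = norm ((\<phi> s - \<psi> s) - (\<Sum>\<pi>\<in>?N. ?p \<phi> \<pi> - ?p \<psi> \<pi>))"
    by (simp add: cumulant.simps[of _ s] sum_subtractf algebra_simps)
  also have "\<dots> \<le> norm (\<phi> s - \<psi> s) + norm (\<Sum>\<pi>\<in>?N. ?p \<phi> \<pi> - ?p \<psi> \<pi>)" by (rule norm_triangle_ineq4)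
  also have "\<dots> \<le> d + (\<Sum>\<pi>\<in>?N. (2 * K) ^ Suc n * d)"
    by (intro add_mono rs sum_norm_le p1)
  also have "\<dots> = d + real (card ?N) * ((2 * K) ^ Suc n * d)" by simp
  also have "\<dots> \<le> d + A * ((2 * K) ^ Suc n * d)"
    using cN K d by (intro add_left_mono mult_right_mono) auto
  also have "\<dots> \<le> K' * d" unfolding K'_def using C d by (simp add: algebra_simps)
  finally have 1: "norm (cumulant \<phi> s - cumulant \<psi> s) \<le> K' * d" .
  have "norm (cumulant \<psi> s) \<le> norm (\<psi> s) + norm (\<Sum>\<pi>\<in>?N. ?p \<psi> \<pi>)"
    unfolding cumulant.simps[of _ s] by (rule norm_triangle_ineq4)
  also have "\<dots> \<le> C + (\<Sum>\<pi>\<in>?N. (2 * K) ^ Suc n)"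
    by (intro add_mono rs sum_norm_le p2)
  also have "\<dots> = C + real (card ?N) * (2 * K) ^ Suc n" by simp
  also have "\<dots> \<le> C + A * (2 * K) ^ Suc n"
    using cN K by (intro add_left_mono mult_right_mono) auto
  also have "\<dots> \<le> K'" unfolding K'_def by simp
  finally show ?case using 1 unfolding K' by blast
qed simp

text \<open>These are the cumulants of the unit, all of whose moments are 1: in the recursion only
  the partition into singletons has a nonzero product. It follows with
  \<open>cumulant_stable\<close> that a functional close to 1 on short words has small cumulants of
  order at least two.\<close>

lemma cumulant_one:
  assumes "s \<noteq> []"
  shows "cumulant (\<lambda>_. 1) s = (if length s = 1 then 1 else 0)"
  using assms
proof (induction s rule: length_induct)
  case (1 s)
  let ?P = "{..<length s}"
  let ?N = "nc_partitions ?P - {{?P}}"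
  let ?\<delta> = "\<lambda>B::nat set. if card B = 1 then 1 else 0 :: complex"
  have "(\<Sum>\<pi>\<in>?N. \<Prod>B\<in>\<pi>. cumulant (\<lambda>_. 1) (read (nth s) B)) = (\<Sum>\<pi>\<in>?N. \<Prod>B\<in>\<pi>. ?\<delta> B)"
  proof (intro sum.cong prod.cong refl)
    fix \<pi> B assume *: "\<pi> \<in> ?N" "B \<in> \<pi>"
    show "cumulant (\<lambda>_. 1) (read (nth s) B) = ?\<delta> B"
      using 1(1)[rule_format, OF nc_partitions_lessThan_read(3,1)[OF *]] by simp
  qed
  moreover have "(\<Sum>\<pi>\<in>?N. \<Prod>B\<in>\<pi>. ?\<delta> B) = (if length s = 1 then 0 else 1)"
  proof -
    let ?\<sigma> = "(\<lambda>x. {x}) ` ?P"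
    have \<sigma>: "?\<sigma> \<in> nc_partitions ?P"
      using partition_on_singletons[of ?P] by (auto simp: nc_partitions_def non_crossing_def)
    have z: "(\<Prod>B\<in>\<pi>. ?\<delta> B) = (if \<pi> = ?\<sigma> then 1 else 0)" if \<pi>: "\<pi> \<in> nc_partitions ?P" for \<pi>
    proof (cases "\<pi> = ?\<sigma>")
      case True
      then show ?thesis by (auto intro!: prod.neutral)
    next
      case False
      have "\<exists>B\<in>\<pi>. card B \<noteq> 1"
      proof (rule ccontr)
        assume "\<not> ?thesis"
        then have s1: "\<exists>x. B = {x}" if "B \<in> \<pi>" for B using that by (auto simp: card_1_singleton_iff)
        have U: "\<Union>\<pi> = ?P" using \<pi> by (auto simp: nc_partitions_def partition_on_def)
        have "{x} \<in> \<pi>" if x: "x \<in> ?P" for x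
        proof -
          have "x \<in> \<Union>\<pi>" using x unfolding U .
          then obtain B where "B \<in> \<pi>" "x \<in> B" by blast
          then show ?thesis using s1[of B] by auto
        qed
        moreover have "B \<in> ?\<sigma>" if B: "B \<in> \<pi>" for B
        proof -
          obtain x where "B = {x}" using s1[OF B] by blast
          moreover have "B \<subseteq> ?P" using B U by blast
          ultimately show ?thesis by blast
        qed
        ultimately have "\<pi> = ?\<sigma>" by blast
        then show False using False by simp
      qed
      then have "(\<Prod>B\<in>\<pi>. ?\<delta> B) = 0" using nc_partitions_finite(1)[OF \<pi>] by (intro prod_zero) auto
      then show ?thesis using False by simp
    qed
    \<comment> \<open>The recursion omits the one-block partition, which is the partition into
      singletons exactly for words of length one.\<close>
    have top: "?\<sigma> = {?P} \<longleftrightarrow> length s = 1"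
    proof
      assume "?\<sigma> = {?P}"
      then have "card ?\<sigma> = 1" by simp
      then show "length s = 1" by (simp add: card_image)
    next
      assume "length s = 1"
      then have "?P = {0}" by auto
      then show "?\<sigma> = {?P}" by simp
    qed
    have "(\<Sum>\<pi>\<in>?N. \<Prod>B\<in>\<pi>. ?\<delta> B) = (\<Sum>\<pi>\<in>?N. if \<pi> = ?\<sigma> then 1 else 0)"
      by (intro sum.cong z) auto
    also have "\<dots> = (if ?\<sigma> \<in> ?N then 1 else 0)"
      by (rule sum.delta) (simp add: finite_nc_partitions)
    finally show ?thesis using \<sigma> top by simp
  qed
  ultimately show ?case by (simp add: cumulant.simps[of _ s])
qed

text \<open>The sets of positions that can carry a nonzero free cumulant of order at least
  two.\<close>

definition mono_sets :: "('l \<Rightarrow> 'k) \<Rightarrow> 'l list \<Rightarrow> nat set set" where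
  "mono_sets f w = {B. B \<subseteq> {..<length w} \<and> card B \<ge> 2 \<and> monochrome f (read (nth w) B)}"

lemma finite_mono_sets: "finite (mono_sets f w)"
  by (rule finite_subset[of _ "Pow {..<length w}"]) (auto simp: mono_sets_def)

lemma mono_setsD:
  assumes "B \<in> mono_sets f w"
  shows "finite B" "B \<subseteq> {..<length w}" "set (read (nth w) B) \<subseteq> set w" "read (nth w) B \<noteq> []"
    "\<exists>a\<in>set w. B \<subseteq> {i. i < length w \<and> f (w ! i) = f a}"
proof -
  show B: "B \<subseteq> {..<length w}" using assms by (simp add: mono_sets_def)
  then show fin: "finite B" using finite_subset by blast
  then show "set (read (nth w) B) \<subseteq> set w" using B by auto
  have "card B \<noteq> 0" using assms by (auto simp: mono_sets_def)
  then show "read (nth w) B \<noteq> []" by (metis length_read list.size(3))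
  from \<open>card B \<noteq> 0\<close> obtain b where b: "b \<in> B" by force
  then have "w ! b \<in> set w" using B by auto
  moreover have "B \<subseteq> {i. i < length w \<and> f (w ! i) = f (w ! b)}"
    using B b fin assms monochromeD[of f "read (nth w) B"] by (auto simp: mono_sets_def)
  ultimately show "\<exists>a\<in>set w. B \<subseteq> {i. i < length w \<and> f (w ! i) = f a}" by blast
qed

text \<open>A monochrome set lies in one colour class, which has at most \<open>2 ^ n\<close>
  subsets. What matters is that the count is linear in the number of colours.\<close>

lemma card_mono_sets:
  assumes "\<And>a. a \<in> set w \<Longrightarrow> length (filter (\<lambda>b. f b = f a) w) \<le> n"
  shows "card (mono_sets f w) \<le> card (f ` set w) * 2 ^ n"
    and "B \<in> mono_sets f w \<Longrightarrow> card B \<le> n"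
proof -
  let ?U = "\<lambda>c. {i. i < length w \<and> f (w ! i) = c}"
  have U: "card (?U c) \<le> n" if "c \<in> f ` set w" for c
    using assms that by (auto simp: length_filter_conv_card)
  have "mono_sets f w \<subseteq> (\<Union>c\<in>f ` set w. Pow (?U c))"
    using mono_setsD(5) by fast
  then have "card (mono_sets f w) \<le> card (\<Union>c\<in>f ` set w. Pow (?U c))"
    by (intro card_mono) auto
  also have "\<dots> \<le> (\<Sum>c\<in>f ` set w. card (Pow (?U c)))"
    by (rule card_UN_le) simp
  also have "\<dots> \<le> (\<Sum>c\<in>f ` set w. 2 ^ n)"
    using U by (intro sum_mono) (simp add: card_Pow)
  finally show "card (mono_sets f w) \<le> card (f ` set w) * 2 ^ n" by simp
  show "card B \<le> n" if B: "B \<in> mono_sets f w"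
  proof -
    obtain a where a: "a \<in> set w" "B \<subseteq> ?U (f a)" using mono_setsD(5)[OF B] by blast
    have "card B \<le> card (?U (f a))" using a(2) by (intro card_mono) auto
    also have "\<dots> \<le> n" using U a(1) by blast
    finally show ?thesis .
  qed
qed

text \<open>The two functionals differ at second order in \<open>e\<close>, while their distance
  from 1 is only of first order. The number of colours will be of order \<open>1 / e\<close>: the
  exponential then stays bounded and the whole bound is of order \<open>e\<close>.\<close>

theorem free_functionals_close:
  fixes C e :: real
  assumes C: "0 \<le> C" and free: "free_functional f \<phi>" "free_functional f \<psi>"
    and e: "0 \<le> e" "e \<le> 1" "C * e \<le> 1"
    and occ: "\<And>a. a \<in> set w \<Longrightarrow> length (filter (\<lambda>b. f b = f a) w) \<le> n"
    and one: "\<And>a. a \<in> set w \<Longrightarrow> \<phi> [a] = 1 \<and> \<psi> [a] = 1"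
    and close: "\<And>s. s \<noteq> [] \<Longrightarrow> monochrome f s \<Longrightarrow> set s \<subseteq> set w \<Longrightarrow> length s \<le> n \<Longrightarrow>
      norm (\<phi> s - \<psi> s) \<le> C * e\<^sup>2 \<and> norm (\<psi> s - 1) \<le> C * e"
  defines "m \<equiv> real (card (f ` set w) * 2 ^ n)" and "K \<equiv> stability_const (1 + C) n"
  shows "norm (\<phi> w - \<psi> w) \<le> m * (K * C * e\<^sup>2) * exp (m * (K * C * e + K * C * e\<^sup>2))"
proof -
  have C1: "0 \<le> 1 + C" using C by simp
  have K: "1 \<le> K" unfolding K_def by (rule stability_const_ge_1[OF C1])
  let ?P = "{..<length w}" and ?lab = "nth w"
  let ?M = "mono_sets f w"
  have e2: "0 \<le> C * e\<^sup>2" "C * e\<^sup>2 \<le> 1"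
  proof -
    have "e\<^sup>2 \<le> e" using e by (simp add: power2_eq_square mult_left_le)
    then show "0 \<le> C * e\<^sup>2" "C * e\<^sup>2 \<le> 1" using C e mult_left_mono[of "e\<^sup>2" e C] by auto
  qed
  have word: "\<phi> w = nc_sum (free_cumulant f \<phi>) ?lab ?P" "\<psi> w = nc_sum (free_cumulant f \<psi>) ?lab ?P"
    using free free_functional_eq_nc_word[of f _ w] by (simp_all add: nc_word_def)
  \<comment> \<open>A one-letter word has only the one-block partition, so its cumulant is its
    value.\<close>
  have single: "free_cumulant f \<phi> [a] = 1" "free_cumulant f \<psi> [a] = 1" if "a \<in> set w" for a
  proof -
    have mono: "monochrome f [a]" by (simp add: monochrome_def)
    have no: "nc_partitions {..<length [a]} - {{{..<length [a]}}} = {}"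
    proof (rule ccontr)
      assume "\<not> ?thesis"
      then obtain \<pi> where \<pi>: "\<pi> \<in> nc_partitions {..<length [a]} - {{{..<length [a]}}}" by blast
      then obtain B where "B \<in> \<pi>" by (auto simp: nc_partitions_def partition_on_def)
      then show False using nc_partitions_lessThan_read(1,3)[OF \<pi>, of B]
        length_0_conv[of "read (nth [a]) B"] by simp
    qed
    have "cumulant \<theta> [a] = \<theta> [a]" for \<theta>
      by (simp only: cumulant.simps[of \<theta> "[a]"] no sum.empty diff_zero)
    then show "free_cumulant f \<phi> [a] = 1" "free_cumulant f \<psi> [a] = 1"
      using one[OF that] mono by (simp_all add: free_cumulant_def)
  qed
  have "norm (nc_sum (free_cumulant f \<phi>) ?lab ?P - nc_sum (free_cumulant f \<psi>) ?lab ?P)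
      \<le> (1 + (K * C * e + K * C * e\<^sup>2)) ^ card ?M - (1 + K * C * e) ^ card ?M"
  proof (rule norm_nc_sum_diff_le)
    fix B assume "B \<subseteq> ?P" "card B \<ge> 2" "B \<notin> ?M"
    then show "free_cumulant f \<phi> (read ?lab B) = 0" "free_cumulant f \<psi> (read ?lab B) = 0"
      by (auto simp: mono_sets_def free_cumulant_def)
  next
    fix B assume B: "B \<in> ?M"
    let ?s = "read ?lab B"
    have s: "monochrome f ?s" "?s \<noteq> []" "set ?s \<subseteq> set w" "length ?s \<le> n" "length ?s \<ge> 2"
      using mono_setsD[OF B] B card_mono_sets(2)[OF occ B] by (auto simp: mono_sets_def)
    have sub: "norm (\<phi> r - \<psi> r) \<le> C * e\<^sup>2 \<and> norm (\<psi> r - 1) \<le> C * e"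
      if "r \<noteq> []" "set r \<subseteq> set ?s" "length r \<le> length ?s" for r
    proof (rule close[OF that(1)])
      show "monochrome f r" using s(1) that(2) unfolding monochrome_def by blast
    qed (use that s in auto)
    \<comment> \<open>Comparing \<phi> with \<psi> gives the perturbation of a single
      cumulant.\<close>
    have "norm (cumulant \<phi> ?s - cumulant \<psi> ?s) \<le> K * (C * e\<^sup>2) \<and> norm (cumulant \<psi> ?s) \<le> K"
    proof (rule cumulant_stable[OF C1 e2 s(2,4), folded K_def])
      fix r assume r: "r \<noteq> []" "set r \<subseteq> set ?s" "length r \<le> length ?s"
      have "norm (\<psi> r) \<le> norm (\<psi> r - 1) + 1"
        using norm_triangle_ineq[of "\<psi> r - 1" 1] by simp
      also have "\<dots> \<le> 1 + C" using sub[OF r] e C mult_left_mono[of e 1 C] by auto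
      finally show "norm (\<phi> r - \<psi> r) \<le> C * e\<^sup>2 \<and> norm (\<psi> r) \<le> 1 + C" using sub[OF r] by simp
    qed
    then show "norm (free_cumulant f \<phi> ?s - free_cumulant f \<psi> ?s) \<le> K * C * e\<^sup>2"
      using s(1) by (simp add: free_cumulant_def mult.assoc)
    \<comment> \<open>Comparing \<psi> with the constant functional 1, whose cumulant is zero
      because \<open>?s\<close> has at least two letters, shows that the cumulant of \<psi> is
      itself of order \<open>e\<close>.\<close>
    have "norm (cumulant \<psi> ?s - cumulant (\<lambda>_. 1) ?s) \<le> K * (C * e) \<and> norm (cumulant (\<lambda>_. 1) ?s) \<le> K"
      by (rule cumulant_stable[OF C1 _ e(3) s(2,4), folded K_def]) (use sub C e in auto)
    then show "norm (free_cumulant f \<psi> ?s) \<le> K * C * e"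
      using s cumulant_one[OF s(2)] by (simp add: free_cumulant_def mult.assoc)
  qed (use single finite_mono_sets K C e in auto)
  also have "\<dots> \<le> real (card ?M) * (K * C * e\<^sup>2) * exp (real (card ?M) * (K * C * e + K * C * e\<^sup>2))"
    by (rule power_diff_le) (use K C e in auto)
  also have "\<dots> \<le> m * (K * C * e\<^sup>2) * exp (m * (K * C * e + K * C * e\<^sup>2))"
  proof -
    have "real (card ?M) \<le> m" unfolding m_def using card_mono_sets(1)[OF occ] by (rule of_nat_mono)
    then show ?thesis using K C e
      by (intro mult_mono iffD2[OF exp_le_cancel_iff] mult_right_mono) auto
  qed
  finally show ?thesis by (simp add: word)
qed

section \<open>Forests and spanning trees\<close>

definition adj :: "nat set set \<Rightarrow> (nat \<times> nat) set" where
  "adj E = {(u, v). {u, v} \<in> E}"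

lemma sym_adj: "sym (adj E)"
  by (auto simp: adj_def sym_def insert_commute)

lemma rtrancl_adj_sym: "(i, j) \<in> (adj E)\<^sup>* \<Longrightarrow> (j, i) \<in> (adj E)\<^sup>*"
  using sym_rtrancl[OF sym_adj[of E]] by (rule symD)

lemma rtrancl_adj_mono: "E \<subseteq> E' \<Longrightarrow> (i, j) \<in> (adj E)\<^sup>* \<Longrightarrow> (i, j) \<in> (adj E')\<^sup>*"
  using rtrancl_mono[of "adj E" "adj E'"] by (auto simp: adj_def)

lemma is_cycle_mono: "is_cycle E vs \<Longrightarrow> E \<subseteq> E' \<Longrightarrow> is_cycle E' vs"
  unfolding is_cycle_def by blast

definition spanning_trees :: "nat set \<Rightarrow> nat set set set" where
  "spanning_trees V = {E. (\<forall>e\<in>E. e \<subseteq> V \<and> card e = 2) \<and> (\<nexists>vs. is_cycle E vs) \<and>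
     (\<forall>i\<in>V. \<forall>j\<in>V. (i, j) \<in> (adj E)\<^sup>*)}"

lemma finite_spanning_trees: "finite V \<Longrightarrow> finite (spanning_trees V)"
  by (rule finite_subset[of _ "Pow (Pow V)"]) (auto simp: spanning_trees_def)

lemma spanning_trees_image:
  assumes inj: "inj_on f V" and E: "E \<in> spanning_trees V"
  shows "image f ` E \<in> spanning_trees (f ` V)"
proof -
  have edge: "e \<subseteq> V" "card e = 2" if "e \<in> E" for e using E that by (auto simp: spanning_trees_def)
  have "\<not> is_cycle (image f ` E) vs" for vs
  proof
    assume c: "is_cycle (image f ` E) vs"
    define us where "us = map (inv_into V f) vs"
    have vV: "vs ! k \<in> f ` V" if "k < length vs" for k
      using c that edge(1) unfolding is_cycle_def by blast
    then have vus: "vs ! k = f (us ! k)" "us ! k \<in> V" if "k < length vs" for k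
      using that by (simp_all add: us_def f_inv_into_f inv_into_into)
    have "is_cycle E us"
      unfolding is_cycle_def
    proof (intro conjI allI impI)
      show "3 \<le> length us" using c by (simp add: is_cycle_def us_def)
      have "set vs \<subseteq> f ` V" using vV by (auto simp: in_set_conv_nth)
      then show "distinct us" using c inj_on_inv_into[of "set vs" f V]
        by (simp add: us_def distinct_map is_cycle_def)
      fix k assume "k < length us"
      then have k: "k < length vs" "Suc k mod length vs < length vs" and len: "length us = length vs"
        by (auto simp: us_def intro: mod_less_divisor)
      then have "{vs ! k, vs ! (Suc k mod length vs)} \<in> image f ` E"
        using c by (simp add: is_cycle_def)
      then obtain e where e: "e \<in> E" "f ` e = f ` {us ! k, us ! (Suc k mod length vs)}"
        using vus(1) k by auto
      have "e = {us ! k, us ! (Suc k mod length vs)}"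
        using inj_on_image_eq_iff[OF inj edge(1)[OF e(1)], of "{us ! k, us ! (Suc k mod length vs)}"]
          e(2) vus(2) k by auto
      then show "{us ! k, us ! (Suc k mod length us)} \<in> E" using e(1) len by simp
    qed
    then show False using E by (auto simp: spanning_trees_def)
  qed
  moreover have "(f i, f j) \<in> (adj (image f ` E))\<^sup>*" if "(i, j) \<in> (adj E)\<^sup>*" for i j
    using that
  proof (induction rule: rtrancl_induct)
    case (step y z)
    then have "f ` {y, z} \<in> image f ` E" unfolding adj_def by blast
    then have "(f y, f z) \<in> adj (image f ` E)" by (simp add: adj_def)
    with step.IH show ?case by (rule rtrancl_into_rtrancl)
  qed simp
  moreover have "card (f ` e) = 2" if "e \<in> E" for e
    using edge[OF that] inj by (simp add: card_image inj_on_subset)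
  moreover have "f ` e \<subseteq> f ` V" if "e \<in> E" for e
    using edge(1)[OF that] by blast
  moreover have "\<forall>i\<in>V. \<forall>j\<in>V. (i, j) \<in> (adj E)\<^sup>*" using E by (simp add: spanning_trees_def)
  ultimately show ?thesis unfolding spanning_trees_def by blast
qed

definition same_sign :: "(nat \<Rightarrow> 'a \<times> bool) \<Rightarrow> nat set set \<Rightarrow> nat set set" where
  "same_sign lab E = {e\<in>E. \<forall>i\<in>e. \<forall>j\<in>e. snd (lab i) = snd (lab j)}"

definition tree_sum :: "(nat \<Rightarrow> 'a \<times> bool) \<Rightarrow> nat set \<Rightarrow> real" where
  "tree_sum lab V = (\<Sum>E\<in>spanning_trees V. (- 1) ^ card (same_sign lab E))"

text \<open>Trees carry no order on their vertices, and edges of one component may cross, so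
  injectivity is enough.\<close>

lemma tree_sum_image:
  assumes inj: "inj_on f V"
  shows "tree_sum lab (f ` V) = tree_sum (lab \<circ> f) V"
proof -
  have edge: "e \<subseteq> W" if "E \<in> spanning_trees W" "e \<in> E" for e E W
    using that by (auto simp: spanning_trees_def)
  have bij: "bij_betw (image (image f)) (spanning_trees V) (spanning_trees (f ` V))"
  proof (rule bij_betw_image_image[OF inj])
    show "E \<subseteq> Pow V \<and> image f ` E \<in> spanning_trees (f ` V)" if "E \<in> spanning_trees V" for E
      using edge[OF that] spanning_trees_image[OF inj that] by blast
    show "E \<subseteq> Pow (f ` V) \<and> image (inv_into V f) ` E \<in> spanning_trees V"
      if E: "E \<in> spanning_trees (f ` V)" for E
    proof
      show "E \<subseteq> Pow (f ` V)" using edge[OF E] by blast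
      have "inv_into V f ` f ` V = V" using inj by (simp add: inv_into_image_cancel)
      then show "image (inv_into V f) ` E \<in> spanning_trees V"
        using spanning_trees_image[OF inj_on_inv_into[of "f ` V" f V, OF subset_refl] E] by simp
    qed
  qed
  have "card (same_sign lab (image f ` E)) = card (same_sign (lab \<circ> f) E)"
    if E: "E \<in> spanning_trees V" for E
  proof -
    have "same_sign lab (image f ` E) = image f ` same_sign (lab \<circ> f) E"
      by (auto simp: same_sign_def)
    moreover have "same_sign (lab \<circ> f) E \<subseteq> Pow V"
      using edge[OF E] by (auto simp: same_sign_def)
    then have "inj_on (image f) (same_sign (lab \<circ> f) E)"
      using inj_on_image_Pow[OF inj] by (rule inj_on_subset[rotated])
    ultimately show ?thesis by (simp add: card_image)
  qed
  then show ?thesis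
    unfolding tree_sum_def by (simp add: sum.reindex_bij_betw[OF bij, symmetric])
qed

text \<open>The factor of one component as a function of the word read along it; the value 0 on
  mixed words encodes that a component carries a single letter.\<close>

definition forest_cumulant :: "('a \<Rightarrow> real) \<Rightarrow> 'a word \<Rightarrow> real" where
  "forest_cumulant x s = (if \<forall>a\<in>set s. \<forall>b\<in>set s. fst a = fst b
     then x (fst (hd s)) ^ (length s - 1) / fact (length s - 1) * tree_sum (nth s) {..<length s} else 0)"

lemma tree_sum_read:
  assumes "finite B"
  shows "tree_sum (nth (read lab B)) {..<card B} = tree_sum lab B"
proof -
  let ?xs = "sorted_list_of_set B"
  have bij: "bij_betw (nth ?xs) {..<card B} B"
    using bij_betw_nth[of ?xs "{..<card B}" B] assms by simp
  have "tree_sum lab B = tree_sum (lab \<circ> nth ?xs) {..<card B}"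
    using tree_sum_image[of "nth ?xs" "{..<card B}" lab] bij by (simp add: bij_betw_def)
  also have "\<dots> = tree_sum (nth (read lab B)) {..<card B}"
  proof -
    have "same_sign (lab \<circ> nth ?xs) E = same_sign (nth (read lab B)) E"
      if E: "E \<in> spanning_trees {..<card B}" for E
    proof -
      have "i < card B" if "i \<in> e" "e \<in> E" for i e
        using E that by (auto simp: spanning_trees_def)
      then have lab: "(lab \<circ> nth ?xs) i = read lab B ! i" if "i \<in> e" "e \<in> E" for i e
        using that by (simp add: read_def)
      show ?thesis unfolding same_sign_def
        by (intro Collect_cong conj_cong refl ball_cong) (simp_all only: lab)
    qed
    then show ?thesis unfolding tree_sum_def by simp
  qed
  finally show ?thesis by simp
qed

section \<open>Forests as families of spanning trees of their components\<close>

lemma components_of_eq: "components_of n E = (\<lambda>i. {j. j < n \<and> (i, j) \<in> (adj E)\<^sup>*}) ` {..<n}"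
  by (auto simp: components_of_def adj_def)

lemma partition_on_components_of: "partition_on {..<n} (components_of n E)"
proof (rule partition_onI)
  show "\<Union>(components_of n E) = {..<n}" by (auto simp: components_of_eq)
  show "{} \<notin> components_of n E" by (auto simp: components_of_eq)
  fix p q assume "p \<in> components_of n E" "q \<in> components_of n E" "p \<noteq> q"
  then obtain i j where *: "p = {k. k < n \<and> (i, k) \<in> (adj E)\<^sup>*}" "q = {k. k < n \<and> (j, k) \<in> (adj E)\<^sup>*}"
    by (auto simp: components_of_eq)
  show "disjnt p q"
  proof (rule ccontr)
    assume "\<not> disjnt p q"
    then obtain k where "(i, k) \<in> (adj E)\<^sup>*" "(j, k) \<in> (adj E)\<^sup>*" using * by (auto simp: disjnt_def)
    then have "(i, j) \<in> (adj E)\<^sup>*" "(j, i) \<in> (adj E)\<^sup>*"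
      using rtrancl_adj_sym rtrancl_trans by metis+
    then have "p = q" using * by (auto intro: rtrancl_trans)
    then show False using \<open>p \<noteq> q\<close> by simp
  qed
qed

lemma partition_on_same_block:
  assumes "partition_on A P" "p \<in> P" "q \<in> P" "x \<in> p" "x \<in> q"
  shows "p = q"
proof (rule ccontr)
  assume "p \<noteq> q"
  then have "p \<inter> q = {}" using assms by (metis disjointD partition_onD2)
  then show False using assms by blast
qed

lemma rtrancl_adj_stays:
  assumes "(i, j) \<in> (adj E)\<^sup>*" "i \<in> B" "\<And>e. e \<in> E \<Longrightarrow> e \<inter> B \<noteq> {} \<Longrightarrow> e \<subseteq> B"
  shows "(i, j) \<in> (adj {e\<in>E. e \<subseteq> B})\<^sup>* \<and> j \<in> B"
  using assms(1)
proof (induction rule: rtrancl_induct)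
  case (step y z)
  then have "{y, z} \<in> E" "{y, z} \<inter> B \<noteq> {}" by (auto simp: adj_def)
  then have "{y, z} \<subseteq> B" "(y, z) \<in> adj {e\<in>E. e \<subseteq> B}" using assms(3) by (auto simp: adj_def)
  then show ?case using step.IH by (auto intro: rtrancl_into_rtrancl)
qed (use assms in simp)

lemma edge_in_component:
  assumes E: "is_forest n E" and B: "B \<in> components_of n E" and e: "e \<in> E" "e \<inter> B \<noteq> {}"
  shows "e \<subseteq> B"
proof
  fix v assume v: "v \<in> e"
  obtain u where u: "u \<in> e" "u \<in> B" using e by blast
  obtain i where i: "B = {j. j < n \<and> (i, j) \<in> (adj E)\<^sup>*}" using B by (auto simp: components_of_eq)
  have "e \<subseteq> {..<n}" "card e = 2" using E e by (auto simp: is_forest_def)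
  show "v \<in> B"
  proof (cases "u = v")
    case False
    then have "e = {u, v}" using u v \<open>card e = 2\<close> by (auto simp: card_2_iff)
    then have "(u, v) \<in> adj E" using e by (simp add: adj_def)
    then show ?thesis using u v i \<open>e \<subseteq> {..<n}\<close> by (auto intro: rtrancl_into_rtrancl)
  qed (use u in simp)
qed

lemma component_spanning_tree:
  assumes E: "is_forest n E" and B: "B \<in> components_of n E"
  shows "{e\<in>E. e \<subseteq> B} \<in> spanning_trees B"
proof -
  have "(i, j) \<in> (adj {e\<in>E. e \<subseteq> B})\<^sup>*" if "i \<in> B" "j \<in> B" for i j
  proof -
    obtain k where k: "B = {j. j < n \<and> (k, j) \<in> (adj E)\<^sup>*}" using B by (auto simp: components_of_eq)
    then have "(k, i) \<in> (adj E)\<^sup>*" "(k, j) \<in> (adj E)\<^sup>*" using that by auto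
    then have "(i, j) \<in> (adj E)\<^sup>*" using rtrancl_adj_sym rtrancl_trans by metis
    then show ?thesis using rtrancl_adj_stays[of i j E B] that edge_in_component[OF E B] by blast
  qed
  moreover have "\<not> is_cycle {e\<in>E. e \<subseteq> B} vs" for vs
    using E is_cycle_mono[of "{e\<in>E. e \<subseteq> B}" vs E] by (auto simp: is_forest_def)
  ultimately show ?thesis using E by (auto simp: spanning_trees_def is_forest_def)
qed

text \<open>Blocks are disjoint, so an edge meeting a block belongs to the tree of that block.
  Walks, and in particular cycles, therefore never leave the block in which they start.\<close>

lemma union_of_trees:
  assumes \<pi>: "partition_on {..<n} \<pi>" and g': "\<forall>B\<in>\<pi>. g B \<in> spanning_trees B"
  defines "E \<equiv> \<Union>B\<in>\<pi>. g B"
  shows "is_forest n E" "components_of n E = \<pi>" "\<And>B. B \<in> \<pi> \<Longrightarrow> {e\<in>E. e \<subseteq> B} = g B"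
proof -
  note g = bspec[OF g']
  have edge: "e \<subseteq> B" "card e = 2" if "B \<in> \<pi>" "e \<in> g B" for e B
    using g[OF that(1)] that by (auto simp: spanning_trees_def)
  have same: "B = C" if "B \<in> \<pi>" "C \<in> \<pi>" "x \<in> B" "x \<in> C" for B C x
    using partition_on_same_block[OF \<pi>] that by blast
  have loc: "e \<subseteq> B" "e \<in> g B" if e: "e \<in> E" and B: "B \<in> \<pi>" and eB: "e \<inter> B \<noteq> {}" for e B
  proof -
    obtain C where C: "C \<in> \<pi>" "e \<in> g C" using e by (auto simp: E_def)
    obtain x where "x \<in> e" "x \<in> B" using eB by blast
    then have "B = C" using same[OF B C(1)] edge(1)[OF C] by blast
    then show "e \<subseteq> B" "e \<in> g B" using edge(1)[OF C] C by auto
  qed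
  show restr: "{e\<in>E. e \<subseteq> B} = g B" if B: "B \<in> \<pi>" for B
  proof
    show "g B \<subseteq> {e\<in>E. e \<subseteq> B}" using edge(1)[OF B] B by (auto simp: E_def)
    show "{e\<in>E. e \<subseteq> B} \<subseteq> g B"
    proof clarify
      fix e assume e: "e \<in> E" "e \<subseteq> B"
      then have "card e = 2" using edge(2) by (auto simp: E_def)
      then have "e \<noteq> {}" by auto
      then have "e \<inter> B \<noteq> {}" using e(2) by blast
      then show "e \<in> g B" using loc e(1) B by blast
    qed
  qed
  have "\<not> is_cycle E vs" for vs
  proof
    assume c: "is_cycle E vs"
    then have len: "length vs \<ge> 3" by (simp add: is_cycle_def)
    have ce: "{vs ! k, vs ! (Suc k mod length vs)} \<in> E" if "k < length vs" for k
      using c that by (simp add: is_cycle_def)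
    obtain B where B: "B \<in> \<pi>" "{vs ! 0, vs ! (Suc 0 mod length vs)} \<in> g B"
    proof -
      have "0 < length vs" using len by linarith
      then show ?thesis using ce[of 0] that unfolding E_def by blast
    qed
    have in_B: "vs ! k \<in> B" if "k < length vs" for k
      using that
    proof (induction k)
      case 0
      then show ?case using edge(1)[OF B] by simp
    next
      case (Suc k)
      then have "{vs ! k, vs ! Suc k} \<in> E" "vs ! k \<in> B" using ce[of k] by auto
      then show ?case using loc(1)[of "{vs ! k, vs ! Suc k}" B] B by auto
    qed
    have "is_cycle (g B) vs"
      unfolding is_cycle_def
    proof (intro conjI allI impI)
      fix k assume k: "k < length vs"
      then have "{vs ! k, vs ! (Suc k mod length vs)} \<inter> B \<noteq> {}" using in_B by blast
      then show "{vs ! k, vs ! (Suc k mod length vs)} \<in> g B" by (rule loc(2)[OF ce[OF k] B(1)])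
    qed (use c in \<open>auto simp: is_cycle_def\<close>)
    then show False using g[OF B(1)] by (auto simp: spanning_trees_def)
  qed
  moreover have "e \<subseteq> {..<n} \<and> card e = 2" if "e \<in> E" for e
    using that edge \<pi> unfolding E_def partition_on_def by blast
  ultimately show "is_forest n E" by (auto simp: is_forest_def)
  have comp: "{j. j < n \<and> (i, j) \<in> (adj E)\<^sup>*} = B" if B: "B \<in> \<pi>" "i \<in> B" for i B
  proof
    show "{j. j < n \<and> (i, j) \<in> (adj E)\<^sup>*} \<subseteq> B"
      using rtrancl_adj_stays[of i _ E B] loc(1)[OF _ B(1)] B(2) by blast
    show "B \<subseteq> {j. j < n \<and> (i, j) \<in> (adj E)\<^sup>*}"
    proof
      fix j assume j: "j \<in> B"
      then have "(i, j) \<in> (adj (g B))\<^sup>*" using g[OF B(1)] B(2) by (auto simp: spanning_trees_def)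
      then have "(i, j) \<in> (adj E)\<^sup>*" by (rule rtrancl_adj_mono[rotated]) (use B in \<open>auto simp: E_def\<close>)
      moreover have "j < n" using \<pi> B j by (auto simp: partition_on_def)
      ultimately show "j \<in> {j. j < n \<and> (i, j) \<in> (adj E)\<^sup>*}" by simp
    qed
  qed
  show "components_of n E = \<pi>"
  proof
    show "components_of n E \<subseteq> \<pi>"
    proof
      fix C assume "C \<in> components_of n E"
      then obtain i where i: "i < n" "C = {j. j < n \<and> (i, j) \<in> (adj E)\<^sup>*}" by (auto simp: components_of_eq)
      then have "i \<in> \<Union>\<pi>" using \<pi> by (auto simp: partition_on_def)
      then obtain B where "B \<in> \<pi>" "i \<in> B" by blast
      then show "C \<in> \<pi>" using comp i by simp
    qed
    show "\<pi> \<subseteq> components_of n E"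
    proof
      fix B assume B: "B \<in> \<pi>"
      then obtain i where i: "i \<in> B" using \<pi> by (metis all_not_in_conv partition_onD3)
      then have "i < n" using B \<pi> by (auto simp: partition_on_def)
      then show "B \<in> components_of n E" using comp[OF B i] by (auto simp: components_of_eq)
    qed
  qed
qed

text \<open>A forest with component partition \<pi> amounts to one spanning tree for each block, and
  its weight is a product over blocks, so the sum distributes into a product of tree sums. The
  non-crossing condition concerns \<pi> alone.\<close>

theorem forest_sum_eq_nc_word:
  "complex_of_real (forest_sum x w) = nc_word (\<lambda>s. complex_of_real (forest_cumulant x s)) w"
proof -
  define n where "n = length w"
  let ?c = "\<lambda>B. x (comp_letter w B) ^ (card B - 1) / fact (card B - 1)"
  let ?F = "\<lambda>\<pi>. {E \<in> nc_forests w. components_of n E = \<pi>}"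
  have fin: "finite (nc_forests w)"
    by (rule finite_subset[of _ "Pow (Pow {..<length w})"]) (auto simp: nc_forests_def is_forest_def)
  have "forest_sum x w = (\<Sum>\<pi>\<in>nc_partitions {..<n}. \<Sum>E\<in>?F \<pi>. forest_weight x w E)"
    unfolding forest_sum_def
  proof (rule sum.group[symmetric])
    show "components_of n ` nc_forests w \<subseteq> nc_partitions {..<n}"
      using partition_on_components_of by (auto simp: nc_partitions_def nc_forests_def n_def)
  qed (auto simp: fin finite_nc_partitions)
  also have "\<dots> = (\<Sum>\<pi>\<in>nc_partitions {..<n}. \<Prod>B\<in>\<pi>. forest_cumulant x (read (nth w) B))"
  proof (rule sum.cong[OF refl])
    fix \<pi> assume \<pi>: "\<pi> \<in> nc_partitions {..<n}"
    then have po: "partition_on {..<n} \<pi>" and nc: "non_crossing \<pi>" by (auto simp: nc_partitions_def)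
    have fB: "finite B" "B \<noteq> {}" if "B \<in> \<pi>" for B
      using nc_partitions_finite(2)[OF \<pi> _ that] nc_partitionsD(2)[OF \<pi> that] by auto
    show "(\<Sum>E\<in>?F \<pi>. forest_weight x w E) = (\<Prod>B\<in>\<pi>. forest_cumulant x (read (nth w) B))"
    proof (cases "\<forall>B\<in>\<pi>. \<forall>i\<in>B. \<forall>j\<in>B. fst (w ! i) = fst (w ! j)")
      \<comment> \<open>A block with two letters supports no forest, and its cumulant is
        zero.\<close>
      case False
      then obtain B where B: "B \<in> \<pi>" "\<not> (\<forall>i\<in>B. \<forall>j\<in>B. fst (w ! i) = fst (w ! j))" by blast
      then have "?F \<pi> = {}" by (auto simp: nc_forests_def n_def)
      then have "(\<Sum>E\<in>?F \<pi>. forest_weight x w E) = 0" by (simp only: sum.empty)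
      moreover have "forest_cumulant x (read (nth w) B) = 0"
        using B fB[OF B(1)] by (auto simp: forest_cumulant_def)
      ultimately show ?thesis using nc_partitions_finite(1)[OF \<pi>] B(1) by (metis finite_lessThan prod_zero)
    next
      case True
      have F: "?F \<pi> = {E. is_forest n E \<and> components_of n E = \<pi>}"
        using True nc by (auto simp: nc_forests_def n_def)
      \<comment> \<open>Gluing trees and restricting a forest to blocks are inverse to each other;
        \<open>PiE\<close> fixes the choice functions outside \<pi>.\<close>
      have bij: "bij_betw (\<lambda>g. \<Union>B\<in>\<pi>. g B) (PiE \<pi> spanning_trees) (?F \<pi>)"
      proof (rule bij_betw_byWitness[where f' = "\<lambda>E. \<lambda>B\<in>\<pi>. {e\<in>E. e \<subseteq> B}"])
        show "\<forall>g\<in>PiE \<pi> spanning_trees. (\<lambda>B\<in>\<pi>. {e \<in> \<Union>B\<in>\<pi>. g B. e \<subseteq> B}) = g"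
        proof
          fix g assume g: "g \<in> PiE \<pi> spanning_trees"
          then have "\<forall>B\<in>\<pi>. g B \<in> spanning_trees B" by blast
          from union_of_trees(3)[OF po this]
          show "(\<lambda>B\<in>\<pi>. {e \<in> \<Union>B\<in>\<pi>. g B. e \<subseteq> B}) = g"
            using g by (intro ext) (auto simp: restrict_def PiE_def extensional_def)
        qed
        show "(\<lambda>g. \<Union>B\<in>\<pi>. g B) ` PiE \<pi> spanning_trees \<subseteq> ?F \<pi>"
          unfolding F using union_of_trees(1,2)[OF po] by blast
        show "\<forall>E\<in>?F \<pi>. (\<Union>B\<in>\<pi>. (\<lambda>B\<in>\<pi>. {e \<in> E. e \<subseteq> B}) B) = E"
          unfolding F
        proof clarify
          fix E assume E: "is_forest n E" "\<pi> = components_of n E"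
          have "\<exists>B\<in>\<pi>. e \<subseteq> B" if e: "e \<in> E" for e
          proof -
            have "e \<subseteq> {..<n}" "card e = 2" using E e by (auto simp: is_forest_def)
            then obtain u where "u \<in> e" "u < n" by (auto simp: card_2_iff)
            then obtain B where "B \<in> \<pi>" "u \<in> B" using po by (auto simp: partition_on_def)
            then show ?thesis using edge_in_component[OF E(1) _ e, of B] E(2) \<open>u \<in> e\<close> by blast
          qed
          then show "(\<Union>B\<in>components_of n E. (\<lambda>B\<in>components_of n E. {e \<in> E. e \<subseteq> B}) B) = E"
            using E(2) by auto
        qed
        show "(\<lambda>E. \<lambda>B\<in>\<pi>. {e \<in> E. e \<subseteq> B}) ` ?F \<pi> \<subseteq> PiE \<pi> spanning_trees"
          unfolding F using component_spanning_tree by auto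
      qed
      have "(\<Sum>E\<in>?F \<pi>. forest_weight x w E) =
        (\<Sum>g\<in>PiE \<pi> spanning_trees. forest_weight x w (\<Union>B\<in>\<pi>. g B))"
        by (rule sum.reindex_bij_betw[OF bij, symmetric])
      also have "\<dots> = (\<Sum>g\<in>PiE \<pi> spanning_trees. \<Prod>B\<in>\<pi>. (- 1) ^ card (same_sign (nth w) (g B)) * ?c B)"
      proof (rule sum.cong[OF refl])
        fix g assume "g \<in> PiE \<pi> spanning_trees"
        then have "\<forall>B\<in>\<pi>. g B \<in> spanning_trees B" by blast
        note * = union_of_trees[OF po this]
        have "same_sign_edges w (\<Union>B\<in>\<pi>. g B) B = card (same_sign (nth w) (g B))" if "B \<in> \<pi>" for B
          unfolding same_sign_edges_def same_sign_def *(3)[OF that, symmetric]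
          by (intro arg_cong[of _ _ card]) auto
        then show "forest_weight x w (\<Union>B\<in>\<pi>. g B) =
            (\<Prod>B\<in>\<pi>. (- 1) ^ card (same_sign (nth w) (g B)) * ?c B)"
          using *(2) by (simp add: forest_weight_def n_def)
      qed
      also have "\<dots> = (\<Prod>B\<in>\<pi>. \<Sum>E\<in>spanning_trees B. (- 1) ^ card (same_sign (nth w) E) * ?c B)"
        by (rule prod_sum_PiE[symmetric])
          (use nc_partitions_finite(1)[OF \<pi>] fB finite_spanning_trees in auto)
      also have "\<dots> = (\<Prod>B\<in>\<pi>. forest_cumulant x (read (nth w) B))"
      proof (rule prod.cong[OF refl])
        fix B assume B: "B \<in> \<pi>"
        have mono: "\<forall>a\<in>set (read (nth w) B). \<forall>b\<in>set (read (nth w) B). fst a = fst b"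
          unfolding set_read[OF fB(1)[OF B]] using True B by blast
        have ne: "read (nth w) B \<noteq> []" using fB[OF B] by (simp add: read_def)
        have "fst (hd (read (nth w) B)) = comp_letter w B"
        proof -
          have "hd (read (nth w) B) \<in> nth w ` B" using hd_in_set[OF ne] fB[OF B] by simp
          then obtain b where b: "b \<in> B" "hd (read (nth w) B) = w ! b" by blast
          have "(\<lambda>i. fst (w ! i)) ` B = (\<lambda>_. fst (w ! b)) ` B"
            using True B b(1) by (intro image_cong refl) blast
          then have "(\<lambda>i. fst (w ! i)) ` B = {fst (w ! b)}" using b(1) by blast
          then show ?thesis using b(2) by (simp add: comp_letter_def)
        qed
        then have "forest_cumulant x (read (nth w) B) = ?c B * tree_sum (nth w) B"
          unfolding forest_cumulant_def if_P[OF mono] length_read tree_sum_read[OF fB(1)[OF B]] by simp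
        then show "(\<Sum>E\<in>spanning_trees B. (- 1) ^ card (same_sign (nth w) E) * ?c B) =
            forest_cumulant x (read (nth w) B)"
          unfolding tree_sum_def sum_distrib_left by (simp only: mult.commute)
      qed
      finally show ?thesis .
    qed
  qed
  finally show ?thesis by (simp add: nc_word_def nc_sum_def n_def)
qed

section \<open>Refinement of single-letter words\<close>

definition sgn_letter :: "'b \<times> bool \<Rightarrow> real" where
  "sgn_letter a = (if snd a then - 1 else 1)"

lemma sgn_letter_sq: "sgn_letter a * sgn_letter a = 1"
  by (simp add: sgn_letter_def)

text \<open>With \<open>d\<close> the exponent sum, \<open>(length s - d^2) / 2\<close> is minus the
  sum of the products of signs over all pairs of positions.\<close>

definition linear_part :: "real \<Rightarrow> ('b \<times> bool) list \<Rightarrow> real" where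
  "linear_part y s = 1 + y * (real (length s) - (\<Sum>a\<leftarrow>s. sgn_letter a)\<^sup>2) / 2"

text \<open>One constant serves all short words and all sizes up to 1. On a monochrome word the head
  names the letter.\<close>

definition single_letter_approx ::
  "real \<Rightarrow> nat \<Rightarrow> ('b \<Rightarrow> real) \<Rightarrow> (('b \<times> bool) list \<Rightarrow> complex) \<Rightarrow> bool" where
  "single_letter_approx C n y \<phi> \<longleftrightarrow> (\<forall>s. s \<noteq> [] \<longrightarrow> length s \<le> n \<longrightarrow> monochrome fst s \<longrightarrow>
     0 \<le> y (fst (hd s)) \<longrightarrow> y (fst (hd s)) \<le> 1 \<longrightarrow>
     norm (\<phi> s - complex_of_real (linear_part (y (fst (hd s))) s)) \<le> C * (y (fst (hd s)))\<^sup>2)"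

lemma is_cycle_card:
  assumes "is_cycle E vs" "\<And>e. e \<in> E \<Longrightarrow> e \<subseteq> V" "finite V"
  shows "3 \<le> card V"
proof -
  have "vs ! k \<in> V" if "k < length vs" for k
    using assms(1) assms(2)[of "{vs ! k, vs ! (Suc k mod length vs)}"] that by (simp add: is_cycle_def)
  then have "set vs \<subseteq> V" by (auto simp: in_set_conv_nth)
  then have "card (set vs) \<le> card V" using assms(3) by (intro card_mono)
  moreover have "card (set vs) = length vs" "3 \<le> length vs"
    using assms(1) by (auto simp: is_cycle_def distinct_card)
  ultimately show ?thesis by simp
qed

lemma spanning_trees_single: "spanning_trees {v} = {{}}"
proof -
  have "\<not> is_cycle {} vs" for vs using is_cycle_card[of "{}" vs "{}"] by fastforce
  moreover have "\<not> (e \<subseteq> {v} \<and> card e = 2)" for e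
    using card_mono[of "{v}" e] by auto
  ultimately show ?thesis by (auto simp: spanning_trees_def)
qed

lemma spanning_trees_pair:
  assumes "u \<noteq> v"
  shows "spanning_trees {u, v} = {{{u, v}}}"
proof -
  have e: "e \<subseteq> {u, v} \<and> card e = 2 \<longleftrightarrow> e = {u, v}" for e
    using assms card_subset_eq[of "{u, v}" e] by (auto simp: card_2_iff)
  have nc: "\<not> is_cycle {{u, v}} vs" for vs
    using is_cycle_card[of "{{u, v}}" vs "{u, v}"] assms by auto
  have c: "(u, v) \<in> (adj {{u, v}})\<^sup>*" "(v, u) \<in> (adj {{u, v}})\<^sup>*"
    by (auto simp: adj_def insert_commute)
  have "E = {{u, v}}" if E: "E \<in> spanning_trees {u, v}" for E
  proof -
    have "E \<subseteq> {{u, v}}" using E e by (auto simp: spanning_trees_def)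
    moreover have "E \<noteq> {}"
    proof
      assume "E = {}"
      then have "adj E = {}" by (simp add: adj_def)
      then show False using E assms by (auto simp: spanning_trees_def)
    qed
    ultimately show ?thesis by blast
  qed
  moreover have "{{u, v}} \<in> spanning_trees {u, v}"
    unfolding spanning_trees_def using nc c assms by auto
  ultimately show ?thesis by blast
qed

lemma forest_cumulant_single: "forest_cumulant x [a] = 1"
proof -
  have "{..<length [a]} = {0}" by auto
  then have "tree_sum (nth [a]) {..<length [a]} = 1"
    by (simp add: tree_sum_def spanning_trees_single same_sign_def)
  then show ?thesis by (simp add: forest_cumulant_def)
qed

text \<open>The only tree on two vertices is one edge, which counts -1 when the signs agree and 1
  otherwise.\<close>

lemma forest_cumulant_pair:
  assumes "fst a = fst b"
  shows "forest_cumulant x [a, b] = - x (fst a) * (sgn_letter a * sgn_letter b)"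
proof -
  have "{..<length [a, b]} = {0, 1::nat}" by auto
  then have "tree_sum (nth [a, b]) {..<length [a, b]} = (- 1) ^ card (same_sign (nth [a, b]) {{0, 1}})"
    by (simp add: tree_sum_def spanning_trees_pair)
  also have "same_sign (nth [a, b]) {{0, 1}} = (if snd a = snd b then {{0, 1}} else {})"
    by (auto simp: same_sign_def)
  finally show ?thesis using assms by (auto simp: forest_cumulant_def sgn_letter_def)
qed

lemma spanning_trees_subset: "spanning_trees V \<subseteq> Pow (Pow V)"
  by (auto simp: spanning_trees_def)

lemma card_spanning_trees: "finite V \<Longrightarrow> card (spanning_trees V) \<le> 2 ^ 2 ^ card V"
  using card_mono[of "Pow (Pow V)" "spanning_trees V"] spanning_trees_subset[of V]
  by (simp add: card_Pow)

text \<open>A crude count of trees, as sets of subsets of the vertices, is enough. What matters is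
  the exponent of \<open>x\<close>, which puts blocks of three or more points at second
  order.\<close>

lemma forest_cumulant_bound:
  assumes "0 \<le> x (fst (hd s))"
  shows "\<bar>forest_cumulant x s\<bar> \<le> 2 ^ 2 ^ length s * x (fst (hd s)) ^ (length s - 1)"
proof (cases "\<forall>a\<in>set s. \<forall>b\<in>set s. fst a = fst b")
  case True
  let ?y = "x (fst (hd s)) ^ (length s - 1)"
  have y: "0 \<le> ?y" using assms by simp
  have "\<bar>tree_sum (nth s) {..<length s}\<bar> \<le> (\<Sum>E\<in>spanning_trees {..<length s}. 1)"
    unfolding tree_sum_def by (rule order_trans[OF sum_abs]) (simp add: power_abs)
  also have "\<dots> \<le> 2 ^ 2 ^ length s"
    using of_nat_mono[OF card_spanning_trees[of "{..<length s}"], where 'a = real] by simp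
  finally have t: "\<bar>tree_sum (nth s) {..<length s}\<bar> \<le> 2 ^ 2 ^ length s" .
  have "?y / fact (length s - 1) \<le> ?y / 1"
    using y fact_ge_1[of "length s - 1", where 'a = real] by (intro divide_left_mono) auto
  then have "\<bar>?y / fact (length s - 1) * tree_sum (nth s) {..<length s}\<bar> \<le> ?y * 2 ^ 2 ^ length s"
    unfolding abs_mult using t y by (intro mult_mono) auto
  then show ?thesis unfolding forest_cumulant_def if_P[OF True] by (simp only: mult.commute)
next
  case False
  then have "forest_cumulant x s = 0" unfolding forest_cumulant_def by (rule if_not_P)
  then show ?thesis using assms by simp
qed

lemma sum_empty_singletons:
  fixes g :: "'i set \<Rightarrow> 'z::comm_monoid_add"
  assumes "finite M"
  shows "(\<Sum>S\<in>insert {} ((\<lambda>B. {B}) ` M). g S) = g {} + (\<Sum>B\<in>M. g {B})"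
  using assms by (subst sum.insert) (auto simp: sum.reindex)

text \<open>Keeps the partitions with at most one big block. The others are dominated by the terms
  of degree at least two in the binomial expansion of \<open>(1 + t) ^ card M\<close>.\<close>

lemma nc_sum_second_order:
  fixes t :: real
  assumes P: "finite P" and one: "\<And>i. i \<in> P \<Longrightarrow> \<kappa> [lab i] = 1"
    and M: "\<And>B. B \<in> M \<Longrightarrow> B \<subseteq> P \<and> card B \<ge> 2"
    and zero: "\<And>B. B \<subseteq> P \<Longrightarrow> card B \<ge> 2 \<Longrightarrow> B \<notin> M \<Longrightarrow> \<kappa> (read lab B) = 0"
    and t: "\<And>B. B \<in> M \<Longrightarrow> norm (\<kappa> (read lab B)) \<le> t" "0 \<le> t"
  shows "norm (nc_sum \<kappa> lab P - 1 - (\<Sum>B\<in>M. \<kappa> (read lab B))) \<le> (1 + t) ^ card M - 1 - card M * t"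
proof -
  let ?p = "\<lambda>S. \<Prod>B\<in>S. \<kappa> (read lab B)"
  let ?F = "big_families P \<inter> Pow M"
  let ?L = "insert {} ((\<lambda>B. {B}) ` M)"
  have finM: "finite M" using M P by (intro finite_subset[of M "Pow P"]) auto
  have single: "(\<lambda>x. {x}) ` P \<in> nc_partitions P"
    using partition_on_singletons by (auto simp: nc_partitions_def non_crossing_def)
  have "big_blocks ((\<lambda>x. {x}) ` P) = {}" by (auto simp: big_blocks_def)
  then have e: "{} \<in> big_families P" using single unfolding big_families_def by (metis imageI)
  have b: "{B} \<in> big_families P" if B: "B \<in> M" for B
  proof -
    \<comment> \<open>A single big block completed by singletons has no crossing, so each member of
      \<open>M\<close> forms a family by itself.\<close>
    let ?\<pi> = "insert B ((\<lambda>x. {x}) ` (P - B))"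
    have "B \<noteq> {}" using M[OF B] by auto
    then have "partition_on P ?\<pi>"
      using M[OF B] by (intro partition_onI) (auto simp: disjnt_def)
    moreover have "non_crossing ?\<pi>"
      unfolding non_crossing_def
    proof (intro ballI impI notI, elim exE conjE)
      fix S T a b c d
      assume *: "S \<in> ?\<pi>" "T \<in> ?\<pi>" "S \<noteq> T" "a < b" "b < c" "c < d" "a \<in> S" "b \<in> T" "c \<in> S" "d \<in> T"
      have "S = B" using *(1,4,5,7,9) by auto
      moreover have "T = B" using *(2,5,6,8,10) by auto
      ultimately show False using *(3) by simp
    qed
    ultimately have "?\<pi> \<in> nc_partitions P" by (simp add: nc_partitions_def)
    moreover have "big_blocks ?\<pi> = {B}" using M[OF B] by (auto simp: big_blocks_def)
    ultimately show ?thesis unfolding big_families_def by (metis imageI)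
  qed
  have L: "?L \<subseteq> ?F" using e b by auto
  have "nc_sum \<kappa> lab P = (\<Sum>S\<in>?F. ?p S)"
    by (rule nc_sum_support[OF P]) (fact one zero)+
  also have "\<dots> = (\<Sum>S\<in>?F - ?L. ?p S) + (\<Sum>S\<in>?L. ?p S)"
    by (rule sum.subset_diff[OF L]) (use finM in simp)
  also note sum_empty_singletons[OF finM]
  finally have "nc_sum \<kappa> lab P - 1 - (\<Sum>B\<in>M. \<kappa> (read lab B)) = (\<Sum>S\<in>?F - ?L. ?p S)" by simp
  also have "norm \<dots> \<le> (\<Sum>S\<in>?F - ?L. t ^ card S)"
  proof (rule sum_norm_le)
    fix S assume S: "S \<in> ?F - ?L"
    have "norm (?p S) \<le> (\<Prod>B\<in>S. t)"
      unfolding prod_norm[symmetric] by (rule prod_mono) (use S t in auto)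
    then show "norm (?p S) \<le> t ^ card S" by simp
  qed
  also have "\<dots> \<le> (\<Sum>S\<in>Pow M - ?L. t ^ card S)"
    using finM t(2) by (intro sum_mono2) auto
  also have "\<dots> = (1 + t) ^ card M - (1 + card M * t)"
  proof -
    have "(\<Sum>S\<in>Pow M. t ^ card S) = (\<Sum>S\<in>Pow M - ?L. t ^ card S) + (\<Sum>S\<in>?L. t ^ card S)"
      using finM by (intro sum.subset_diff) auto
    then show ?thesis using sum_empty_singletons[OF finM, of "\<lambda>S. t ^ card S"] sum_Pow_power[OF finM, of t] by simp
  qed
  finally show ?thesis by simp
qed

text \<open>Applies \<open>exp z - 1 \<le> z * exp z\<close> twice.\<close>

lemma exp_second_order:
  fixes z :: real
  assumes "0 \<le> z"
  shows "exp z - 1 - z \<le> z\<^sup>2 * exp z"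
proof -
  have "1 - z \<le> exp (- z)" using exp_ge_add_one_self[of "- z"] by simp
  then have "(1 - z) * exp z \<le> exp (- z) * exp z" by (intro mult_right_mono) auto
  then have *: "exp z - 1 \<le> z * exp z" by (simp add: exp_minus algebra_simps)
  then have "z * (exp z - 1) \<le> z * (z * exp z)" using assms by (intro mult_left_mono)
  with * show ?thesis by (simp add: power2_eq_square algebra_simps)
qed

text \<open>The second elementary symmetric polynomial in terms of power sums. For signs
  \<open>g\<close> on \<open>m\<close> points with sum \<open>d\<close> it equals
  \<open>(d^2 - m) / 2\<close>.\<close>

lemma sum_pairs:
  fixes g :: "nat \<Rightarrow> real"
  assumes "finite U"
  shows "(\<Sum>B | B \<subseteq> U \<and> card B = 2. \<Prod>i\<in>B. g i) = ((\<Sum>i\<in>U. g i)\<^sup>2 - (\<Sum>i\<in>U. g i * g i)) / 2"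
  using assms
proof (induction U rule: finite_induct)
  case empty
  have "{B. B \<subseteq> {} \<and> card B = 2} = ({} :: nat set set)" by auto
  then show ?case by simp
next
  case (insert x U)
  let ?A = "{B. B \<subseteq> U \<and> card B = 2}"
  let ?C = "(\<lambda>i. {x, i}) ` U"
  have "{B. B \<subseteq> insert x U \<and> card B = 2} = ?A \<union> ?C"
  proof (intro equalityI subsetI)
    fix B assume B: "B \<in> {B. B \<subseteq> insert x U \<and> card B = 2}"
    show "B \<in> ?A \<union> ?C"
    proof (cases "x \<in> B")
      case True
      then obtain i where "B = {x, i}" "i \<noteq> x" using B by (auto simp: card_2_iff doubleton_eq_iff)
      then show ?thesis using B by auto
    qed (use B in auto)
  qed (use insert.hyps in \<open>auto simp: card_insert_if\<close>)
  moreover have "?A \<inter> ?C = {}" using insert.hyps by auto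
  moreover have "finite ?A" using insert.hyps by (intro finite_subset[of ?A "Pow U"]) auto
  ultimately have "(\<Sum>B | B \<subseteq> insert x U \<and> card B = 2. \<Prod>i\<in>B. g i) =
      (\<Sum>B\<in>?A. \<Prod>i\<in>B. g i) + (\<Sum>B\<in>?C. \<Prod>i\<in>B. g i)"
    using insert.hyps by (simp add: sum.union_disjoint)
  also have "(\<Sum>B\<in>?C. \<Prod>i\<in>B. g i) = (\<Sum>i\<in>U. g x * g i)"
  proof (subst sum.reindex)
    show "inj_on (\<lambda>i. {x, i}) U" using insert.hyps by (auto simp: inj_on_def doubleton_eq_iff)
    have "(\<Prod>j\<in>{x, i}. g j) = g x * g i" if "i \<in> U" for i
      using that insert.hyps by (subst prod.insert) auto
    then show "sum ((\<lambda>B. prod g B) \<circ> (\<lambda>i. {x, i})) U = (\<Sum>i\<in>U. g x * g i)"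
      by (intro sum.cong) auto
  qed
  also have "(\<Sum>i\<in>U. g x * g i) = g x * sum g U" by (simp add: sum_distrib_left)
  finally show ?case using insert by (simp add: power2_eq_square field_simps)
qed

lemma sum_positions:
  fixes g :: "'l \<Rightarrow> real"
  shows "(\<Sum>i | i < length w \<and> Q (w ! i). g (w ! i)) = (\<Sum>a\<leftarrow>w. if Q a then g a else 0)"
proof -
  have "(\<Sum>i | i < length w \<and> Q (w ! i). g (w ! i)) = (\<Sum>i\<in>{0..<length w} \<inter> {i. Q (w ! i)}. g (w ! i))"
    by (intro sum.cong) auto
  also have "\<dots> = (\<Sum>i\<in>{0..<length w}. if Q (w ! i) then g (w ! i) else 0)"
    by (subst sum.inter_restrict) auto
  also have "\<dots> = (\<Sum>a\<leftarrow>w. if Q a then g a else 0)"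
    by (simp add: sum_list_sum_nth)
  finally show ?thesis .
qed

section \<open>Counting pieces in refined words\<close>

lemma refine_word_Nil [simp]: "refine_word K [] = []"
  by (simp add: refine_word_def)

lemma refine_word_append [simp]: "refine_word K (v @ w) = refine_word K v @ refine_word K w"
  by (simp add: refine_word_def)

lemma refine_word_Cons: "refine_word K (a # w) = refine_letter K a @ refine_word K w"
  by (simp add: refine_word_def)

lemma set_refine_letter: "set (refine_letter K a) = (\<lambda>j. ((fst a, j), snd a)) ` {1..K}"
  unfolding refine_letter_def by (cases "snd a") (auto simp: atLeastLessThanSuc_atLeastAtMost)

lemma set_refine_word: "set (refine_word K w) = (\<Union>a\<in>set w. (\<lambda>j. ((fst a, j), snd a)) ` {1..K})"
  by (simp add: refine_word_def set_refine_letter)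

lemma refine_letter_sum:
  fixes h :: "_ \<Rightarrow> 'z::comm_monoid_add"
  shows "(\<Sum>c\<leftarrow>refine_letter K a. h c) = (\<Sum>j\<in>{1..K}. h ((fst a, j), snd a))"
proof -
  have d: "distinct (refine_letter K a)"
    unfolding refine_letter_def by (auto simp: distinct_map inj_on_def)
  show ?thesis
    unfolding sum_list_distinct_conv_sum_set[OF d] set_refine_letter
    by (subst sum.reindex) (auto simp: inj_on_def)
qed

text \<open>Each occurrence of \<open>b\<close> contributes the piece \<open>k\<close> exactly once,
  with its own sign. Hence every colour class of a refined word has the size and the exponent sum of
  the letter it comes from, whatever \<open>K\<close> is.\<close>

lemma refine_word_colour_sum:
  fixes g :: "_ \<Rightarrow> real"
  assumes "1 \<le> k" "k \<le> K"
  shows "(\<Sum>c\<leftarrow>refine_word K w. if fst c = (b, k) then g c else 0) =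
    (\<Sum>a\<leftarrow>w. if fst a = b then g ((b, k), snd a) else 0)"
proof (induction w)
  case (Cons a w)
  have "(\<Sum>c\<leftarrow>refine_letter K a. if fst c = (b, k) then g c else 0) =
      (if fst a = b then g ((b, k), snd a) else 0)"
    using assms unfolding refine_letter_sum by (cases "fst a = b") (auto simp: sum.delta)
  then show ?case using Cons by (simp add: refine_word_Cons)
qed simp

lemma length_filter_sum: "real (length (filter Q v)) = (\<Sum>c\<leftarrow>v. if Q c then 1 else 0)"
  by (induction v) auto

lemma refine_word_occurrences:
  assumes "1 \<le> k" "k \<le> K"
  shows "length (filter (\<lambda>c. fst c = (b, k)) (refine_word K w)) = length (filter (\<lambda>a. fst a = b) w)"
proof -
  have "real (length (filter (\<lambda>c. fst c = (b, k)) (refine_word K w))) = real (length (filter (\<lambda>a. fst a = b) w))"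
    unfolding length_filter_sum refine_word_colour_sum[OF assms, of b "\<lambda>_. 1" w] ..
  then show ?thesis by simp
qed

lemma forest_cumulant_read_pair:
  assumes "card B = 2" "monochrome fst (read lab B)"
  shows "forest_cumulant x (read lab B) = - x (fst (hd (read lab B))) * (\<Prod>i\<in>B. sgn_letter (lab i))"
proof -
  obtain i j where B: "B = {i, j}" "i < j"
    using assms(1) unfolding card_2_iff by (metis insert_commute linorder_neqE_nat)
  have r: "read lab B = [lab i, lab j]"
    using read_Un[of "{i}" "{j}" lab] B by (simp add: read_def insert_commute)
  have "fst (lab i) = fst (lab j)" using monochromeD[OF assms(2)] r by simp
  then show ?thesis using B r forest_cumulant_pair[of "lab i" "lab j" x] by simp
qed

lemma forest_cumulant_not_monochrome: "\<not> monochrome fst s \<Longrightarrow> forest_cumulant x s = 0"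
  unfolding monochrome_def forest_cumulant_def by (rule if_not_P)

text \<open>With \<delta> = Y / K, each of the \<open>K\<close> pieces contributes \<delta> (m -
  d^2) / 2 through its pairs, and these add up to a term independent of \<open>K\<close>. Larger
  blocks cost O(K \<delta>^2) and products of several blocks O((K \<delta>)^2), both O(Y^2)
  uniformly in \<open>K\<close>.\<close>

theorem refined_forest_sum_single:
  "\<exists>C\<ge>0. \<forall>(y :: 'b \<Rightarrow> real) K. K \<ge> 1 \<longrightarrow>
     single_letter_approx C n y (\<lambda>s. complex_of_real (refined_forest_sum y s K))"
proof -
  \<comment> \<open>\<open>A\<close> bounds the number of trees on at most \<open>n\<close>
    vertices; the factor \<open>2 ^ n\<close> bounds the number of monochrome sets of one
    colour.\<close>
  define A where "A = (2 ^ 2 ^ n :: real)"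
  define D where "D = 2 ^ n * A"
  have AD: "0 \<le> A" "0 \<le> D" by (auto simp: A_def D_def)
  have "\<bar>refined_forest_sum y s K - (1 + Y * (real (length s) - d\<^sup>2) / 2)\<bar> \<le> (D\<^sup>2 * exp D + D) * Y\<^sup>2"
    if K: "K \<ge> 1" and s: "s \<noteq> []" "length s \<le> n" "monochrome fst s"
      and Y: "Y = y (fst (hd s))" "0 \<le> Y" "Y \<le> 1" and d: "d = (\<Sum>a\<leftarrow>s. sgn_letter a)"
    for y :: "'b \<Rightarrow> real" and s K Y d
  proof -
    define b where "b = fst (hd s)"
    define \<delta> where "\<delta> = Y / real K"
    define w where "w = refine_word K s"
    define x' where "x' = (\<lambda>(a, j::nat). y a / real K)"
    let ?P = "{..<length w}" and ?lab = "nth w" and ?M = "mono_sets fst w"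
    let ?\<kappa> = "\<lambda>B. forest_cumulant x' (read ?lab B)"
    have \<delta>: "0 \<le> \<delta>" "\<delta> \<le> 1" "real K * \<delta> = Y" using K Y by (auto simp: \<delta>_def field_simps)
    have colour: "\<exists>k. 1 \<le> k \<and> k \<le> K \<and> fst c = (b, k)" if c: "c \<in> set w" for c
    proof -
      obtain a j where "a \<in> set s" "j \<in> {1..K}" "c = ((fst a, j), snd a)"
        using c unfolding w_def set_refine_word by auto
      then show ?thesis using monochromeD[OF s(3), of a "hd s"] s(1) by (auto simp: b_def)
    qed
    then have x': "x' (fst c) = \<delta>" if "c \<in> set w" for c
      using that by (fastforce simp: x'_def \<delta>_def Y b_def)
    have occ: "length (filter (\<lambda>c'. fst c' = fst c) w) \<le> n" if c: "c \<in> set w" for c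
    proof -
      obtain k where "1 \<le> k" "k \<le> K" "fst c = (b, k)" using colour[OF c] by blast
      then show ?thesis unfolding w_def using refine_word_occurrences[of k K b s]
          order_trans[OF length_filter_le s(2), of "\<lambda>a. fst a = b"] by simp
    qed
    have cM: "real (card ?M) \<le> real K * 2 ^ n"
    proof -
      have "fst ` set w \<subseteq> Pair b ` {1..K}" using colour by fastforce
      then have "card (fst ` set w) \<le> card (Pair b ` {1..K})" by (intro card_mono) auto
      also have "\<dots> = K" by (simp add: card_image inj_on_def)
      finally have "card (fst ` set w) * 2 ^ n \<le> K * 2 ^ n" by simp
      moreover have "card ?M \<le> card (fst ` set w) * 2 ^ n" by (rule card_mono_sets(1)) (rule occ)
      ultimately have "card ?M \<le> K * 2 ^ n" by linarith
      then show ?thesis by (metis of_nat_le_iff of_nat_mult of_nat_numeral of_nat_power)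
    qed
    have hd: "x' (fst (hd (read ?lab B))) = \<delta>" if B: "B \<in> ?M" for B
      using x' mono_setsD(3,4)[OF B] by (meson hd_in_set subsetD)
    have bound: "\<bar>?\<kappa> B\<bar> \<le> A * \<delta> ^ (card B - 1)" if B: "B \<in> ?M" for B
    proof -
      have "\<bar>?\<kappa> B\<bar> \<le> 2 ^ 2 ^ card B * \<delta> ^ (card B - 1)"
        using forest_cumulant_bound[of x' "read ?lab B"] hd[OF B] \<delta>(1) by simp
      also have "\<dots> \<le> A * \<delta> ^ (card B - 1)"
        unfolding A_def using card_mono_sets(2)[of w fst n B] occ B \<delta>(1)
        by (intro mult_right_mono power_increasing) auto
      finally show ?thesis .
    qed
    have "norm (nc_sum (\<lambda>s. complex_of_real (forest_cumulant x' s)) ?lab ?P - 1 - (\<Sum>B\<in>?M. complex_of_real (?\<kappa> B)))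
        \<le> (1 + A * \<delta>) ^ card ?M - 1 - card ?M * (A * \<delta>)"
    proof (rule nc_sum_second_order)
      fix B assume "B \<subseteq> ?P" "2 \<le> card B" "B \<notin> ?M"
      then show "complex_of_real (?\<kappa> B) = 0"
        using forest_cumulant_not_monochrome by (auto simp: mono_sets_def)
    next
      fix B assume B: "B \<in> ?M"
      then have "\<delta> ^ (card B - 1) \<le> \<delta> ^ 1"
        using \<delta> by (intro power_decreasing) (auto simp: mono_sets_def)
      then have "A * \<delta> ^ (card B - 1) \<le> A * \<delta>" using AD by (simp add: mult_left_mono)
      then show "norm (complex_of_real (?\<kappa> B)) \<le> A * \<delta>" using bound[OF B] by simp
    qed (use AD \<delta> in \<open>auto simp: mono_sets_def forest_cumulant_single\<close>)
    also have "\<dots> \<le> exp (card ?M * (A * \<delta>)) - 1 - card ?M * (A * \<delta>)"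
    proof -
      have "(1 + A * \<delta>) ^ card ?M \<le> exp (A * \<delta>) ^ card ?M"
        using AD \<delta> by (intro power_mono) auto
      then show ?thesis by (simp add: exp_of_nat_mult)
    qed
    also have "\<dots> \<le> (card ?M * (A * \<delta>))\<^sup>2 * exp (card ?M * (A * \<delta>))"
      using AD \<delta> by (intro exp_second_order) auto
    also have "\<dots> \<le> (D * Y)\<^sup>2 * exp D"
    proof -
      have "card ?M * (A * \<delta>) \<le> (real K * 2 ^ n) * (A * \<delta>)"
        using cM AD \<delta> by (intro mult_right_mono) auto
      also have "\<dots> = D * Y" using \<delta>(3) by (simp add: D_def algebra_simps)
      finally have 1: "card ?M * (A * \<delta>) \<le> D * Y" .
      have 2: "D * Y \<le> D" using AD Y by (simp add: mult_left_le)
      have "0 \<le> card ?M * (A * \<delta>)" using AD \<delta>(1) by simp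
      then have "(card ?M * (A * \<delta>))\<^sup>2 \<le> (D * Y)\<^sup>2" using 1 by (intro power_mono)
      moreover have "exp (card ?M * (A * \<delta>)) \<le> exp D" using 1 2 by simp
      ultimately show ?thesis by (intro mult_mono) auto
    qed
    finally have 1: "\<bar>refined_forest_sum y s K - 1 - (\<Sum>B\<in>?M. ?\<kappa> B)\<bar> \<le> (D * Y)\<^sup>2 * exp D"
      using forest_sum_eq_nc_word[of x' w]
      unfolding nc_word_def refined_forest_sum_def x'_def[symmetric] w_def[symmetric]
      by (metis norm_of_real of_real_1 of_real_diff of_real_sum)
    let ?M2 = "{B \<in> ?M. card B = 2}"
    have "(\<Sum>B\<in>?M. ?\<kappa> B) = (\<Sum>B\<in>?M - ?M2. ?\<kappa> B) + (\<Sum>B\<in>?M2. ?\<kappa> B)"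
      by (rule sum.subset_diff) (auto simp: finite_mono_sets)
    \<comment> \<open>Blocks of at least three points carry at least the factor \<delta>^2, and
      there are O(K) of them.\<close>
    moreover have "\<bar>\<Sum>B\<in>?M - ?M2. ?\<kappa> B\<bar> \<le> D * Y\<^sup>2"
    proof -
      have "\<bar>\<Sum>B\<in>?M - ?M2. ?\<kappa> B\<bar> \<le> (\<Sum>B\<in>?M - ?M2. A * \<delta>\<^sup>2)"
      proof (rule order_trans[OF sum_abs sum_mono])
        fix B assume B: "B \<in> ?M - ?M2"
        then have "\<delta> ^ (card B - 1) \<le> \<delta> ^ 2"
          using \<delta> by (intro power_decreasing) (auto simp: mono_sets_def)
        then have "A * \<delta> ^ (card B - 1) \<le> A * \<delta>\<^sup>2" using AD by (simp add: mult_left_mono)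
        then show "\<bar>?\<kappa> B\<bar> \<le> A * \<delta>\<^sup>2" using bound B by fastforce
      qed
      also have "\<dots> = real (card (?M - ?M2)) * (A * \<delta>\<^sup>2)" by simp
      also have "\<dots> \<le> (real K * 2 ^ n) * (A * \<delta>\<^sup>2)"
      proof (rule mult_right_mono)
        have "card (?M - ?M2) \<le> card ?M" by (intro card_mono) (auto simp: finite_mono_sets)
        then show "real (card (?M - ?M2)) \<le> real K * 2 ^ n" using cM by linarith
      qed (use AD in auto)
      also have "\<dots> = D * (Y * \<delta>)" using \<delta>(3) by (simp add: D_def power2_eq_square algebra_simps)
      also have "\<dots> \<le> D * (Y * Y)"
      proof -
        have "\<delta> \<le> Y" using \<delta> K by (metis mult_le_cancel_right1 not_less of_nat_1 of_nat_mono)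
        then show ?thesis using AD Y by (intro mult_left_mono) auto
      qed
      finally show ?thesis by (simp add: power2_eq_square)
    qed
    moreover have "(\<Sum>B\<in>?M2. ?\<kappa> B) = Y * (real (length s) - d\<^sup>2) / 2"
    proof -
      let ?U = "\<lambda>k. {i. i < length w \<and> fst (w ! i) = (b, k)}"
      let ?g = "\<lambda>i. sgn_letter (w ! i)"
      \<comment> \<open>Monochrome pairs are sorted by the index of their piece, so that
        \<open>sum_pairs\<close> applies to each colour class.\<close>
      have M2: "?M2 = (\<Union>k\<in>{1..K}. {B. B \<subseteq> ?U k \<and> card B = 2})"
      proof (intro equalityI subsetI)
        fix B assume B: "B \<in> ?M2"
        then obtain a where a: "a \<in> set w" "B \<subseteq> {i. i < length w \<and> fst (w ! i) = fst a}"
          using mono_setsD(5)[of B fst w] by blast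
        obtain k where "1 \<le> k" "k \<le> K" "fst a = (b, k)" using colour[OF a(1)] by blast
        then show "B \<in> (\<Union>k\<in>{1..K}. {B. B \<subseteq> ?U k \<and> card B = 2})" using a B by auto
      next
        fix B assume "B \<in> (\<Union>k\<in>{1..K}. {B. B \<subseteq> ?U k \<and> card B = 2})"
        then obtain k where B: "B \<subseteq> ?U k" "card B = 2" by blast
        have "finite B" using B(1) finite_subset by fastforce
        then have "\<forall>c\<in>set (read ?lab B). fst c = (b, k)" using B(1) by auto
        then have "monochrome fst (read ?lab B)" unfolding monochrome_def by metis
        then show "B \<in> ?M2" using B by (auto simp: mono_sets_def)
      qed
      have "(\<Sum>B\<in>?M2. ?\<kappa> B) = (\<Sum>B\<in>?M2. - \<delta> * (\<Prod>i\<in>B. ?g i))"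
        using hd by (intro sum.cong refl) (auto simp: forest_cumulant_read_pair mono_sets_def)
      also have "\<dots> = (\<Sum>k\<in>{1..K}. \<Sum>B | B \<subseteq> ?U k \<and> card B = 2. - \<delta> * (\<Prod>i\<in>B. ?g i))"
        unfolding M2
      proof (rule sum.UNION_disjoint)
        show "\<forall>k\<in>{1..K}. finite {B. B \<subseteq> ?U k \<and> card B = 2}"
          by (auto intro!: finite_subset[of _ "Pow {..<length w}"])
        show "\<forall>k\<in>{1..K}. \<forall>l\<in>{1..K}. k \<noteq> l \<longrightarrow> {B. B \<subseteq> ?U k \<and> card B = 2} \<inter> {B. B \<subseteq> ?U l \<and> card B = 2} = {}"
        proof (intro ballI impI)
          fix k l :: nat assume "k \<noteq> l"
          then have d: "?U k \<inter> ?U l = {}" by auto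
          have "card B \<noteq> 2" if "B \<subseteq> ?U k" "B \<subseteq> ?U l" for B
          proof -
            have "B = {}" using d that by blast
            then show ?thesis by simp
          qed
          then show "{B. B \<subseteq> ?U k \<and> card B = 2} \<inter> {B. B \<subseteq> ?U l \<and> card B = 2} = {}" by blast
        qed
      qed simp
      also have "\<dots> = (\<Sum>k\<in>{1..K}. - \<delta> * ((d\<^sup>2 - real (length s)) / 2))"
      proof (rule sum.cong[OF refl])
        fix k assume k: "k \<in> {1..K}"
        have sb: "fst a = b" if "a \<in> set s" for a
          using monochromeD[OF s(3), of a "hd s"] that s(1) by (simp add: b_def)
        have "(\<Sum>i\<in>?U k. ?g i) = (\<Sum>a\<leftarrow>s. if fst a = b then sgn_letter ((b, k), snd a) else 0)"
          unfolding sum_positions[where w = w and Q = "\<lambda>c. fst c = (b, k)" and g = sgn_letter]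
          unfolding w_def using k by (intro refine_word_colour_sum) auto
        also have "\<dots> = (\<Sum>a\<leftarrow>s. sgn_letter a)"
          using sb by (intro arg_cong[of _ _ sum_list] map_cong) (auto simp: sgn_letter_def)
        finally have g: "(\<Sum>i\<in>?U k. ?g i) = d" by (simp add: d)
        have "(\<Sum>i\<in>?U k. ?g i * ?g i) = real (card (?U k))" by (simp add: sgn_letter_sq)
        also have "card (?U k) = length (filter (\<lambda>c. fst c = (b, k)) w)"
          by (simp add: length_filter_conv_card)
        also have "\<dots> = length (filter (\<lambda>a. fst a = b) s)"
          unfolding w_def using k by (intro refine_word_occurrences) auto
        also have "filter (\<lambda>a. fst a = b) s = s" using sb by (simp add: filter_id_conv)
        finally have "(\<Sum>i\<in>?U k. ?g i * ?g i) = real (length s)" .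
        then show "(\<Sum>B | B \<subseteq> ?U k \<and> card B = 2. - \<delta> * (\<Prod>i\<in>B. ?g i)) = - \<delta> * ((d\<^sup>2 - real (length s)) / 2)"
          using sum_pairs[of "?U k" ?g] g by (simp only: sum_distrib_left[symmetric]) simp
      qed
      also have "\<dots> = - (real K * \<delta>) * ((d\<^sup>2 - real (length s)) / 2)" by simp
      also have "\<dots> = Y * (real (length s) - d\<^sup>2) / 2" unfolding \<delta>(3) by (simp add: field_simps)
      finally show ?thesis .
    qed
    ultimately have "\<bar>refined_forest_sum y s K - (1 + Y * (real (length s) - d\<^sup>2) / 2)\<bar> \<le> (D * Y)\<^sup>2 * exp D + D * Y\<^sup>2"
      using 1 by linarith
    then show ?thesis by (simp add: power_mult_distrib algebra_simps)
  qed
  then show ?thesis using AD unfolding single_letter_approx_def linear_part_def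
    by (intro exI[of _ "D\<^sup>2 * exp D + D"]) (simp only: norm_of_real flip: of_real_diff, simp)
qed

section \<open>Convergence of the refined forest sums\<close>

lemma read_map:
  assumes "B \<subseteq> {..<length w}"
  shows "read (nth (map h w)) B = map h (read (nth w) B)"
proof -
  have "finite B" using assms finite_subset by blast
  then show ?thesis unfolding read_def using assms by auto
qed

lemma tree_sum_cong_sign:
  assumes "\<And>i. i \<in> V \<Longrightarrow> snd (lab i) = snd (lab' i)"
  shows "tree_sum lab V = tree_sum lab' V"
proof -
  have "same_sign lab E = same_sign lab' E" if "E \<in> spanning_trees V" for E
  proof -
    have "snd (lab i) = snd (lab' i)" if "i \<in> e" "e \<in> E" for i e
      using that \<open>E \<in> _\<close> assms by (auto simp: spanning_trees_def)
    then show ?thesis unfolding same_sign_def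
      by (intro Collect_cong conj_cong refl ball_cong) simp_all
  qed
  then show ?thesis unfolding tree_sum_def by simp
qed

lemma forest_cumulant_map:
  assumes inj: "inj_on g (fst ` set s)" and x: "\<And>c. c \<in> fst ` set s \<Longrightarrow> x (g c) = x' c" and "s \<noteq> []"
  shows "forest_cumulant x (map (apfst g) s) = forest_cumulant x' s"
proof -
  have "tree_sum (nth (map (apfst g) s)) {..<length s} = tree_sum (nth s) {..<length s}"
    by (rule tree_sum_cong_sign) simp
  moreover have "(\<forall>a\<in>set (map (apfst g) s). \<forall>b\<in>set (map (apfst g) s). fst a = fst b) \<longleftrightarrow>
      (\<forall>a\<in>set s. \<forall>b\<in>set s. fst a = fst b)"
  proof -
    have "(\<forall>a\<in>set (map (apfst g) s). \<forall>b\<in>set (map (apfst g) s). fst a = fst b) \<longleftrightarrow>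
        (\<forall>a\<in>set s. \<forall>b\<in>set s. g (fst a) = g (fst b))" by simp
    also have "\<dots> \<longleftrightarrow> (\<forall>a\<in>set s. \<forall>b\<in>set s. fst a = fst b)"
      by (intro ball_cong refl inj_on_eq_iff[OF inj]) auto
    finally show ?thesis .
  qed
  moreover have "x (fst (hd (map (apfst g) s))) = x' (fst (hd s))"
    using x[of "fst (hd s)"] \<open>s \<noteq> []\<close> by (simp add: hd_map)
  ultimately show ?thesis unfolding forest_cumulant_def by (simp only: length_map)
qed

text \<open>Injectivity is required only on the letters that occur: the later renaming
  \<open>split_index\<close> identifies the indices 0 and 1, but the indices in refined words start
  at 1.\<close>

lemma forest_sum_map:
  assumes inj: "inj_on g (fst ` set w)" and x: "\<And>c. c \<in> fst ` set w \<Longrightarrow> x (g c) = x' c"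
  shows "forest_sum x (map (apfst g) w) = forest_sum x' w"
proof -
  have "nc_word (\<lambda>s. complex_of_real (forest_cumulant x s)) (map (apfst g) w) =
      nc_word (\<lambda>s. complex_of_real (forest_cumulant x' s)) w"
    unfolding nc_word_def nc_sum_def length_map
  proof (intro sum.cong prod.cong refl arg_cong[of _ _ complex_of_real])
    fix \<pi> B assume *: "\<pi> \<in> nc_partitions {..<length w}" "B \<in> \<pi>"
    have B: "B \<subseteq> {..<length w}" "B \<noteq> {}" using nc_partitionsD[OF *] by auto
    then have "finite B" using finite_subset by blast
    then have sub: "set (read (nth w) B) \<subseteq> set w" and ne: "read (nth w) B \<noteq> []"
      using B by (auto simp: read_def)
    show "forest_cumulant x (read (nth (map (apfst g) w)) B) = forest_cumulant x' (read (nth w) B)"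
      unfolding read_map[OF B(1)]
    proof (rule forest_cumulant_map)
      have sub': "fst ` set (read (nth w) B) \<subseteq> fst ` set w" using sub by blast
      show "inj_on g (fst ` set (read (nth w) B))" by (rule inj_on_subset[OF inj sub'])
      show "x (g c) = x' c" if "c \<in> fst ` set (read (nth w) B)" for c
        by (rule x) (use that sub' in blast)
    qed (rule ne)
  qed
  then show ?thesis by (simp flip: forest_sum_eq_nc_word)
qed

lemma centred_comp_refine:
  "centred (\<lambda>v. \<phi> (refine_word K v)) acc ws = centred \<phi> (refine_word K acc) (map (refine_word K) ws)"
  by (induction ws arbitrary: acc) simp_all

lemma alternating_refine:
  assumes K: "K \<ge> 1" and alt: "alternating fst ws"
  shows "alternating (fst \<circ> fst) (map (refine_word K) ws)"
proof -
  have ne: "refine_word K W \<noteq> []" if "W \<in> set ws" for W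
  proof -
    have "hd W \<in> set W" using alt that by (auto simp: alternating_def)
    then have "((fst (hd W), 1), snd (hd W)) \<in> set (refine_word K W)"
      using K unfolding set_refine_word by force
    then show ?thesis by (metis empty_iff empty_set)
  qed
  have col: "fst (fst c) = fst (hd W)" if W: "W \<in> set ws" and c: "c \<in> set (refine_word K W)" for W c
  proof -
    obtain a where a: "a \<in> set W" "fst (fst c) = fst a" using c unfolding set_refine_word by auto
    moreover have "hd W \<in> set W" using a by (cases W) auto
    ultimately show ?thesis using monochromeD[of fst W a "hd W"] alt W by (simp add: alternating_def)
  qed
  have "monochrome (fst \<circ> fst) (refine_word K W)" if "W \<in> set ws" for W
    unfolding monochrome_def using col[OF that] by (metis comp_apply)
  moreover have "(fst \<circ> fst) (hd (refine_word K W)) = fst (hd W)" if "W \<in> set ws" for W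
    using col[OF that] ne[OF that] by simp
  then have "successively (\<lambda>V W. (fst \<circ> fst) (hd V) \<noteq> (fst \<circ> fst) (hd W)) (map (refine_word K) ws)"
    using alt unfolding alternating_def successively_map
    by (auto simp: successively_conv_nth)
  ultimately show ?thesis using ne by (auto simp: alternating_def)
qed

text \<open>Pieces are coloured by their parent letter. This is coarser than the colouring by
  pieces, so blocks that mix parents have cumulant zero all the more. Refinement respects
  concatenation and carries runs to runs, so freeness passes to the unrefined words.\<close>

theorem free_functional_refined:
  assumes "K \<ge> 1"
  shows "free_functional fst (\<lambda>s. complex_of_real (refined_forest_sum y s K))"
proof -
  let ?x = "\<lambda>(b, j::nat). y b / real K"
  let ?\<phi> = "\<lambda>w. complex_of_real (forest_sum ?x w)"
  have "free_functional (fst \<circ> fst) (nc_word (\<lambda>s. complex_of_real (forest_cumulant ?x s)))"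
  proof (rule free_functional_nc_word)
    fix s :: "('a \<times> nat) word" assume "\<not> monochrome (fst \<circ> fst) s"
    then have "\<not> monochrome fst s" unfolding monochrome_def comp_def by metis
    then show "complex_of_real (forest_cumulant ?x s) = 0" by (simp add: forest_cumulant_not_monochrome)
  qed
  then have free: "free_functional (fst \<circ> fst) ?\<phi>" by (simp add: forest_sum_eq_nc_word)
  show ?thesis
    unfolding free_functional_def
  proof (intro conjI allI impI)
    show "complex_of_real (refined_forest_sum y [] K) = 1"
      using free by (simp add: free_functional_def refined_forest_sum_def)
    fix ws :: "'a word list" assume "ws \<noteq> []" "alternating fst ws"
    then show "centred (\<lambda>s. complex_of_real (refined_forest_sum y s K)) [] ws = 0"
      using free alternating_refine[OF assms, of ws] centred_comp_refine[of ?\<phi> K "[]" ws]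
      by (simp add: free_functional_def refined_forest_sum_def)
  qed
qed

text \<open>No set of two or more positions is monochrome, and with \<open>M\<close> empty the error
  bound of \<open>nc_sum_second_order\<close> is 0.\<close>

lemma forest_sum_distinct:
  assumes "distinct (map fst w)"
  shows "forest_sum x w = 1"
proof -
  let ?\<kappa> = "\<lambda>s. complex_of_real (forest_cumulant x s)"
  have "norm (nc_sum ?\<kappa> (nth w) {..<length w} - 1 - (\<Sum>B\<in>{}. ?\<kappa> (read (nth w) B)))
      \<le> (1 + (0::real)) ^ card ({} :: nat set set) - 1 - real (card ({} :: nat set set)) * 0"
  proof (rule nc_sum_second_order)
    fix B assume B: "B \<subseteq> {..<length w}" "2 \<le> card B"
    have "\<not> monochrome fst (read (nth w) B)"
    proof
      assume m: "monochrome fst (read (nth w) B)"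
      have fin: "finite B" using B(1) finite_subset by blast
      obtain i j where ij: "i \<in> B" "j \<in> B" "i \<noteq> j"
        using B(2) fin by (metis card_le_Suc0_iff_eq not_less_eq_eq numeral_2_eq_2)
      have "fst (w ! i) = fst (w ! j)" using monochromeD[OF m] ij fin by simp
      moreover have "i < length w" "j < length w" using ij B by auto
      ultimately show False using assms ij(3) nth_eq_iff_index_eq[of "map fst w" i j] by simp
    qed
    then show "?\<kappa> (read (nth w) B) = 0" by (simp add: forest_cumulant_not_monochrome)
  qed (auto simp: forest_cumulant_single)
  then have "complex_of_real (forest_sum x w) = 1"
    by (simp add: forest_sum_eq_nc_word nc_word_def)
  then show ?thesis by simp
qed

lemma refined_forest_sum_letter: "refined_forest_sum y [a] K = 1"
proof -
  have "distinct (map fst (refine_word K [a]))"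
    by (auto simp: refine_word_def refine_letter_def distinct_map inj_on_def)
  then show ?thesis unfolding refined_forest_sum_def by (rule forest_sum_distinct)
qed

lemma refine_word_one: "refine_word 1 w = map (apfst (\<lambda>b. (b, 1))) w"
  by (induction w) (auto simp: refine_word_def refine_letter_def)

text \<open>Makes the unrefined sum the case \<open>K = 1\<close>, to which
  \<open>refined_forest_sum_single\<close> and \<open>free_functional_refined\<close> apply.\<close>

lemma refined_forest_sum_one: "refined_forest_sum y s 1 = forest_sum y s"
  unfolding refined_forest_sum_def refine_word_one
  by (rule forest_sum_map) (auto simp: inj_on_def)

text \<open>The functional \<phi> on words in pieces stays abstract because two are needed: a
  further refinement, for the Cauchy property, and the normalized expectation of increments, for
  identifying the limit. It only has to be free, normalized on letters and correct to first
  order.\<close>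

theorem refined_close:
  fixes x :: "'a \<Rightarrow> real" and C :: real
  assumes x: "\<And>a. 0 < x a" and C: "0 \<le> C"
  shows "\<exists>D J\<^sub>0. \<forall>J\<ge>J\<^sub>0. \<forall>\<phi>. J \<ge> 1 \<longrightarrow> free_functional fst \<phi> \<longrightarrow> (\<forall>a. \<phi> [a] = 1) \<longrightarrow>
    single_letter_approx C (length w) (\<lambda>(a, j). x a / real J) \<phi> \<longrightarrow>
    norm (\<phi> (refine_word J w) - complex_of_real (refined_forest_sum x w J)) \<le> D / real J"
proof -
  define n where "n = length w"
  obtain C1 where C1: "C1 \<ge> 0" and est: "\<forall>(y :: 'a \<times> nat \<Rightarrow> real) K. K \<ge> 1 \<longrightarrow>
     single_letter_approx C1 n y (\<lambda>s. complex_of_real (refined_forest_sum y s K))"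
    using refined_forest_sum_single[where 'b = "'a \<times> nat", of n] by (elim exE conjE) (rule that)
  \<comment> \<open>\<open>C + C1\<close> compares \<phi> with the forest sum through their common
    linear part; \<open>n + n^2\<close> bounds the linear coefficient itself.\<close>
  define C' where "C' = C + C1 + real n + (real n)\<^sup>2"
  have C': "0 \<le> C'" using C C1 by (simp add: C'_def)
  define K where "K = stability_const (1 + C') n * C'"
  have K: "0 \<le> K" unfolding K_def using C' stability_const_ge_1[of "1 + C'" n] by simp
  \<comment> \<open>\<open>X\<close> dominates every value of a letter of \<open>w\<close>, so all
    pieces have size at most \<open>X / J\<close>.\<close>
  define X where "X = (\<Sum>l\<leftarrow>w. x (fst l))"
  have xX: "x (fst l) \<le> X" if "l \<in> set w" for l
    unfolding X_def using that x by (intro member_le_sum_list) (auto intro: less_imp_le)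
  have X0: "0 \<le> X" unfolding X_def using x by (intro sum_list_nonneg) (auto intro: less_imp_le)
  \<comment> \<open>At most \<open>n * J\<close> colours occur. \<open>D\<close> comes from the
    bound of \<open>free_functionals_close\<close> at \<open>e = X / J\<close>, where the number of
    colours cancels one of the two factors \<open>1 / J\<close>.\<close>
  define L where "L = real n * 2 ^ n"
  define D where "D = L * K * X\<^sup>2 * exp (L * (2 * K) * X)"
  have "norm (\<phi> (refine_word J w) - complex_of_real (refined_forest_sum x w J)) \<le> D / real J"
    if J: "J \<ge> nat \<lceil>(1 + C') * X\<rceil>" "J \<ge> 1" and free: "free_functional fst \<phi>" and one: "\<And>a. \<phi> [a] = 1"
      and app: "single_letter_approx C n (\<lambda>(a, j). x a / real J) \<phi>"
    for J and \<phi> :: "('a \<times> nat) word \<Rightarrow> complex"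
  proof -
    define e where "e = X / real J"
    define y where "y = (\<lambda>(a, j::nat). x a / real J)"
    define v where "v = refine_word J w"
    let ?\<psi> = "\<lambda>s. complex_of_real (refined_forest_sum y s 1)"
    \<comment> \<open>The threshold on \<open>J\<close> yields both \<open>e \<le> 1\<close> and
      \<open>C' * e \<le> 1\<close>, as \<open>free_functionals_close\<close> demands.\<close>
    have "(1 + C') * X \<le> real J" using J(1) by linarith
    then have "(1 + C') * X / real J \<le> 1" using J(2) by (simp add: divide_le_eq)
    moreover have "(1 + C') * X / real J = e + C' * e"
      unfolding e_def by (simp only: distrib_right add_divide_distrib mult_1 times_divide_eq_right)
    ultimately have le1: "e + C' * e \<le> 1" by linarith
    have e0: "0 \<le> e" unfolding e_def using X0 by simp
    then have "0 \<le> C' * e" using C' by simp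
    then have e: "0 \<le> e" "e \<le> 1" "C' * e \<le> 1" using le1 e0 by linarith+
    have vcol: "\<exists>l\<in>set w. \<exists>j\<in>{1..J}. fst c = (fst l, j)" if "c \<in> set v" for c
      using that unfolding v_def set_refine_word by force
    have cv: "real (card (fst ` set v) * 2 ^ n) \<le> L * real J"
    proof -
      have "fst ` set v \<subseteq> (fst ` set w) \<times> {1..J}" using vcol by fastforce
      then have "card (fst ` set v) \<le> card ((fst ` set w) \<times> {1..J})" by (intro card_mono) auto
      also have "\<dots> \<le> n * J"
        using card_image_le[of "set w" fst] card_length[of w] by (simp add: card_cartesian_product n_def)
      finally have "card (fst ` set v) * 2 ^ n \<le> n * J * 2 ^ n" by simp
      then have "real (card (fst ` set v) * 2 ^ n) \<le> real (n * J * 2 ^ n)" by (rule of_nat_mono)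
      then show ?thesis by (simp add: L_def mult.commute mult.left_commute)
    qed
    have "norm (\<phi> v - ?\<psi> v) \<le> real (card (fst ` set v) * 2 ^ n) * (K * e\<^sup>2) *
        exp (real (card (fst ` set v) * 2 ^ n) * (K * e + K * e\<^sup>2))"
    proof (rule free_functionals_close[OF C' free _ e, where n = n, folded K_def])
      show "free_functional fst ?\<psi>" by (rule free_functional_refined) simp
    next
      fix c assume "c \<in> set v"
      then obtain l :: "'a \<times> bool" and j where "j \<in> {1..J}" "fst c = (fst l, j)" using vcol by blast
      then show "length (filter (\<lambda>b. fst b = fst c) v) \<le> n"
        unfolding v_def using refine_word_occurrences[of j J "fst l" w]
          length_filter_le[of "\<lambda>a. fst a = fst l" w] by (simp add: n_def)
    next
      show "\<phi> [a] = 1 \<and> ?\<psi> [a] = 1" for a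
        using one by (simp add: refined_forest_sum_letter)
    next
      fix s assume s: "s \<noteq> []" "monochrome fst s" "set s \<subseteq> set v" "length s \<le> n"
      let ?Y = "x (fst (fst (hd s))) / real J"
      let ?d = "\<Sum>a\<leftarrow>s. sgn_letter a"
      let ?z = "?Y * (real (length s) - ?d\<^sup>2) / 2"
      have yY: "y (fst (hd s)) = ?Y" by (simp add: y_def case_prod_unfold)
      have "hd s \<in> set v" using s(1,3) by auto
      then obtain l :: "'a \<times> bool" and j where "l \<in> set w" "fst (hd s) = (fst l, j)" using vcol by blast
      then have "x (fst (fst (hd s))) \<le> X" using xX by simp
      then have Y: "0 \<le> ?Y" "?Y \<le> e" using x[of "fst (fst (hd s))"] J(2)
        by (auto simp: e_def divide_right_mono less_imp_le)
      have Y2: "?Y\<^sup>2 \<le> e\<^sup>2" using Y by (intro power_mono)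
      have approx: "norm (\<theta> s - complex_of_real (1 + ?z)) \<le> E * e\<^sup>2"
        if "single_letter_approx E n y \<theta>" "0 \<le> E" for E \<theta>
      proof -
        have "norm (\<theta> s - complex_of_real (1 + ?z)) \<le> E * ?Y\<^sup>2"
          using that(1)[unfolded single_letter_approx_def, rule_format, OF s(1,4,2)] Y e yY
          unfolding linear_part_def by simp
        then show ?thesis using mult_left_mono[OF Y2 that(2)] by linarith
      qed
      have 1: "norm (\<phi> s - complex_of_real (1 + ?z)) \<le> C * e\<^sup>2"
        using app C unfolding y_def[symmetric] by (rule approx)
      have 2: "norm (?\<psi> s - complex_of_real (1 + ?z)) \<le> C1 * e\<^sup>2"
        by (rule approx) (use est C1 in auto)
      have "norm (\<phi> s - ?\<psi> s) \<le> C * e\<^sup>2 + C1 * e\<^sup>2"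
        using norm_triangle_sub[of "\<phi> s - ?\<psi> s" "\<phi> s - complex_of_real (1 + ?z)"] 1 2
          norm_triangle_ineq4[of "\<phi> s - complex_of_real (1 + ?z)" "?\<psi> s - complex_of_real (1 + ?z)"]
        by simp
      also have "\<dots> \<le> C' * e\<^sup>2"
      proof -
        have "0 \<le> (real n + (real n)\<^sup>2) * e\<^sup>2" by simp
        then show ?thesis by (simp add: C'_def algebra_simps)
      qed
      finally have a: "norm (\<phi> s - ?\<psi> s) \<le> C' * e\<^sup>2" .
      have "\<bar>?z\<bar> \<le> e * (real n + (real n)\<^sup>2)"
      proof -
        have "\<bar>sum_list (map sgn_letter s)\<bar> \<le> real (length s)" for s :: "('a \<times> nat) word"
        proof (induction s)
          case (Cons a s)
          then show ?case by (simp add: sgn_letter_def) linarith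
        qed simp
        then have "\<bar>?d\<bar> \<le> real n" using s(4) by (meson of_nat_mono order_trans)
        then have "?d\<^sup>2 \<le> (real n)\<^sup>2" by (metis abs_ge_zero power2_abs power_mono)
        moreover have "\<bar>(l - q) / 2\<bar> \<le> N + M" if "0 \<le> l" "l \<le> N" "0 \<le> q" "q \<le> M" for l q N M :: real
          using that by (simp add: abs_le_iff)
        ultimately have "\<bar>(real (length s) - ?d\<^sup>2) / 2\<bar> \<le> real n + (real n)\<^sup>2"
          using s(4) by simp
        then have "\<bar>?Y\<bar> * \<bar>(real (length s) - ?d\<^sup>2) / 2\<bar> \<le> e * (real n + (real n)\<^sup>2)"
          using Y e by (intro mult_mono) auto
        then show ?thesis by (simp only: abs_mult[symmetric] times_divide_eq_right)
      qed
      moreover have "C1 * e\<^sup>2 \<le> C1 * e"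
        using e C1 by (intro mult_left_mono) (auto simp: power2_eq_square mult_left_le)
      moreover have "norm (?\<psi> s - 1) \<le> C1 * e\<^sup>2 + \<bar>?z\<bar>"
      proof -
        have "?\<psi> s - 1 = (?\<psi> s - complex_of_real (1 + ?z)) + complex_of_real ?z" by simp
        then have "norm (?\<psi> s - 1) \<le> norm (?\<psi> s - complex_of_real (1 + ?z)) + norm (complex_of_real ?z)"
          by (metis norm_triangle_ineq)
        then show ?thesis using 2 unfolding norm_of_real by linarith
      qed
      moreover have "0 \<le> C * e" using C e by simp
      ultimately have "norm (?\<psi> s - 1) \<le> C' * e" unfolding C'_def by (simp add: algebra_simps)
      with a show "norm (\<phi> s - ?\<psi> s) \<le> C' * e\<^sup>2 \<and> norm (?\<psi> s - 1) \<le> C' * e" by blast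
    qed
    also have "\<dots> \<le> (L * real J) * (K * e\<^sup>2) * exp ((L * real J) * (2 * K * e))"
    proof -
      have "e\<^sup>2 \<le> e" using e by (simp add: power2_eq_square mult_left_le)
      then have "K * e\<^sup>2 \<le> K * e" using K by (rule mult_left_mono)
      then have "K * e + K * e\<^sup>2 \<le> 2 * K * e" by simp
      moreover have "0 \<le> L" by (simp add: L_def)
      ultimately show ?thesis using cv K e
        by (intro mult_mono iffD2[OF exp_le_cancel_iff]) auto
    qed
    also have "\<dots> = D / real J"
    proof -
      have "real J \<noteq> 0" using J(2) by simp
      then have "real J * e = X" by (simp add: e_def)
      then have "(L * real J) * (K * e\<^sup>2) = L * K * X * e" "(L * real J) * (2 * K * e) = L * (2 * K) * X"
        by (simp_all add: power2_eq_square algebra_simps)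
      then show ?thesis by (simp add: D_def e_def power2_eq_square)
    qed
    finally show ?thesis
      by (simp only: v_def refined_forest_sum_one y_def) (simp only: refined_forest_sum_def)
  qed
  then show ?thesis unfolding n_def by blast
qed

section \<open>Iterated refinement and the Cauchy property\<close>

lemma refine_indices:
  assumes K: "K \<ge> 1"
  shows "concat (map (\<lambda>j. map (Pair j) [1..<Suc K]) [1..<Suc J]) =
    map (\<lambda>i. (Suc ((i - 1) div K), Suc ((i - 1) mod K))) [1..<Suc (J * K)]"
proof (induction J)
  case (Suc J)
  let ?f = "\<lambda>i. (Suc ((i - 1) div K), Suc ((i - 1) mod K))"
  have upt: "[1..<Suc (Suc J * K)] = [1..<Suc (J * K)] @ [Suc (J * K)..<Suc (J * K) + K]"
    using upt_add_eq_append[of 1 "Suc (J * K)" K] by (simp add: add.commute)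
  have "map (Pair (Suc J)) [1..<Suc K] = map ?f [Suc (J * K)..<Suc (J * K) + K]"
    by (rule nth_equalityI) (use K in \<open>auto simp del: upt_Suc\<close>)
  then show ?case using Suc by (simp only: upt upt_Suc_append map_append concat_append) simp
qed simp

lemma refine_letter_alt:
  "refine_letter J l = (if snd l then rev else id) (map (\<lambda>j. ((fst l, j), snd l)) [1..<Suc J])"
  by (simp add: refine_letter_def rev_map)

lemma concat_map_rev: "concat (map f (rev xs)) = rev (concat (map (\<lambda>x. rev (f x)) xs))"
  by (induction xs) simp_all

text \<open>Piece \<open>i\<close> among \<open>J * K\<close> is piece \<open>k\<close> of piece
  \<open>j\<close> when \<open>i - 1 = (j - 1) * K + (k - 1)\<close>: quotient and remainder,
  shifted to start at 1.\<close>

definition split_index :: "nat \<Rightarrow> 'a \<times> nat \<Rightarrow> ('a \<times> nat) \<times> nat" where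
  "split_index K = (\<lambda>(a, i). ((a, Suc ((i - 1) div K)), Suc ((i - 1) mod K)))"

text \<open>For an inverse letter both levels reverse their order, and together they reverse the
  whole sequence of pieces.\<close>

lemma refine_refine:
  assumes K: "K \<ge> 1"
  shows "refine_word K (refine_word J w) = map (apfst (split_index K)) (refine_word (J * K) w)"
proof (induction w)
  case (Cons l w)
  let ?h = "\<lambda>(j, k::nat). (((fst l, j :: nat), k), snd l)"
  have base: "concat (map (\<lambda>j. map (\<lambda>k. (((fst l, j), k), snd l)) [1..<Suc K]) [1..<Suc J]) =
      map (apfst (split_index K)) (map (\<lambda>j. ((fst l, j), snd l)) [1..<Suc (J * K)])"
    using arg_cong[OF refine_indices[OF K, of J], of "map ?h"]
    by (simp add: map_concat comp_def split_index_def del: upt_Suc)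
  have "refine_word K (refine_letter J l) = map (apfst (split_index K)) (refine_letter (J * K) l)"
  proof (cases "snd l")
    case True
    then have "refine_word K (refine_letter J l) =
        rev (concat (map (\<lambda>j. map (\<lambda>k. (((fst l, j), k), snd l)) [1..<Suc K]) [1..<Suc J]))"
      unfolding refine_word_def refine_letter_alt
      by (simp add: concat_map_rev rev_map comp_def del: upt_Suc)
    then show ?thesis using True unfolding base by (simp add: refine_letter_alt rev_map del: upt_Suc)
  next
    case False
    then have "refine_word K (refine_letter J l) =
        concat (map (\<lambda>j. map (\<lambda>k. (((fst l, j), k), snd l)) [1..<Suc K]) [1..<Suc J])"
      unfolding refine_word_def refine_letter_alt by (simp add: comp_def del: upt_Suc)
    then show ?thesis using False unfolding base by (simp add: refine_letter_alt del: upt_Suc)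
  qed
  then show ?case using Cons by (simp add: refine_word_Cons)
qed simp

lemma refined_forest_sum_refine:
  assumes K: "K \<ge> 1"
  shows "refined_forest_sum (\<lambda>(a, j). x a / real J) (refine_word J w) K = refined_forest_sum x w (J * K)"
proof -
  have "inj_on (split_index K) (fst ` set (refine_word (J * K) w))"
  proof (rule inj_onI)
    fix c d assume c: "c \<in> fst ` set (refine_word (J * K) w)" and d: "d \<in> fst ` set (refine_word (J * K) w)"
      and eq: "split_index K c = split_index K d"
    obtain a i where ai: "c = (a, i)" "1 \<le> i" using c unfolding set_refine_word by auto
    obtain b j where bj: "d = (b, j)" "1 \<le> j" using d unfolding set_refine_word by auto
    have "a = b" "(i - 1) div K = (j - 1) div K" "(i - 1) mod K = (j - 1) mod K"
      using eq by (simp_all add: ai bj split_index_def)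
    then have "i - 1 = j - 1" by (metis div_mult_mod_eq)
    then show "c = d" using ai bj \<open>a = b\<close> by simp
  qed
  moreover have "(\<lambda>(b, k). (case b of (a, j) \<Rightarrow> x a / real J) / real K) (split_index K c) =
      (\<lambda>(a, j). x a / real (J * K)) c" for c
    by (simp add: split_index_def case_prod_unfold)
  ultimately show ?thesis
    unfolding refined_forest_sum_def refine_refine[OF K] by (rule forest_sum_map)
qed

text \<open>Passing from \<open>J\<close> to \<open>J * K\<close> pieces costs at most
  \<open>D / J\<close>, whatever \<open>K\<close> is; two arbitrary numbers of pieces are compared
  through their product.\<close>

theorem convergent_refined_forest_sum:
  fixes x :: "'a \<Rightarrow> real"
  assumes x: "\<And>a. 0 < x a"
  shows "convergent (refined_forest_sum x w)"
proof -
  obtain C where C: "C \<ge> 0" and est: "\<forall>(y :: 'a \<times> nat \<Rightarrow> real) K. K \<ge> 1 \<longrightarrow>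
     single_letter_approx C (length w) y (\<lambda>s. complex_of_real (refined_forest_sum y s K))"
    using refined_forest_sum_single[where 'b = "'a \<times> nat", of "length w"] by (elim exE conjE) (rule that)
  obtain D J\<^sub>0 where close: "\<forall>J\<ge>J\<^sub>0. \<forall>\<phi>. J \<ge> 1 \<longrightarrow> free_functional fst \<phi> \<longrightarrow> (\<forall>a. \<phi> [a] = 1) \<longrightarrow>
    single_letter_approx C (length w) (\<lambda>(a, j). x a / real J) \<phi> \<longrightarrow>
    norm (\<phi> (refine_word J w) - complex_of_real (refined_forest_sum x w J)) \<le> D / real J"
    using refined_close[where x = x and C = C and w = w, OF x C] by (elim exE) (rule that)
  have step: "\<bar>refined_forest_sum x w (J * K) - refined_forest_sum x w J\<bar> \<le> D / real J"
    if J: "J \<ge> J\<^sub>0" "J \<ge> 1" and K: "K \<ge> 1" for J K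
  proof -
    let ?y = "\<lambda>(a, j::nat). x a / real J"
    let ?\<phi> = "\<lambda>s. complex_of_real (refined_forest_sum ?y s K)"
    have "norm (?\<phi> (refine_word J w) - complex_of_real (refined_forest_sum x w J)) \<le> D / real J"
    proof (rule close[rule_format, OF J])
      show "free_functional fst ?\<phi>" by (rule free_functional_refined[OF K])
      show "?\<phi> [a] = 1" for a by (simp add: refined_forest_sum_letter)
      show "single_letter_approx C (length w) ?y ?\<phi>" using est K by blast
    qed
    then show ?thesis
      unfolding refined_forest_sum_refine[OF K] by (simp only: norm_of_real flip: of_real_diff)
  qed
  have "Cauchy (refined_forest_sum x w)"
  proof (rule CauchyI)
    fix e :: real assume e: "0 < e"
    obtain N where N: "real N > 2 * D / e" using reals_Archimedean2 by blast
    define M where "M = Suc (max N J\<^sub>0)"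
    have small: "D / real m < e / 2" if m: "m \<ge> M" for m
    proof -
      have "real N \<le> real m" "0 < real m" using m by (auto simp: M_def)
      then have "2 * D / e < real m" using N by linarith
      then show ?thesis using e \<open>0 < real m\<close> by (simp add: field_simps)
    qed
    have "norm (refined_forest_sum x w m - refined_forest_sum x w n) < e" if m: "m \<ge> M" and n: "n \<ge> M" for m n
    proof -
      have "\<bar>refined_forest_sum x w (m * n) - refined_forest_sum x w m\<bar> \<le> D / real m"
        using step[of m n] m n by (simp add: M_def)
      moreover have "\<bar>refined_forest_sum x w (m * n) - refined_forest_sum x w n\<bar> \<le> D / real n"
        using step[of n m] m n by (simp add: M_def mult.commute)
      ultimately show ?thesis using small[OF m] small[OF n] unfolding real_norm_def by linarith
    qed
    then show "\<exists>M. \<forall>m\<ge>M. \<forall>n\<ge>M. norm (refined_forest_sum x w m - refined_forest_sum x w n) < e" by blast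
  qed
  then show ?thesis by (simp add: Cauchy_convergent_iff)
qed

section \<open>Free multiplicative Brownian motion\<close>

definition first_order :: "(real \<Rightarrow> real) \<Rightarrow> real \<Rightarrow> bool" where
  "first_order f a \<longleftrightarrow> (\<exists>C\<ge>0. \<forall>t. 0 \<le> t \<longrightarrow> t \<le> 1 \<longrightarrow> \<bar>f t - (1 + a * t)\<bar> \<le> C * t\<^sup>2)"

lemma first_order_mult:
  assumes "first_order f a" "first_order g b"
  shows "first_order (\<lambda>t. f t * g t) (a + b)"
proof -
  obtain A where A: "0 \<le> A" "\<And>t. 0 \<le> t \<Longrightarrow> t \<le> 1 \<Longrightarrow> \<bar>f t - (1 + a * t)\<bar> \<le> A * t\<^sup>2"
    using assms(1) unfolding first_order_def by blast
  obtain B where B: "0 \<le> B" "\<And>t. 0 \<le> t \<Longrightarrow> t \<le> 1 \<Longrightarrow> \<bar>g t - (1 + b * t)\<bar> \<le> B * t\<^sup>2"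
    using assms(2) unfolding first_order_def by blast
  define C where "C = A * (1 + \<bar>b\<bar> + B) + (1 + \<bar>a\<bar>) * B + \<bar>a * b\<bar>"
  have "\<bar>f t * g t - (1 + (a + b) * t)\<bar> \<le> C * t\<^sup>2" if t: "0 \<le> t" "t \<le> 1" for t
  proof -
    have t2: "t\<^sup>2 \<le> 1" using t by (simp add: power_le_one)
    have "\<bar>b * t\<bar> \<le> \<bar>b\<bar>" "\<bar>a * t\<bar> \<le> \<bar>a\<bar>" using t by (simp_all add: abs_mult mult_left_le)
    moreover have "B * t\<^sup>2 \<le> B" using B(1) t2 by (simp add: mult_left_le)
    ultimately have g: "\<bar>g t\<bar> \<le> 1 + \<bar>b\<bar> + B" and a: "\<bar>1 + a * t\<bar> \<le> 1 + \<bar>a\<bar>"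
      using B(2)[OF t] by linarith+
    have "f t * g t - (1 + (a + b) * t) =
        (f t - (1 + a * t)) * g t + (1 + a * t) * (g t - (1 + b * t)) + a * b * t\<^sup>2"
      by (simp add: algebra_simps power2_eq_square)
    moreover have "\<bar>P + Q + R\<bar> \<le> \<bar>P\<bar> + \<bar>Q\<bar> + \<bar>R\<bar>" for P Q R :: real by linarith
    ultimately have "\<bar>f t * g t - (1 + (a + b) * t)\<bar> \<le> \<bar>(f t - (1 + a * t)) * g t\<bar> +
        \<bar>(1 + a * t) * (g t - (1 + b * t))\<bar> + \<bar>a * b * t\<^sup>2\<bar>"
      by simp
    also have "\<dots> = \<bar>f t - (1 + a * t)\<bar> * \<bar>g t\<bar> + \<bar>1 + a * t\<bar> * \<bar>g t - (1 + b * t)\<bar> + \<bar>a * b\<bar> * t\<^sup>2"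
      by (simp add: abs_mult)
    also have "\<dots> \<le> (A * t\<^sup>2) * (1 + \<bar>b\<bar> + B) + (1 + \<bar>a\<bar>) * (B * t\<^sup>2) + \<bar>a * b\<bar> * t\<^sup>2"
      using A B t g a by (intro add_mono mult_mono order_refl) auto
    also have "\<dots> = C * t\<^sup>2" by (simp add: C_def algebra_simps)
    finally show ?thesis .
  qed
  moreover have "0 \<le> C" using A B by (simp add: C_def)
  ultimately show ?thesis unfolding first_order_def by blast
qed

lemma first_order_exp:
  assumes "0 \<le> c"
  shows "first_order (\<lambda>t. exp (c * t)) c"
  unfolding first_order_def
proof (intro exI[of _ "c\<^sup>2 * exp c"] conjI allI impI)
  fix t :: real assume t: "0 \<le> t" "t \<le> 1"
  have "exp (c * t) - 1 - c * t \<le> (c * t)\<^sup>2 * exp (c * t)"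
    using assms t by (intro exp_second_order) simp
  also have "\<dots> \<le> (c * t)\<^sup>2 * exp c"
    using assms t by (intro mult_left_mono) (auto simp: mult_left_le)
  finally show "\<bar>exp (c * t) - (1 + c * t)\<bar> \<le> c\<^sup>2 * exp c * t\<^sup>2"
    using exp_ge_add_one_self[of "c * t"] by (simp add: power_mult_distrib algebra_simps)
qed simp

definition fmbm_poly :: "nat \<Rightarrow> real \<Rightarrow> real" where
  "fmbm_poly d t = (\<Sum>k<d. real (d choose (k + 1)) * real d powi (int k - 1) * (- t) ^ k / fact k)"

lemma first_order_fmbm_poly:
  assumes d: "d \<ge> 1"
  shows "first_order (fmbm_poly d) (- (real d * (real d - 1) / 2))"
proof -
  define c where "c k = real (d choose (k + 1)) * real d powi (int k - 1) / fact k" for k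
  define A where "A = (\<Sum>k<d. \<bar>c (k + 2)\<bar>)"
  \<comment> \<open>The terms \<open>k = d\<close> and \<open>k = Suc d\<close> vanish with their
    binomial coefficients; adding them lets two terms be split off even for
    \<open>d = 1\<close>.\<close>
  have expand: "fmbm_poly d t = c 0 - c 1 * t + (\<Sum>k<d. c (k + 2) * (- t) ^ (k + 2))" for t
  proof -
    have "fmbm_poly d t = (\<Sum>k<d. c k * (- t) ^ k)"
      by (simp add: fmbm_poly_def c_def)
    also have "\<dots> = (\<Sum>k<Suc (Suc d). c k * (- t) ^ k)"
    proof -
      have "c d = 0" "c (Suc d) = 0" by (simp_all add: c_def binomial_eq_0)
      then show ?thesis by simp
    qed
    also have "\<dots> = c 0 - c 1 * t + (\<Sum>k<d. c (k + 2) * (- t) ^ (k + 2))"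
      by (simp add: sum.lessThan_Suc_shift del: sum.lessThan_Suc)
    finally show ?thesis .
  qed
  have c0: "c 0 = 1" using d by (simp add: c_def power_int_minus)
  have c1: "c 1 = real d * (real d - 1) / 2"
  proof -
    have "real (d choose 2) = real d * (real d - 1) / 2"
      by (simp add: choose_two real_of_nat_div algebra_simps of_nat_diff d)
    then show ?thesis by (simp add: c_def numeral_2_eq_2)
  qed
  have "\<bar>fmbm_poly d t - (1 + - (real d * (real d - 1) / 2) * t)\<bar> \<le> A * t\<^sup>2" if t: "0 \<le> t" "t \<le> 1" for t
  proof -
    have "fmbm_poly d t - (1 + - (real d * (real d - 1) / 2) * t) = (\<Sum>k<d. c (k + 2) * (- t) ^ (k + 2))"
      unfolding expand c0 c1 by simp
    also have "\<bar>\<dots>\<bar> \<le> (\<Sum>k<d. \<bar>c (k + 2)\<bar> * t\<^sup>2)"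
    proof (rule order_trans[OF sum_abs sum_mono])
      fix k
      have "t ^ (k + 2) \<le> t ^ 2" using t by (intro power_decreasing) auto
      then show "\<bar>c (k + 2) * (- t) ^ (k + 2)\<bar> \<le> \<bar>c (k + 2)\<bar> * t\<^sup>2"
        using t unfolding abs_mult power_abs by (intro mult_left_mono) auto
    qed
    finally show ?thesis by (simp add: A_def sum_distrib_right)
  qed
  moreover have "0 \<le> A" unfolding A_def by (intro sum_nonneg) simp
  ultimately show ?thesis unfolding first_order_def by blast
qed

text \<open>At order 0 the formula in \<open>fmbm_moment\<close> is an empty sum, whereas the moment
  is 1.\<close>

definition unit_moment :: "real \<Rightarrow> nat \<Rightarrow> real" where
  "unit_moment t d = (if d = 0 then 1 else fmbm_moment t d)"

text \<open>The exponentials combine to \<open>exp ((m - d) / 2 * t)\<close>, and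
  \<open>(m - d) / 2 - d * (d - 1) / 2 = (m - d^2) / 2\<close> is the coefficient found for forests.
  The hypothesis keeps the exponent nonnegative.\<close>

lemma first_order_moment:
  assumes "d \<le> m"
  shows "first_order (\<lambda>t. exp (real m * t / 2) * unit_moment t d) ((real m - (real d)\<^sup>2) / 2)"
proof (cases "d = 0")
  case True
  then show ?thesis using first_order_exp[of "real m / 2"] by (simp add: unit_moment_def)
next
  case False
  then have "first_order (\<lambda>t. exp ((real m - real d) / 2 * t) * fmbm_poly d t)
      ((real m - real d) / 2 + - (real d * (real d - 1) / 2))"
    using assms by (intro first_order_mult first_order_exp first_order_fmbm_poly) auto
  moreover have e1: "exp ((real m - real d) / 2 * t) * fmbm_poly d t = exp (real m * t / 2) * unit_moment t d" for t
  proof -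
    have "exp ((real m - real d) / 2 * t) = exp (real m * t / 2) * exp (- real d * t / 2)"
      by (simp add: exp_add[symmetric] diff_divide_distrib algebra_simps)
    then show ?thesis using False by (simp add: unit_moment_def fmbm_moment_def fmbm_poly_def)
  qed
  moreover have e2: "(real m - real d) / 2 + - (real d * (real d - 1) / 2) = (real m - (real d)\<^sup>2) / 2"
    by (simp add: power2_eq_square field_simps)
  ultimately show ?thesis by (simp only: e1 e2)
qed

text \<open>Words of bounded length involve finitely many pairs \<open>(m, d)\<close>, so the sum of
  their constants serves all.\<close>

lemma moment_estimate:
  "\<exists>C\<ge>0. \<forall>m d t. m \<le> n \<longrightarrow> d \<le> m \<longrightarrow> 0 \<le> t \<longrightarrow> t \<le> 1 \<longrightarrow>
    \<bar>exp (real m * t / 2) * unit_moment t d - (1 + t * (real m - (real d)\<^sup>2) / 2)\<bar> \<le> C * t\<^sup>2"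
proof -
  have "\<forall>p. \<exists>C\<ge>0. snd p \<le> fst p \<longrightarrow> (\<forall>t. 0 \<le> t \<longrightarrow> t \<le> 1 \<longrightarrow>
     \<bar>exp (real (fst p) * t / 2) * unit_moment t (snd p) - (1 + (real (fst p) - (real (snd p))\<^sup>2) / 2 * t)\<bar> \<le> C * t\<^sup>2)"
    using first_order_moment unfolding first_order_def by (metis order_refl)
  then obtain c where c: "\<And>p. 0 \<le> c p" "\<And>p t. snd p \<le> fst p \<Longrightarrow> 0 \<le> t \<Longrightarrow> t \<le> 1 \<Longrightarrow>
     \<bar>exp (real (fst p) * t / 2) * unit_moment t (snd p) - (1 + (real (fst p) - (real (snd p))\<^sup>2) / 2 * t)\<bar> \<le> c p * t\<^sup>2"
    by metis
  define C where "C = (\<Sum>p\<in>{..n} \<times> {..n}. c p)"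
  have "\<bar>exp (real m * t / 2) * unit_moment t d - (1 + t * (real m - (real d)\<^sup>2) / 2)\<bar> \<le> C * t\<^sup>2"
    if "m \<le> n" "d \<le> m" "0 \<le> t" "t \<le> 1" for m d t
  proof -
    have "c (m, d) \<le> C" unfolding C_def using that c(1) by (intro member_le_sum) auto
    then have "c (m, d) * t\<^sup>2 \<le> C * t\<^sup>2" by (intro mult_right_mono) auto
    then show ?thesis using c(2)[of "(m, d)" t] that by (simp add: mult.commute)
  qed
  moreover have "0 \<le> C" unfolding C_def using c(1) by (intro sum_nonneg) auto
  ultimately show ?thesis by blast
qed

lemma successively_concatD:
  "successively Q (concat xss) \<Longrightarrow> xs \<in> set xss \<Longrightarrow> successively Q xs"
  by (induction xss) (auto simp: successively_append_iff)

lemma prod_list_concat: "prod_list (concat xss) = prod_list (map prod_list xss :: 'z::monoid_mult list)"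
  by (induction xss) simp_all

section \<open>Freeness in terms of functionals on words\<close>

context nc_prob_space
begin

lemma state_diff: "\<tau> (a - b) = \<tau> a - \<tau> b"
proof -
  have "\<tau> a = \<tau> ((a - b) + b)" by simp
  then show ?thesis by (simp only: state_add) simp
qed

lemma star_one: "star 1 = 1"
proof -
  have "star 1 = star 1 * star (star 1)" by (simp add: star_star)
  also have "\<dots> = star (star 1 * 1)" by (rule star_mult[symmetric])
  finally show ?thesis by (simp add: star_star)
qed

lemma star_prod_list: "star (prod_list xs) = prod_list (map star (rev xs))"
  by (induction xs) (simp_all add: star_one star_mult)

lemma star_alg_diff: "a \<in> star_alg X \<Longrightarrow> b \<in> star_alg X \<Longrightarrow> a - b \<in> star_alg X"
  using star_alg.add[OF _ star_alg.scale[of b X "- 1"], of a] by simp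

lemma star_alg_prod_list: "(\<And>y. y \<in> set ys \<Longrightarrow> y \<in> star_alg X) \<Longrightarrow> prod_list ys \<in> star_alg X"
  by (induction ys) (auto intro: star_alg.one star_alg.mult)

lemma star_alg_subset:
  assumes "X \<subseteq> star_alg Y"
  shows "star_alg X \<subseteq> star_alg Y"
proof
  fix z assume "z \<in> star_alg X"
  then show "z \<in> star_alg Y"
    by induction (use assms in \<open>auto intro: star_alg.intros\<close>)
qed

text \<open>Identifies the formal expansion \<open>centred\<close> with the state of an actual
  product of centred elements, to which the definition of freeness applies.\<close>

lemma centred_state:
  fixes g :: "'l \<Rightarrow> 'm"
  defines "\<phi> \<equiv> \<lambda>s. \<tau> (prod_list (map g s))"
  shows "centred \<phi> acc ws = \<tau> (prod_list (map g acc) *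
    prod_list (map (\<lambda>W. prod_list (map g W) - scale (\<phi> W) 1) ws))"
proof (induction ws arbitrary: acc)
  case Nil
  then show ?case by (simp add: \<phi>_def)
next
  case (Cons W ws)
  let ?R = "prod_list (map (\<lambda>W. prod_list (map g W) - scale (\<phi> W) 1) ws)"
  have "prod_list (map g acc) * ((prod_list (map g W) - scale (\<phi> W) 1) * ?R) =
      prod_list (map g (acc @ W)) * ?R - scale (\<phi> W) (prod_list (map g acc) * ?R)"
    by (simp add: algebra_simps scale_mult_left scale_mult_right)
  then show ?case by (simp add: Cons state_diff state_scale)
qed

text \<open>A run evaluates to an element of the algebra of its colour. Letters may be any elements
  of these algebras, which later admits scaled increments and their adjoints.\<close>

lemma free_functional_state:
  fixes g :: "'l \<Rightarrow> 'm" and col :: "'l \<Rightarrow> 'c"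
  assumes free: "free_sets UNIV X" and g: "\<And>l. g l \<in> star_alg (X (col l))"
  shows "free_functional col (\<lambda>s. \<tau> (prod_list (map g s)))"
  unfolding free_functional_def
proof (intro conjI allI impI)
  show "\<tau> (prod_list (map g [])) = 1" by (simp add: state_one)
  fix ws :: "'l list list" assume ne: "ws \<noteq> []" and alt: "alternating col ws"
  let ?\<phi> = "\<lambda>s. \<tau> (prod_list (map g s))"
  let ?y = "\<lambda>W. prod_list (map g W) - scale (?\<phi> W) 1"
  have "\<tau> (prod_list (map ?y ws)) = 0"
  proof (rule free[unfolded free_sets_def, rule_format], intro conjI allI impI)
    show "successively (\<noteq>) (map (\<lambda>W. col (hd W)) ws)"
      using alt by (simp add: alternating_def successively_map)
    show "map (\<lambda>W. col (hd W)) ws \<noteq> []" using ne by simp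
  next
    fix k assume "k < length (map (\<lambda>W. col (hd W)) ws)"
    then have k: "k < length ws" "ws ! k \<in> set ws" by auto
    have "col l = col (hd (ws ! k))" if "l \<in> set (ws ! k)" for l
      using alt k(2) that monochromeD[of col "ws ! k" l "hd (ws ! k)"] by (auto simp: alternating_def)
    then have "g l \<in> star_alg (X (col (hd (ws ! k))))" if "l \<in> set (ws ! k)" for l
      using g[of l] that by simp
    then have "prod_list (map g (ws ! k)) \<in> star_alg (X (col (hd (ws ! k))))"
      by (intro star_alg_prod_list) auto
    then show "map ?y ws ! k \<in> star_alg (X (map (\<lambda>W. col (hd W)) ws ! k))"
      using k by (simp add: star_alg_diff star_alg.scale star_alg.one)
    show "\<tau> (map ?y ws ! k) = 0"
      using k by (simp add: state_diff state_scale state_one)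
  qed simp_all
  then show "centred ?\<phi> [] ws = 0" using centred_state[of g "[]" ws] by simp
qed

lemma free_sets_reindex:
  assumes "free_sets UNIV X" "inj r"
  shows "free_sets UNIV (X \<circ> r)"
  unfolding free_sets_def
proof (intro allI impI, elim conjE)
  fix "is" and ys :: "'m list"
  assume *: "is \<noteq> []" "length is = length ys" "successively (\<noteq>) is"
    "\<forall>k<length is. ys ! k \<in> star_alg ((X \<circ> r) (is ! k)) \<and> \<tau> (ys ! k) = 0"
  have "successively (\<noteq>) (map r is)"
    using *(3) assms(2) by (simp add: successively_map inj_eq)
  with * show "\<tau> (prod_list ys) = 0"
    by (intro assms(1)[unfolded free_sets_def, rule_format, of "map r is"]) auto
qed

text \<open>Freeness is associative: consecutive increments of the same letter are multiplied first.\<close>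

lemma free_sets_increments:
  assumes bms: "free_mult_bms u" and h: "\<And>a. 0 \<le> h a"
  shows "free_sets UNIV (\<lambda>(a, j :: nat). {u a (real (Suc j) * h a) * star (u a (real j * h a))})"
  unfolding free_sets_def
proof (intro allI impI, elim conjE)
  let ?v = "\<lambda>a (j :: nat). u a (real (Suc j) * h a) * star (u a (real j * h a))"
  let ?X = "\<lambda>(a, j :: nat). {u a (real (Suc j) * h a) * star (u a (real j * h a))}"
  fix "is" and ys :: "'m list"
  assume ne: "is \<noteq> []" and len: "length is = length ys" and succ: "successively (\<noteq>) is"
    and ys: "\<forall>k<length is. ys ! k \<in> star_alg (?X (is ! k)) \<and> \<tau> (ys ! k) = 0"
  \<comment> \<open>Within a run the Brownian motion is fixed and only the increment index
    varies.\<close>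
  obtain zss where zss: "concat zss = zip is ys" "alternating (fst \<circ> fst) zss"
    using exists_runs by blast
  have mem: "snd z \<in> star_alg (?X (fst z)) \<and> \<tau> (snd z) = 0" if "z \<in> set (zip is ys)" for z
    using that ys len by (auto simp: set_zip)
  \<comment> \<open>Freeness of the increments of one motion makes the product over a run centred
    again, so that freeness between different motions applies to the product of the runs.\<close>
  have run: "prod_list (map snd R) \<in> star_alg (u (fst (fst (hd R))) ` {0..}) \<and> \<tau> (prod_list (map snd R)) = 0"
    if R: "R \<in> set zss" for R
  proof -
    define a where "a = fst (fst (hd R))"
    have Rne: "R \<noteq> []" and Rmono: "monochrome (fst \<circ> fst) R" using zss(2) R by (auto simp: alternating_def)
    have Rsub: "set R \<subseteq> set (zip is ys)" using R by (auto simp flip: zss(1))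
    have Ra: "fst (fst z) = a" if "z \<in> set R" for z
      using monochromeD[OF Rmono that, of "hd R"] Rne by (simp add: a_def)
    have Rz: "snd z \<in> star_alg {?v a (snd (fst z))}" "\<tau> (snd z) = 0" if z: "z \<in> set R" for z
      using mem[of z] Rsub z Ra[OF z] by (auto simp: case_prod_unfold)
    have bm: "free_mult_bm (u a)" using bms by (simp add: free_mult_bms_def)
    have "?v a j \<in> star_alg (u a ` {0..})" for j
      using h[of a] by (intro star_alg.mult star_alg.star star_alg.gen) auto
    then have sub: "star_alg {?v a j} \<subseteq> star_alg (u a ` {0..})" for j
      by (intro star_alg_subset) auto
    have 1: "prod_list (map snd R) \<in> star_alg (u a ` {0..})"
    proof (rule star_alg_prod_list)
      fix y assume "y \<in> set (map snd R)"
      then obtain z where "z \<in> set R" "y = snd z" by auto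
      then show "y \<in> star_alg (u a ` {0..})" using Rz(1)[of z] sub by blast
    qed
    define js where "js = map (snd \<circ> fst) R"
    \<comment> \<open>Increment \<open>j\<close> uses the times with indices \<open>j\<close> and
      \<open>Suc j\<close>, so the list of times must reach one index beyond the maximum.\<close>
    define N where "N = Suc (Suc (Max (set js)))"
    define ts where "ts = map (\<lambda>k. real k * h a) [0..<N]"
    have jsN: "Suc j < N" if "j \<in> set js" for j
    proof -
      have "j \<le> Max (set js)" using that by (intro Max_ge) auto
      then show ?thesis by (simp add: N_def)
    qed
    have ts: "sorted ts" "\<forall>t\<in>set ts. 0 \<le> t" "length ts = N"
      using h[of a] by (auto simp: ts_def sorted_iff_nth_mono mult_right_mono)
    have "free_sets {k. Suc k < length ts} (\<lambda>k. {u a (ts ! Suc k) * star (u a (ts ! k))})"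
      using bm ts(1,2) by (simp add: free_mult_bm_def)
    note fr = this[unfolded free_sets_def, rule_format, of js "map snd R"]
    have "\<tau> (prod_list (map snd R)) = 0"
    proof (rule fr, intro conjI allI impI)
      show "js \<noteq> []" "length js = length (map snd R)" using Rne by (simp_all add: js_def)
      show "set js \<subseteq> {k. Suc k < length ts}" using jsN ts(3) by auto
      have "successively (\<noteq>) (map fst (zip is ys))" using succ len by simp
      then have "successively (\<lambda>z z'. fst z \<noteq> fst z') (concat zss)"
        by (simp add: successively_map zss(1))
      then have sR: "successively (\<lambda>z z'. fst z \<noteq> fst z') R" using R by (rule successively_concatD)
      have "snd (fst z) \<noteq> snd (fst z')" if "z \<in> set R" "z' \<in> set R" "fst z \<noteq> fst z'" for z z'
      proof
        assume "snd (fst z) = snd (fst z')"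
        with Ra[OF that(1)] Ra[OF that(2)] have "fst z = fst z'" by (intro prod_eqI) simp_all
        with that(3) show False ..
      qed
      then have "successively (\<lambda>z z'. snd (fst z) \<noteq> snd (fst z')) R"
        by (rule successively_mono[OF sR])
      then show "successively (\<noteq>) js" by (simp add: js_def successively_map)
    next
      fix k assume "k < length js"
      then have k: "k < length R" "R ! k \<in> set R" "js ! k = snd (fst (R ! k))" "js ! k \<in> set js"
        by (auto simp: js_def)
      have "ts ! Suc (js ! k) = real (Suc (js ! k)) * h a" "ts ! (js ! k) = real (js ! k) * h a"
        using jsN[OF k(4)] by (simp_all add: ts_def del: upt_Suc of_nat_Suc)
      then show "map snd R ! k \<in> star_alg {u a (ts ! Suc (js ! k)) * star (u a (ts ! (js ! k)))}"
        using Rz(1)[OF k(2)] k by simp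
      show "\<tau> (map snd R ! k) = 0" using Rz(2)[OF k(2)] k by simp
    qed
    then show ?thesis using 1 by (simp add: a_def)
  qed
  have "free_sets UNIV (\<lambda>a. u a ` {0..})" using bms by (simp add: free_mult_bms_def)
  note fr = this[unfolded free_sets_def, rule_format, of "map (\<lambda>R. fst (fst (hd R))) zss"
      "map (\<lambda>R. prod_list (map snd R)) zss"]
  have "\<tau> (prod_list (map (\<lambda>R. prod_list (map snd R)) zss)) = 0"
  proof (rule fr, intro conjI allI impI)
    show "map (\<lambda>R. fst (fst (hd R))) zss \<noteq> []" using zss(1) ne len by (cases zss) auto
    show "successively (\<noteq>) (map (\<lambda>R. fst (fst (hd R))) zss)"
      using zss(2) by (simp add: alternating_def successively_map)
  next
    fix k assume "k < length (map (\<lambda>R. fst (fst (hd R))) zss)"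
    then have k: "k < length zss" "zss ! k \<in> set zss" by auto
    then show "map (\<lambda>R. prod_list (map snd R)) zss ! k \<in> star_alg (u (map (\<lambda>R. fst (fst (hd R))) zss ! k) ` {0..})"
      "\<tau> (map (\<lambda>R. prod_list (map snd R)) zss ! k) = 0"
      using run[OF k(2)] by simp_all
  qed simp_all
  moreover have "prod_list (map (\<lambda>R. prod_list (map snd R)) zss) = prod_list (map snd (concat zss))"
    by (simp add: map_concat prod_list_concat comp_def)
  ultimately show "\<tau> (prod_list ys) = 0" using len by (simp add: zss(1))
qed

end

section \<open>Words in Brownian increments\<close>

context nc_prob_space
begin

lemma unitary_mult:
  assumes "unitary a" "unitary b"
  shows "unitary (a * b)"
proof -
  have "star (a * b) * (a * b) = star b * (star a * a) * b" by (simp add: star_mult mult.assoc)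
  moreover have "(a * b) * star (a * b) = a * (b * star b) * star a" by (simp add: star_mult mult.assoc)
  ultimately show ?thesis using assms by (simp add: unitary_def)
qed

lemma unitary_star: "unitary a \<Longrightarrow> unitary (star a)"
  by (simp add: unitary_def star_star)

definition upow :: "'m \<Rightarrow> int \<Rightarrow> 'm" where
  "upow v k = (if 0 \<le> k then v ^ nat k else star v ^ nat (- k))"

lemma mult_upow:
  assumes v: "unitary v"
  shows "v * upow v k = upow v (k + 1)" "star v * upow v k = upow v (k - 1)"
proof -
  have c: "v * (star v * z) = z" "star v * (v * z) = z" for z
    using v by (simp_all add: unitary_def flip: mult.assoc)
  show "v * upow v k = upow v (k + 1)"
  proof (cases "0 \<le> k")
    case True
    then show ?thesis by (simp add: upow_def nat_add_distrib)
  next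
    case False
    define n where "n = nat (- k - 1)"
    have "k = - int (Suc n)" using False by (simp add: n_def)
    then show ?thesis using v by (cases n) (simp_all add: upow_def nat_add_distrib c unitary_def)
  qed
  show "star v * upow v k = upow v (k - 1)"
  proof (cases "0 < k")
    case True
    define n where "n = nat (k - 1)"
    have "k = int (Suc n)" using True by (simp add: n_def)
    then show ?thesis by (simp add: upow_def nat_add_distrib c)
  next
    case False
    then have "nat (1 - k) = Suc (nat (- k))" by simp
    then show ?thesis using False by (cases "k = 0") (simp_all add: upow_def)
  qed
qed

text \<open>This is why only the length and the exponent sum of a single-letter word enter the
  comparison with forests.\<close>

lemma prod_list_upow:
  assumes "unitary v"
  shows "prod_list (map (\<lambda>l. if snd l then star v else v) s) = upow v (\<Sum>l\<leftarrow>s. if snd l then - 1 else 1)"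
proof (induction s)
  case Nil
  then show ?case by (simp add: upow_def)
next
  case (Cons l s)
  then show ?case using mult_upow[OF assms] by (simp add: add.commute)
qed

text \<open>The moments of orders \<open>k\<close> and \<open>- k\<close> agree, so the sign of the
  exponent sum is immaterial.\<close>

lemma state_upow:
  assumes "is_fmbm_law t \<nu>" "has_distribution v \<nu>"
  shows "\<tau> (upow v k) = complex_of_real (unit_moment t (nat \<bar>k\<bar>))"
proof -
  have "\<tau> (v ^ n) = complex_of_real (unit_moment t n)" "\<tau> (star v ^ n) = complex_of_real (unit_moment t n)" for n
    using assms by (cases "n = 0"; simp add: is_fmbm_law_def has_distribution_def unit_moment_def state_one)+
  then show ?thesis by (simp add: upow_def)
qed

lemma prod_list_scale:
  "prod_list (map (\<lambda>l. scale (\<alpha> l) (b l)) s) = scale (prod_list (map \<alpha> s)) (prod_list (map b s))"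
  by (induction s) (simp_all add: scale_mult_left scale_mult_right)

lemma prod_list_exp:
  "prod_list (map (\<lambda>l. complex_of_real (exp (f l))) s) = complex_of_real (exp (\<Sum>l\<leftarrow>s. f l))"
  by (induction s) (simp_all add: exp_add)

definition increment :: "(real \<Rightarrow> 'm) \<Rightarrow> real \<Rightarrow> nat \<Rightarrow> 'm" where
  "increment u h j = u (real (Suc j) * h) * star (u (real j * h))"

lemma unitary_increment: "free_mult_bm u \<Longrightarrow> 0 \<le> h \<Longrightarrow> unitary (increment u h j)"
  unfolding increment_def by (intro unitary_mult unitary_star) (auto simp: free_mult_bm_def)

lemma increment_law:
  assumes "free_mult_bm u" "0 \<le> h"
  shows "\<exists>\<nu>. is_fmbm_law h \<nu> \<and> has_distribution (increment u h j) \<nu>"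
proof -
  have "0 \<le> real j * h" "real j * h \<le> real (Suc j) * h" using assms(2) by (auto intro: mult_right_mono)
  moreover have "real (Suc j) * h - real j * h = h" by (simp add: algebra_simps)
  ultimately show ?thesis using assms(1) unfolding free_mult_bm_def increment_def by metis
qed

text \<open>Telescoping down to \<open>u 0 = 1\<close>; later increments stand on the left, hence
  the reversed list.\<close>

lemma prod_list_increments:
  assumes u: "free_mult_bm u" and h: "0 \<le> h"
  shows "prod_list (map (increment u h) (rev [0..<J])) = u (real J * h)"
proof (induction J)
  case 0
  then show ?case using u by (simp add: free_mult_bm_def)
next
  case (Suc J)
  have "star (u (real J * h)) * u (real J * h) = 1"
    using u h by (simp add: free_mult_bm_def unitary_def)
  then show ?case using Suc by (simp add: increment_def mult.assoc del: of_nat_Suc)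
qed

definition value_letter :: "('c \<Rightarrow> 'm) \<Rightarrow> 'c \<times> bool \<Rightarrow> 'm" where
  "value_letter v l = (if snd l then star (v (fst l)) else v (fst l))"

text \<open>
  The first factor \<open>A\<^sub>1\<close> of a refined letter is the last increment, since the increments are
  multiplied from the left. The remaining values make the index map a bijection.
\<close>

definition flip_index :: "nat \<Rightarrow> nat \<Rightarrow> nat" where
  "flip_index J j = (if j = 0 then J else if j \<le> J then J - j else j)"

lemma inj_flip_index: "inj (flip_index J)"
  by (rule injI) (auto simp: flip_index_def split: if_splits)

lemma map_flip_index: "map (flip_index J) [1..<Suc J] = rev [0..<J]"
  by (rule nth_equalityI) (auto simp: flip_index_def rev_nth simp del: upt_Suc)

text \<open>For an inverse letter, \<open>star\<close> reverses the product of the pieces, in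
  accordance with the reversed order in \<open>refine_letter\<close>.\<close>

lemma value_refine_letter:
  assumes u: "free_mult_bm (u (fst l))" and h: "0 \<le> h (fst l)"
  shows "prod_list (map (value_letter (\<lambda>(a, j). increment (u a) (h a) (flip_index J j))) (refine_letter J l))
    = value_letter (\<lambda>a. u a (real J * h a)) l"
proof -
  let ?f = "\<lambda>j. increment (u (fst l)) (h (fst l)) (flip_index J j)"
  have pos: "prod_list (map ?f [1..<Suc J]) = u (fst l) (real J * h (fst l))"
    using prod_list_increments[OF u h, of J] unfolding map_flip_index[symmetric] by (simp add: comp_def del: upt_Suc)
  have "prod_list (map (\<lambda>j. star (?f j)) (rev [1..<Suc J])) = star (prod_list (map ?f [1..<Suc J]))"
    by (simp add: star_prod_list rev_map comp_def del: upt_Suc)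
  then show ?thesis using pos
    by (simp add: refine_letter_def value_letter_def comp_def del: upt_Suc)
qed

lemma value_refine_word:
  assumes u: "\<And>a. free_mult_bm (u a)" and h: "\<And>a. 0 \<le> h a"
  shows "prod_list (map (value_letter (\<lambda>(a, j). increment (u a) (h a) (flip_index J j))) (refine_word J w))
    = prod_list (map (value_letter (\<lambda>a. u a (real J * h a))) w)"
  by (induction w) (simp_all add: refine_word_Cons value_refine_letter[OF u h])

lemma word_expectation_eq:
  "word_expectation u x w = \<tau> (prod_list (map (value_letter (\<lambda>a. u a (x a))) w))"
  unfolding word_expectation_def value_letter_def by (simp add: case_prod_unfold)

lemma state_monochrome:
  assumes v: "unitary (v c)" and law: "is_fmbm_law t \<nu>" "has_distribution (v c) \<nu>"
    and s: "\<And>l. l \<in> set s \<Longrightarrow> fst l = c" and \<alpha>: "\<And>l. l \<in> set s \<Longrightarrow> \<alpha> l = t / 2"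
  shows "\<tau> (prod_list (map (\<lambda>l. scale (complex_of_real (exp (\<alpha> l))) (value_letter v l)) s)) =
    complex_of_real (exp (real (length s) * t / 2) * unit_moment t (nat \<bar>\<Sum>l\<leftarrow>s. if snd l then - 1 else 1 :: int\<bar>))"
proof -
  have "prod_list (map (value_letter v) s) = prod_list (map (\<lambda>l. if snd l then star (v c) else v c) s)"
    using s by (intro arg_cong[of _ _ prod_list] map_cong refl) (simp add: value_letter_def)
  moreover have "(\<Sum>l\<leftarrow>s. \<alpha> l) = real (length s) * t / 2"
  proof -
    have "(\<Sum>l\<leftarrow>s. \<alpha> l) = (\<Sum>l\<leftarrow>s. t / 2)"
      by (intro arg_cong[of _ _ sum_list] map_cong refl \<alpha>)
    also have "\<dots> = real (length s) * t / 2" by (simp add: sum_list_triv)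
    finally show ?thesis .
  qed
  ultimately show ?thesis
    by (simp add: prod_list_scale prod_list_exp state_scale prod_list_upow[OF v] state_upow[OF law])
qed

lemma sign_sum:
  fixes s :: "('c \<times> bool) list"
  shows "real (nat \<bar>\<Sum>l\<leftarrow>s. if snd l then - 1 else 1 :: int\<bar>) = \<bar>\<Sum>l\<leftarrow>s. sgn_letter l\<bar>"
    "nat \<bar>\<Sum>l\<leftarrow>s. if snd l then - 1 else 1 :: int\<bar> \<le> length s"
proof -
  have "real_of_int (\<Sum>l\<leftarrow>s. if snd l then - 1 else 1) = (\<Sum>l\<leftarrow>s. sgn_letter l)"
    by (induction s) (simp_all add: sgn_letter_def)
  then show "real (nat \<bar>\<Sum>l\<leftarrow>s. if snd l then - 1 else 1 :: int\<bar>) = \<bar>\<Sum>l\<leftarrow>s. sgn_letter l\<bar>"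
    by (simp add: flip: of_int_abs)
  have "\<bar>\<Sum>l\<leftarrow>s. if snd l then - 1 else 1 :: int\<bar> \<le> int (length s)"
    by (induction s) auto
  then show "nat \<bar>\<Sum>l\<leftarrow>s. if snd l then - 1 else 1 :: int\<bar> \<le> length s" by simp
qed

text \<open>The first term does not depend on \<open>J\<close>, since increments over time
  \<open>x a / J\<close> multiply to the motion at time \<open>x a\<close>. The estimate therefore
  identifies the limit of the forest sums.\<close>

theorem word_expectation_close:
  assumes bms: "free_mult_bms u" and x: "\<And>a. 0 < x a"
  shows "\<exists>D J\<^sub>0. \<forall>J\<ge>J\<^sub>0. J \<ge> 1 \<longrightarrow>
    norm (complex_of_real (exp ((\<Sum>l\<leftarrow>w. x (fst l)) / 2)) * word_expectation u x w -
      complex_of_real (refined_forest_sum x w J)) \<le> D / real J"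
proof -
  obtain C where C: "C \<ge> 0" and est: "\<forall>m d t. m \<le> length w \<longrightarrow> d \<le> m \<longrightarrow> 0 \<le> t \<longrightarrow> t \<le> 1 \<longrightarrow>
    \<bar>exp (real m * t / 2) * unit_moment t d - (1 + t * (real m - (real d)\<^sup>2) / 2)\<bar> \<le> C * t\<^sup>2"
    using moment_estimate[of "length w"] by (elim exE conjE) (rule that)
  obtain D J\<^sub>0 where close: "\<forall>J\<ge>J\<^sub>0. \<forall>\<phi>. J \<ge> 1 \<longrightarrow> free_functional fst \<phi> \<longrightarrow> (\<forall>a. \<phi> [a] = 1) \<longrightarrow>
    single_letter_approx C (length w) (\<lambda>(a, j). x a / real J) \<phi> \<longrightarrow>
    norm (\<phi> (refine_word J w) - complex_of_real (refined_forest_sum x w J)) \<le> D / real J"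
    using refined_close[where x = x and C = C and w = w, OF x C] by (elim exE) (rule that)
  have "norm (complex_of_real (exp ((\<Sum>l\<leftarrow>w. x (fst l)) / 2)) * word_expectation u x w -
      complex_of_real (refined_forest_sum x w J)) \<le> D / real J" if J: "J \<ge> J\<^sub>0" "J \<ge> 1" for J
  proof -
    define h where "h a = x a / real J" for a
    define v where "v = (\<lambda>(a, j). increment (u a) (h a) (flip_index J j))"
    \<comment> \<open>An increment over time \<open>h\<close> has mean \<open>exp (- h / 2)\<close>.
      The scaling gives single letters the value 1, and over the whole refined word it multiplies up
      to the exponential in the claim.\<close>
    define g where "g l = scale (complex_of_real (exp (h (fst (fst l)) / 2))) (value_letter v l)" for l
    let ?\<phi> = "\<lambda>s. \<tau> (prod_list (map g s))"
    have h: "0 \<le> h a" "real J * h a = x a" for a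
      using x[of a] J(2) by (simp_all add: h_def)
    have bm: "free_mult_bm (u a)" for a using bms by (simp add: free_mult_bms_def)
    \<comment> \<open>Increments are renumbered to match the order of the factors in a refined
      letter; an injective change of indices preserves freeness.\<close>
    have "free_sets UNIV ((\<lambda>(a, j). {u a (real (Suc j) * h a) * star (u a (real j * h a))}) \<circ> (\<lambda>(a, j). (a, flip_index J j)))"
    proof (rule free_sets_reindex[OF free_sets_increments[OF bms h(1)]])
      show "inj (\<lambda>(a, j). (a, flip_index J j))"
        using inj_flip_index[of J] by (auto simp: inj_on_def)
    qed
    also have "(\<lambda>(a, j). {u a (real (Suc j) * h a) * star (u a (real j * h a))}) \<circ> (\<lambda>(a, j). (a, flip_index J j)) = (\<lambda>c. {v c})"
      by (auto simp: v_def increment_def)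
    finally have free: "free_functional fst ?\<phi>"
      by (rule free_functional_state) (simp add: g_def value_letter_def star_alg.intros)
    have mono: "?\<phi> s = complex_of_real (exp (real (length s) * h a / 2) *
        unit_moment (h a) (nat \<bar>\<Sum>l\<leftarrow>s. if snd l then - 1 else 1 :: int\<bar>))"
      if s: "\<And>l. l \<in> set s \<Longrightarrow> fst l = (a, j)" for s a j
    proof -
      obtain \<nu> where "is_fmbm_law (h a) \<nu>" "has_distribution (v (a, j)) \<nu>"
        using increment_law[of "u a" "h a" "flip_index J j", OF bm h(1)] by (auto simp: v_def)
      moreover have "unitary (v (a, j))"
        using unitary_increment[of "u a" "h a", OF bm h(1)] by (simp add: v_def)
      ultimately show ?thesis unfolding g_def using s by (intro state_monochrome) auto
    qed
    have "norm (?\<phi> (refine_word J w) - complex_of_real (refined_forest_sum x w J)) \<le> D / real J"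
    proof (rule close[rule_format, OF J free])
      show "?\<phi> [l] = 1" for l
        using mono[of "[l]" "fst (fst l)" "snd (fst l)"]
        by (simp add: unit_moment_def fmbm_moment_def exp_minus)
      show "single_letter_approx C (length w) (\<lambda>(a, j). x a / real J) ?\<phi>"
        unfolding single_letter_approx_def
      proof (intro allI impI)
        fix s :: "('a \<times> nat) word"
        assume s: "s \<noteq> []" "length s \<le> length w" "monochrome fst s"
          "(\<lambda>(a, j). x a / real J) (fst (hd s)) \<le> 1"
        define a where "a = fst (fst (hd s))"
        let ?d = "nat \<bar>\<Sum>l\<leftarrow>s. if snd l then - 1 else 1 :: int\<bar>"
        have "fst l = (a, snd (fst (hd s)))" if "l \<in> set s" for l
          using monochromeD[OF s(3) that, of "hd s"] s(1) by (simp add: a_def)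
        then have \<phi>: "?\<phi> s = complex_of_real (exp (real (length s) * h a / 2) * unit_moment (h a) ?d)"
          by (rule mono)
        have "\<bar>exp (real (length s) * h a / 2) * unit_moment (h a) ?d -
            (1 + h a * (real (length s) - (real ?d)\<^sup>2) / 2)\<bar> \<le> C * (h a)\<^sup>2"
          using est[rule_format, OF s(2) sign_sum(2)[of s] h(1)] s(4) by (simp add: h_def a_def case_prod_unfold)
        moreover have d2: "(real ?d)\<^sup>2 = (\<Sum>l\<leftarrow>s. sgn_letter l)\<^sup>2"
          unfolding sign_sum(1) by (rule power2_abs)
        moreover have "(\<lambda>(a, j). x a / real J) (fst (hd s)) = h a"
          by (simp add: h_def a_def case_prod_unfold)
        ultimately show "norm (?\<phi> s - complex_of_real (linear_part ((\<lambda>(a, j). x a / real J) (fst (hd s))) s))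
            \<le> C * ((\<lambda>(a, j). x a / real J) (fst (hd s)))\<^sup>2"
          unfolding \<phi> linear_part_def d2 by (simp only: norm_of_real flip: of_real_diff)
      qed
    qed
    moreover have "?\<phi> (refine_word J w) = complex_of_real (exp ((\<Sum>l\<leftarrow>w. x (fst l)) / 2)) * word_expectation u x w"
    proof -
      have "(\<Sum>l\<leftarrow>refine_word J w. h (fst (fst l)) / 2) = (\<Sum>l\<leftarrow>w. x (fst l)) / 2"
        by (induction w) (simp_all add: refine_word_Cons refine_letter_sum h(2) add_divide_distrib)
      then show ?thesis
        unfolding g_def prod_list_scale prod_list_exp state_scale v_def value_refine_word[OF bm h(1)] h(2)
          word_expectation_eq by simp
    qed
    ultimately show ?thesis by simp
  qed
  then show ?thesis by blast
qed

end

theorem proposition7p8: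
  fixes x :: "'a \<Rightarrow> real" and w :: "'a word"
  assumes "\<And>a. 0 < x a"
  shows "convergent (refined_forest_sum x w) \<and>
    (\<forall>(scale :: complex \<Rightarrow> 'm::ring_1 \<Rightarrow> 'm) star \<tau> u.
       nc_prob_space scale star \<tau> \<longrightarrow> nc_prob_space.free_mult_bms scale star \<tau> u \<longrightarrow>
       complex_of_real (normalized_forest_poly x w) =
         nc_prob_space.word_expectation star \<tau> u x w)"
proof (intro conjI allI impI)
  show conv: "convergent (refined_forest_sum x w)"
    by (rule convergent_refined_forest_sum) (rule assms)
  fix scale :: "complex \<Rightarrow> 'm \<Rightarrow> 'm" and star \<tau> and u :: "'a \<Rightarrow> real \<Rightarrow> 'm"
  assume nc: "nc_prob_space scale star \<tau>" and bms: "nc_prob_space.free_mult_bms scale star \<tau> u"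
  interpret nc_prob_space scale star \<tau> by (rule nc)
  let ?s = "\<Sum>l\<leftarrow>w. x (fst l)"
  let ?L = "complex_of_real (exp (?s / 2)) * word_expectation u x w"
  obtain D J\<^sub>0 where D: "\<forall>J\<ge>J\<^sub>0. J \<ge> 1 \<longrightarrow>
      norm (?L - complex_of_real (refined_forest_sum x w J)) \<le> D / real J"
    using word_expectation_close[where w = w and x = x, OF bms assms] by (elim exE) (rule that)
  have "(\<lambda>J. complex_of_real (refined_forest_sum x w J)) \<longlonglongrightarrow> ?L"
  proof (rule Lim_transform_bound[OF _ lim_const_over_n[of D], THEN LIM_zero_cancel])
    show "\<forall>\<^sub>F J in sequentially. norm (complex_of_real (refined_forest_sum x w J) - ?L) \<le> norm (D / real J)"
    proof (rule eventually_sequentiallyI)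
      fix J assume "max J\<^sub>0 1 \<le> J"
      then have "norm (?L - complex_of_real (refined_forest_sum x w J)) \<le> D / real J" using D by simp
      also have "\<dots> \<le> norm (D / real J)" unfolding real_norm_def by (rule abs_ge_self)
      finally show "norm (complex_of_real (refined_forest_sum x w J) - ?L) \<le> norm (D / real J)"
        by (simp only: norm_minus_commute)
    qed
  qed
  \<comment> \<open>\<open>forest_poly\<close> is given by \<open>lim\<close>, which is a genuine
    limit by the convergence just shown.\<close>
  moreover have "(\<lambda>J. complex_of_real (refined_forest_sum x w J)) \<longlonglongrightarrow> complex_of_real (forest_poly x w)"
    using conv unfolding forest_poly_def convergent_LIMSEQ_iff by (rule tendsto_of_real)
  ultimately have "complex_of_real (forest_poly x w) = ?L" by (rule LIMSEQ_unique[rotated])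
  then have "complex_of_real (normalized_forest_poly x w) =
      complex_of_real (exp (- (1 / 2) * ?s) * exp (?s / 2)) * word_expectation u x w"
    by (simp add: normalized_forest_poly_def)
  also have "exp (- (1 / 2) * ?s) * exp (?s / 2) = 1" by (simp flip: exp_add)
  finally show "complex_of_real (normalized_forest_poly x w) = word_expectation u x w" by simp
qed

end
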